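(* Let $d\ge 1$ be an integer and let $(\Phi,K,\mu,T)$ be a self-conformal system on $\mathbb{R}^d$. Let $\mathcal{C}$ be a collection of $\mu$-measurable subsets of $\mathbb{R}^d$ and suppose there exist constants $C>0$ and $\delta>0$ such that $$\mu\big((\partial E)_{\varrho}\big)\le C\,\varrho^{\delta}\qquad\text{for all }\varrho>0\text{ and all }E\in\mathcal{C}.$$ Then $\mu$ is exponentially mixing with respect to $(T,\mathcal{C})$.
   Context: Self-conformal system. $|\cdot|$ is the Euclidean norm on $\mathbb{R}^d$; for a $d\times d$ matrix $A$, $|A|=\sup\{|Ax|:|x|=1\}$; $f'(x)$ is the Jacobian matrix. A $C^1$ map $f:\Omega\to\mathbb{R}^d$ on an open set $\Omega\subseteq\mathbb{R}^d$ is conformal if it is injective, $f'(x)\ne0$ and $|f'(x)y|=|f'(x)|\,|y|$ for all $x\in\Omega$, $y\in\mathbb{R}^d$. A $C^{1+\alpha}$ conformal IFS ($\alpha>0$) is a finite family $\Phi=\{\varphi_j\}_{1\le j\le m}$, $m\ge2$, for which there is a bounded connected open set $\Omega\subseteq\mathbb{R}^d$ such that each $\varphi_j:\Omega\to\Omega$ is an injective contractive conformal map with $\overline{\varphi_j(\Omega)}\subseteq\Omega$, $0<\inf_\Omega|\varphi_j'|\le\sup_\Omega|\varphi_j'|<1$, and $\big||\varphi_j'(x)|-|\varphi_j'(y)|\big|\le C|x-y|^\alpha$ on $\Omega$ for some constant $C$. $K\subseteq\Omega$ is the unique nonempty compact set with $K=\bigcup_{j}\varphi_j(K)$ (the self-conformal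 set). The open set condition (OSC): there is a nonempty open $V\subseteq\Omega$ with $\varphi_j(V)\subseteq V$ for all $j$ and $\varphi_i(V)\cap\varphi_j(V)=\emptyset$ for $i\ne j$. Gibbs measure on $K$: given $\alpha'>0$ and positive $\alpha'$-Hölder functions $g_j:\varphi_j(\Omega)\to(0,\infty)$ ($1\le j\le m$), let $\mathcal{L}:C(K)\to C(K)$, $(\mathcal{L}f)(x)=\sum_{j=1}^m g_j(\varphi_j(x))f(\varphi_j(x))$, with spectral radius $R$ and dual $\mathcal{L}^*$ acting on finite signed Borel measures on $K$. There are a unique positive $h\in C(K)$ and a unique Borel probability measure $\nu$ on $K$ with $\mathcal{L}h=Rh$, $\mathcal{L}^*\nu=R\nu$, $\int_K h\,d\nu=1$. The Gibbs measure is $d\mu=h\,d\nu$. The map $T$: let $\pi:\{1,\dots,m\}^{\mathbb{N}}\to K$, $\pi(i_1i_2\cdots)=\lim_{n}\varphi_{i_1}\circ\cdots\circ\varphi_{i_n}(x_0)$ (any $x_0\in K$), let $\sigma$ be the left shift and $\widetilde K=\{x\in K:\#\pi^{-1}(x)=1\}$. Define $T:\mathbb{R}^d\to\mathbb{R}^d$ by $T(x)=\pi(\sigma(\pi^{-1}(x)))$ if $x\in\widetilde K$ and $T(x)=x$ otherwise. A self-conformal system on $\mathbb{R}^d$ is a quadruple $(\Phi,K,\mu,T)$ with $\Phi$ a $C^{1+\alpha}$ conformal IFS (some $\alpha>0$) satisfying the OSC, $K$ its self-conformal set, $\mu$ a Gibbs measure on $K$ (with respect to some such potentials; viewed as a measure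 on $\mathbb{R}^d$; it is $T$-invariant), and $T:\mathbb{R}^d\to\mathbb{R}^d$ the map given by $T(x)=\pi(\sigma(\pi^{-1}(x)))$ for $x\in\widetilde K$ and $T(x)=x$ for $x\notin\widetilde K$. Exponential mixing: for a $T$-invariant probability measure $\mu$ and a collection $\mathcal{C}$ of measurable sets put $\phi(n)=\sup\{|\mu(E\cap T^{-n}F)/\mu(F)-\mu(E)|:E\in\mathcal{C},\ F\ \mu\text{-measurable},\ \mu(F)>0\}$. $\mu$ is exponentially mixing with respect to $(T,\mathcal{C})$ if there is $\gamma\in(0,1)$ with $\phi(n)=O(\gamma^n)$. $\partial E$ is the topological boundary of $E$ in $\mathbb{R}^d$ and $(E)_\varrho=\{x\in\mathbb{R}^d:\inf_{y\in E}|x-y|<\varrho\}$. *)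

theory Defs
  imports
    "HOL-Analysis.Analysis"
    "HOL-Probability.Probability"
    "HOL-Library.Landau_Symbols"
begin

section \<open>Conformal iterated function systems\<close>

text \<open>Maps defined only on an open set \<open>\<Omega>\<close> are represented by total functions; all conditions
  refer to their values on \<open>\<Omega>\<close>, where (as \<open>\<Omega>\<close> is open) the two-sided derivative is the
  derivative relative to \<open>\<Omega>\<close>.\<close>

definition jnorm :: "(real ^ 'n \<Rightarrow> real ^ 'n) \<Rightarrow> real ^ 'n \<Rightarrow> real" where
  "jnorm f x = onorm ((*v) (jacobian f (at x)))"

text \<open>The library's operator norm \<^const>\<open>onorm\<close> is a supremum of quotients; it is the supremum
  over the unit sphere.\<close>

lemma onorm_matrix_eq_SUP_sphere:
  fixes A :: "real ^ 'n ^ 'n"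
  shows "onorm ((*v) A) = (SUP x\<in>sphere 0 1. norm (A *v x))"
proof -
  obtain e :: "real ^ 'n" where e: "norm e = 1"
    using vector_choose_size[of 1] by auto
  have bl: "bounded_linear ((*v) A)" by simp
  have le: "norm (A *v x) \<le> onorm ((*v) A)" if "x \<in> sphere 0 1" for x
    using onorm[OF bl, of x] that by simp
  have bdd: "bdd_above ((\<lambda>x. norm (A *v x)) ` sphere 0 1)"
    using le by (intro bdd_aboveI2)
  show ?thesis
  proof (rule antisym)
    show "onorm ((*v) A) \<le> (SUP x\<in>sphere 0 1. norm (A *v x))"
    proof (rule onorm_le)
      fix x :: "real ^ 'n"
      show "norm (A *v x) \<le> (SUP x\<in>sphere 0 1. norm (A *v x)) * norm x"
      proof (cases "x = 0")
        case False
        define u where "u = x /\<^sub>R norm x"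
        have "u \<in> sphere 0 1" using False by (simp add: u_def)
        then have "norm (A *v u) \<le> (SUP x\<in>sphere 0 1. norm (A *v x))"
          by (rule cSUP_upper[OF _ bdd])
        moreover have "norm (A *v u) = norm (A *v x) / norm x"
          by (simp add: u_def matrix_vector_mult_scaleR divide_inverse mult.commute)
        ultimately show ?thesis using False by (simp add: divide_le_eq)
      qed simp
    qed
    show "(SUP x\<in>sphere 0 1. norm (A *v x)) \<le> onorm ((*v) A)"
      using e by (intro cSUP_least le) auto
  qed
qed

definition conformal_on :: "(real ^ 'n) set \<Rightarrow> (real ^ 'n \<Rightarrow> real ^ 'n) \<Rightarrow> bool" where
  "conformal_on \<Omega> f \<longleftrightarrow>
     open \<Omega> \<and>
     (\<forall>x\<in>\<Omega>. f differentiable (at x)) \<and>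
     continuous_on \<Omega> (\<lambda>x. jacobian f (at x)) \<and>
     inj_on f \<Omega> \<and>
     (\<forall>x\<in>\<Omega>. jacobian f (at x) \<noteq> 0 \<and>
        (\<forall>y. norm (jacobian f (at x) *v y) = jnorm f x * norm y))"

definition holder_on :: "real \<Rightarrow> 'a::metric_space set \<Rightarrow> ('a \<Rightarrow> real) \<Rightarrow> bool" where
  "holder_on \<alpha> S g \<longleftrightarrow> (\<exists>C. \<forall>x\<in>S. \<forall>y\<in>S. \<bar>g x - g y\<bar> \<le> C * dist x y powr \<alpha>)"

text \<open>Boundedness of \<open>jnorm\<close> is spelled out because \<open>SUP\<close> over an unbounded set of reals is
  unspecified.\<close>

definition conformal_IFS ::
  "real \<Rightarrow> (real ^ 'n) set \<Rightarrow> nat \<Rightarrow> (nat \<Rightarrow> real ^ 'n \<Rightarrow> real ^ 'n) \<Rightarrow> bool" where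
  "conformal_IFS \<alpha> \<Omega> m \<phi> \<longleftrightarrow>
     \<alpha> > 0 \<and> m \<ge> 2 \<and> bounded \<Omega> \<and> connected \<Omega> \<and> open \<Omega> \<and>
     (\<forall>j\<in>{1..m}.
        \<phi> j \<in> \<Omega> \<rightarrow> \<Omega> \<and>
        conformal_on \<Omega> (\<phi> j) \<and>
        (\<exists>c<1. c-lipschitz_on \<Omega> (\<phi> j)) \<and>
        closure (\<phi> j ` \<Omega>) \<subseteq> \<Omega> \<and>
        0 < (INF x\<in>\<Omega>. jnorm (\<phi> j) x) \<and>
        bdd_above (jnorm (\<phi> j) ` \<Omega>) \<and> (SUP x\<in>\<Omega>. jnorm (\<phi> j) x) < 1 \<and>
        holder_on \<alpha> \<Omega> (jnorm (\<phi> j)))"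

definition self_conformal_set ::
  "(real ^ 'n) set \<Rightarrow> nat \<Rightarrow> (nat \<Rightarrow> real ^ 'n \<Rightarrow> real ^ 'n) \<Rightarrow> (real ^ 'n) set \<Rightarrow> bool" where
  "self_conformal_set \<Omega> m \<phi> K \<longleftrightarrow>
     K \<noteq> {} \<and> compact K \<and> K \<subseteq> \<Omega> \<and> K = (\<Union>j\<in>{1..m}. \<phi> j ` K)"

definition open_set_condition ::
  "(real ^ 'n) set \<Rightarrow> nat \<Rightarrow> (nat \<Rightarrow> real ^ 'n \<Rightarrow> real ^ 'n) \<Rightarrow> bool" where
  "open_set_condition \<Omega> m \<phi> \<longleftrightarrow>
     (\<exists>V. V \<noteq> {} \<and> open V \<and> V \<subseteq> \<Omega> \<and>
        (\<forall>j\<in>{1..m}. \<phi> j ` V \<subseteq> V) \<and>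
        (\<forall>i\<in>{1..m}. \<forall>j\<in>{1..m}. i \<noteq> j \<longrightarrow> \<phi> i ` V \<inter> \<phi> j ` V = {}))"


section \<open>Gibbs measures\<close>

text \<open>The codomain is polymorphic so that the same formula gives the operator on real \<open>C(K)\<close>
  and its complexification, on which the spectrum is defined.\<close>

definition transfer_op ::
  "nat \<Rightarrow> (nat \<Rightarrow> 'a \<Rightarrow> 'a) \<Rightarrow> (nat \<Rightarrow> 'a \<Rightarrow> real) \<Rightarrow> ('a \<Rightarrow> 'b::real_vector) \<Rightarrow> 'a \<Rightarrow> 'b" where
  "transfer_op m \<phi> g f x = (\<Sum>j=1..m. g j (\<phi> j x) *\<^sub>R f (\<phi> j x))"

text \<open>\<^const>\<open>extensional\<close> makes elements of \<open>C(K)\<close> determined by their values on \<open>K\<close>.\<close>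

definition CK :: "'a::topological_space set \<Rightarrow> ('a \<Rightarrow> complex) set" where
  "CK K = {f \<in> extensional K. continuous_on K f}"

text \<open>For a bounded operator on the Banach space \<open>C(K)\<close>, a bijective \<open>z - L\<close> automatically has a
  bounded inverse.\<close>

definition CK_spectrum ::
  "'a::topological_space set \<Rightarrow> (('a \<Rightarrow> complex) \<Rightarrow> 'a \<Rightarrow> complex) \<Rightarrow> complex set" where
  "CK_spectrum K L = {z. \<not> bij_betw (\<lambda>f. \<lambda>x\<in>K. z * f x - L f x) (CK K) (CK K)}"

definition CK_spectral_radius ::
  "'a::topological_space set \<Rightarrow> (('a \<Rightarrow> complex) \<Rightarrow> 'a \<Rightarrow> complex) \<Rightarrow> real" where
  "CK_spectral_radius K L = (SUP z\<in>CK_spectrum K L. cmod z)"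

text \<open>The measure \<open>\<nu>\<close> lives on \<open>K\<close> with its Borel sets. The identity \<open>L\<^sup>* \<nu> = R \<nu>\<close> between finite
  signed measures is the identity of the functionals they define on \<open>C(K)\<close>. The Gibbs measure
  \<open>h d\<nu>\<close> is pushed forward along the inclusion of \<open>K\<close> to a Borel measure on the whole space.\<close>

definition gibbs_measure ::
  "(real ^ 'n) set \<Rightarrow> nat \<Rightarrow> (nat \<Rightarrow> real ^ 'n \<Rightarrow> real ^ 'n) \<Rightarrow> (real ^ 'n) set \<Rightarrow>
   (real ^ 'n) measure \<Rightarrow> bool" where
  "gibbs_measure \<Omega> m \<phi> K \<mu> \<longleftrightarrow>
     (\<exists>(\<alpha>'::real) g R h \<nu>.
        \<alpha>' > 0 \<and>
        (\<forall>j\<in>{1..m}. (\<forall>x\<in>\<phi> j ` \<Omega>. g j x > 0) \<and> holder_on \<alpha>' (\<phi> j ` \<Omega>) (g j)) \<and>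
        R = CK_spectral_radius K (transfer_op m \<phi> g) \<and>
        continuous_on K h \<and> (\<forall>x\<in>K. h x > 0) \<and>
        (\<forall>x\<in>K. transfer_op m \<phi> g h x = R * h x) \<and>
        prob_space \<nu> \<and> sets \<nu> = sets (restrict_space borel K) \<and>
        (\<forall>f::real ^ 'n \<Rightarrow> real. continuous_on K f \<longrightarrow>
           (\<integral>x. transfer_op m \<phi> g f x \<partial>\<nu>) = R * (\<integral>x. f x \<partial>\<nu>)) \<and>
        (\<integral>x. h x \<partial>\<nu>) = 1 \<and>
        \<mu> = distr (density \<nu> (\<lambda>x. ennreal (h x))) borel (\<lambda>x. x))"


section \<open>Coding and the induced map\<close>

text \<open>Infinite words are sequences indexed from \<open>0\<close>.\<close>

definition words :: "nat \<Rightarrow> (nat \<Rightarrow> nat) set" where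
  "words m = (UNIV \<rightarrow> {1..m})"

primrec cylinder_map :: "(nat \<Rightarrow> 'a \<Rightarrow> 'a) \<Rightarrow> (nat \<Rightarrow> nat) \<Rightarrow> nat \<Rightarrow> 'a \<Rightarrow> 'a" where
  "cylinder_map \<phi> i 0 = id"
| "cylinder_map \<phi> i (Suc n) = cylinder_map \<phi> i n \<circ> \<phi> (i n)"

definition coding ::
  "(nat \<Rightarrow> 'a \<Rightarrow> 'a) \<Rightarrow> 'a::topological_space set \<Rightarrow> (nat \<Rightarrow> nat) \<Rightarrow> 'a" where
  "coding \<phi> K i = (THE x. \<forall>x0\<in>K. (\<lambda>n. cylinder_map \<phi> i n x0) \<longlonglongrightarrow> x)"

definition shift :: "(nat \<Rightarrow> nat) \<Rightarrow> nat \<Rightarrow> nat" where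
  "shift i = (\<lambda>n. i (Suc n))"

definition uniquely_coded ::
  "nat \<Rightarrow> (nat \<Rightarrow> 'a \<Rightarrow> 'a) \<Rightarrow> 'a::topological_space set \<Rightarrow> 'a set" where
  "uniquely_coded m \<phi> K = {x \<in> K. card {i \<in> words m. coding \<phi> K i = x} = 1}"

definition induced_map ::
  "nat \<Rightarrow> (nat \<Rightarrow> 'a \<Rightarrow> 'a) \<Rightarrow> 'a::topological_space set \<Rightarrow> 'a \<Rightarrow> 'a" where
  "induced_map m \<phi> K x =
     (if x \<in> uniquely_coded m \<phi> K
      then coding \<phi> K (shift (the_inv_into (words m) (coding \<phi> K) x))
      else x)"


section \<open>Self-conformal systems and exponential mixing\<close>

text \<open>The family \<open>\<Phi>\<close> is given by \<open>m\<close> and \<open>\<phi>\<close> on the indices \<open>1, \<dots>, m\<close>. One and the same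
  \<open>\<Omega>\<close> serves as domain in all the conditions.\<close>

definition self_conformal_system ::
  "nat \<Rightarrow> (nat \<Rightarrow> real ^ 'n \<Rightarrow> real ^ 'n) \<Rightarrow> (real ^ 'n) set \<Rightarrow> (real ^ 'n) measure \<Rightarrow>
   (real ^ 'n \<Rightarrow> real ^ 'n) \<Rightarrow> bool" where
  "self_conformal_system m \<phi> K \<mu> T \<longleftrightarrow>
     (\<exists>\<Omega> \<alpha>. conformal_IFS \<alpha> \<Omega> m \<phi> \<and>
        open_set_condition \<Omega> m \<phi> \<and>
        self_conformal_set \<Omega> m \<phi> K \<and>
        gibbs_measure \<Omega> m \<phi> K \<mu> \<and>
        T = induced_map m \<phi> K)"

text \<open>The sets \<open>E\<close> and \<open>F\<close> range over sets measurable for the completion of the Borel measure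
  \<open>\<mu>\<close>. All quantities in the supremum lie in \<open>[0, 1]\<close> when \<open>\<mu>\<close> is invariant; inserting \<open>0\<close> only
  fixes the value for an empty collection.\<close>

definition mixing_coeff :: "'a measure \<Rightarrow> ('a \<Rightarrow> 'a) \<Rightarrow> 'a set set \<Rightarrow> nat \<Rightarrow> real" where
  "mixing_coeff \<mu> T \<C> n =
     Sup (insert 0
       {\<bar>measure (completion \<mu>) (E \<inter> (T ^^ n) -` F) / measure (completion \<mu>) F
          - measure (completion \<mu>) E\<bar> | E F.
        E \<in> \<C> \<and> F \<in> sets (completion \<mu>) \<and> measure (completion \<mu>) F > 0})"

definition invariant_measure :: "('a \<Rightarrow> 'a) \<Rightarrow> 'a measure \<Rightarrow> bool" where
  "invariant_measure T \<mu> \<longleftrightarrow> T \<in> measurable \<mu> \<mu> \<and> distr \<mu> \<mu> T = \<mu>"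

text \<open>Exponential mixing is only defined for invariant probability measures and measurable
  collections; these requirements are part of the predicate.\<close>

definition exponentially_mixing :: "'a measure \<Rightarrow> ('a \<Rightarrow> 'a) \<Rightarrow> 'a set set \<Rightarrow> bool" where
  "exponentially_mixing \<mu> T \<C> \<longleftrightarrow>
     prob_space \<mu> \<and> invariant_measure T \<mu> \<and> \<C> \<subseteq> sets (completion \<mu>) \<and>
     (\<exists>\<gamma>. 0 < \<gamma> \<and> \<gamma> < 1 \<and> mixing_coeff \<mu> T \<C> \<in> O(\<lambda>n. \<gamma> ^ n))"

text \<open>The case split reflects \<open>inf \<emptyset> = \<infinity>\<close>, whereas \<^const>\<open>infdist\<close> is \<open>0\<close> for the empty set.\<close>

definition open_neighbourhood :: "'a::metric_space set \<Rightarrow> real \<Rightarrow> 'a set" where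
  "open_neighbourhood A \<rho> = {x. A \<noteq> {} \<and> infdist x A < \<rho>}"

end

theory Submission
  imports Defs
begin

text \<open>Let \<open>p j x = g j (\<phi> j x) * h (\<phi> j x) / (R * h x)\<close>. These weights are positive, sum to \<open>1\<close> and have
  Hoelder logarithms, and the Gibbs measure is stationary for the random choice of branches with these
  probabilities: it is preserved by the dual of the normalized transfer operator
  \<open>P f x = (\<Sum>j=1..m. p j x * f (\<phi> j x))\<close>. Three facts give the theorem.

  The operator \<open>P\<close> contracts. Two points at distance \<open>d\<close> can be coupled so as to follow the same branch
  with probability at least \<open>exp (- A * d powr b)\<close>, in which case they come closer by the factor \<open>c\<close>.
  Measured in the distance \<open>1 - exp (- B * d powr b)\<close> with a large \<open>B\<close>, every step is a uniform contraction
  (\<open>transfer_contraction\<close>). Hence the iterates \<open>P\<^sup>n f\<close> of a Lipschitz function converge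
  uniformly and exponentially fast to its mean.

  Overlaps are null. The map \<open>T\<close> inverts the branches only on points with a unique code, so the identity
  \<open>\<integral> f * (F \<circ> T\<^sup>n) = \<integral> P\<^sup>n f * F\<close>, and with it the invariance of the measure, requires that almost
  every point has one. The open set condition enters here, and only through a volume estimate: by bounded
  distortion the cylinders of one length that contain a given point are at most \<open>N\<close> in number
  (\<open>bounded_multiplicity\<close>). Let \<open>M\<^sub>n x\<close> be this number. A branch carries the cylinders around \<open>x\<close> to
  cylinders around \<open>\<phi> j x\<close>, and there is at least one more if \<open>\<phi> j x\<close> lies in two first-level pieces, so
  by stationarity the mean of \<open>M\<^sub>n\<close> increases in each step by at least the measure of the overlap. Being
  bounded by \<open>N\<close>, it forces this measure to vanish (\<open>overlap_null\<close>).

  Sets are approximated by Lipschitz functions. The indicator of \<open>E\<close> differs from a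
  \<open>1 / \<rho>\<close>-Lipschitz function only within distance \<open>\<rho>\<close> of the frontier, a set of measure at most
  \<open>C * \<rho> powr \<delta>\<close>. Letting \<open>\<rho>\<close> decay exponentially in \<open>n\<close>, but slower than the correlations of Lipschitz
  functions, one obtains the exponential rate (\<open>exponentially_mixing\<close>).\<close>

section \<open>The attractor and its coding\<close>

text \<open>Finite words are lists and \<open>foldr \<phi> u\<close> is the composition of the maps along the word \<open>u\<close>, first
  letter outermost, so that \<open>foldr \<phi> u ` K\<close> is the cylinder of \<open>u\<close>. The contraction is assumed on all of
  \<open>\<Omega>\<close>, not only on \<open>K\<close>: it is what makes the distortion of the compositions bounded without any
  chaining of points inside \<open>\<Omega>\<close>.\<close>

locale ifs_attractor =
  fixes m :: nat and \<phi> :: "nat \<Rightarrow> 'a::metric_space \<Rightarrow> 'a" and \<Omega> K :: "'a set" and c :: real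
  assumes maps: "j \<in> {1..m} \<Longrightarrow> x \<in> \<Omega> \<Longrightarrow> \<phi> j x \<in> \<Omega>"
    and c_pos: "0 < c" and c_less: "c < 1"
    and contr: "j \<in> {1..m} \<Longrightarrow> x \<in> \<Omega> \<Longrightarrow> y \<in> \<Omega> \<Longrightarrow> dist (\<phi> j x) (\<phi> j y) \<le> c * dist x y"
    and inj: "j \<in> {1..m} \<Longrightarrow> inj_on (\<phi> j) \<Omega>"
    and bdd: "bounded \<Omega>"
    and K_ne: "K \<noteq> {}" and K_compact: "compact K" and K_sub: "K \<subseteq> \<Omega>"
    and K_eq: "K = (\<Union>j\<in>{1..m}. \<phi> j ` K)"
begin

(* Membership in the index set {1..m} is to stay a single atomic premise. *)
declare atLeastAtMost_iff [simp del] One_nat_def [simp del]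

lemma maps_K: "j \<in> {1..m} \<Longrightarrow> x \<in> K \<Longrightarrow> \<phi> j x \<in> K"
  using K_eq by blast

lemma K_cases:
  assumes "x \<in> K"
  obtains j y where "j \<in> {1..m}" "y \<in> K" "x = \<phi> j y"
  using assms K_eq by blast

lemma cont: "j \<in> {1..m} \<Longrightarrow> continuous_on \<Omega> (\<phi> j)"
  using contr c_pos
  by (intro lipschitz_on_continuous_on[of c] lipschitz_onI) auto

lemma word_in:
  "u \<in> lists {1..m} \<Longrightarrow> x \<in> \<Omega> \<Longrightarrow> foldr \<phi> u x \<in> \<Omega>"
  by (induction u) (auto intro: maps)

lemma word_in_K:
  "u \<in> lists {1..m} \<Longrightarrow> x \<in> K \<Longrightarrow> foldr \<phi> u x \<in> K"
  by (induction u) (auto intro: maps_K)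

lemma word_contr:
  assumes "u \<in> lists {1..m}" "x \<in> \<Omega>" "y \<in> \<Omega>"
  shows "dist (foldr \<phi> u x) (foldr \<phi> u y) \<le> c ^ length u * dist x y"
  using assms(1)
proof (induction u)
  case (Cons j u)
  then have "dist (foldr \<phi> (j # u) x) (foldr \<phi> (j # u) y) \<le> c * dist (foldr \<phi> u x) (foldr \<phi> u y)"
    using word_in assms by (auto intro!: contr)
  also have "\<dots> \<le> c * (c ^ length u * dist x y)"
    using Cons c_pos by (intro mult_left_mono) auto
  finally show ?case by simp
qed simp

lemma word_inj: "u \<in> lists {1..m} \<Longrightarrow> inj_on (foldr \<phi> u) \<Omega>"
proof (induction u)
  case (Cons j u)
  show ?case
  proof (rule inj_onI)
    fix x y assume xy: "x \<in> \<Omega>" "y \<in> \<Omega>" "foldr \<phi> (j # u) x = foldr \<phi> (j # u) y"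
    have "foldr \<phi> u x = foldr \<phi> u y"
      using xy Cons.prems word_in by (auto intro: inj_onD[OF inj[of j]])
    moreover have "inj_on (foldr \<phi> u) \<Omega>" using Cons by simp
    ultimately show "x = y" using xy by (meson inj_onD)
  qed
qed (simp add: inj_on_def)

lemma word_cont: "u \<in> lists {1..m} \<Longrightarrow> continuous_on \<Omega> (foldr \<phi> u)"
  using word_contr c_pos
  by (intro lipschitz_on_continuous_on[of "c ^ length u"] lipschitz_onI) auto

lemma word_compact: "u \<in> lists {1..m} \<Longrightarrow> compact (foldr \<phi> u ` K)"
  using word_cont K_compact K_sub by (blast intro: compact_continuous_image continuous_on_subset)

lemma K_word_cases: "x \<in> K \<Longrightarrow> \<exists>u\<in>lists {1..m}. length u = n \<and> (\<exists>z\<in>K. x = foldr \<phi> u z)"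
proof (induction n arbitrary: x)
  case (Suc n)
  obtain j y where y: "j \<in> {1..m}" "y \<in> K" "x = \<phi> j y" using K_cases[OF Suc.prems] .
  obtain u z where "u \<in> lists {1..m}" "length u = n" "z \<in> K" "y = foldr \<phi> u z" using Suc.IH[OF y(2)] by blast
  then show ?case using y by (intro bexI[of _ "j # u"] conjI bexI[of _ z]) auto
qed auto

lemma cylinder_map_eq: "cylinder_map \<phi> i n = foldr \<phi> (map i [0..<n])"
proof (induction n)
  case (Suc n)
  then show ?case by (simp add: fun_eq_iff)
qed (simp add: fun_eq_iff)

lemma words_nth: "i \<in> words m \<Longrightarrow> i n \<in> {1..m}"
  by (auto simp: words_def Pi_iff)

lemma prefix_in_lists: "i \<in> words m \<Longrightarrow> map i [0..<n] \<in> lists {1..m}"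
  using words_nth by auto

lemma prefix_Suc: "map i [0..<Suc n] = i 0 # map (shift i) [0..<n]"
  by (simp add: shift_def map_Suc_upt[symmetric] upt_conv_Cons del: upt_Suc)

lemma shift_words: "i \<in> words m \<Longrightarrow> shift i \<in> words m"
  by (auto simp: words_def shift_def)

lemma coding_unique_limit:
  assumes i: "i \<in> words m" and x: "\<And>n. x \<in> foldr \<phi> (map i [0..<n]) ` K" and x0: "x0 \<in> K"
  shows "(\<lambda>n. cylinder_map \<phi> i n x0) \<longlonglongrightarrow> x"
proof -
  obtain D where D: "\<And>a b. a \<in> \<Omega> \<Longrightarrow> b \<in> \<Omega> \<Longrightarrow> dist a b \<le> D"
    using bdd unfolding bounded_two_points by blast
  have le: "dist (cylinder_map \<phi> i n x0) x \<le> c ^ n * D" for n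
  proof -
    obtain y where y: "y \<in> K" "x = foldr \<phi> (map i [0..<n]) y" using x by blast
    have "dist (cylinder_map \<phi> i n x0) x \<le> c ^ length (map i [0..<n]) * dist x0 y"
      using word_contr[OF prefix_in_lists[OF i]] y x0 K_sub by (auto simp: cylinder_map_eq)
    also have "\<dots> \<le> c ^ n * D"
      using D y x0 K_sub c_pos by (auto intro!: mult_left_mono)
    finally show ?thesis .
  qed
  have "(\<lambda>n. c ^ n * D) \<longlonglongrightarrow> 0"
    using c_pos c_less by (auto intro!: tendsto_mult_left_zero LIMSEQ_power_zero)
  then have "(\<lambda>n. dist (cylinder_map \<phi> i n x0) x) \<longlonglongrightarrow> 0"
    by (rule Lim_null_comparison[rotated]) (simp add: le)
  then show ?thesis by (rule iffD2[OF tendsto_dist_iff])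
qed

lemma coding_eqI:
  assumes "i \<in> words m" and "\<And>n. x \<in> foldr \<phi> (map i [0..<n]) ` K"
  shows "coding \<phi> K i = x"
  unfolding coding_def
proof (rule the_equality)
  show "\<forall>x0\<in>K. (\<lambda>n. cylinder_map \<phi> i n x0) \<longlonglongrightarrow> x"
    using coding_unique_limit assms by blast
  show "y = x" if "\<forall>x0\<in>K. (\<lambda>n. cylinder_map \<phi> i n x0) \<longlonglongrightarrow> y" for y
    using that coding_unique_limit[OF assms] K_ne by (meson LIMSEQ_unique ex_in_conv)
qed

lemma prefix_image_antimono:
  assumes i: "i \<in> words m" and "n \<le> k"
  shows "foldr \<phi> (map i [0..<k]) ` K \<subseteq> foldr \<phi> (map i [0..<n]) ` K"
proof -
  have "map i [0..<k] = map i [0..<n] @ map i [n..<k]"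
    using assms(2) by (metis le_add_diff_inverse map_append upt_add_eq_append zero_le)
  moreover have "foldr \<phi> (map i [n..<k]) ` K \<subseteq> K"
    using i by (auto intro!: word_in_K simp: words_nth words_def)
  ultimately show ?thesis by auto
qed

lemma ex_code_point:
  assumes i: "i \<in> words m"
  shows "\<exists>x. \<forall>n. x \<in> foldr \<phi> (map i [0..<n]) ` K"
proof -
  have "K \<inter> \<Inter> (range (\<lambda>n. foldr \<phi> (map i [0..<n]) ` K)) \<noteq> {}"
  proof (rule compact_imp_fip[OF K_compact])
    show "closed T" if "T \<in> range (\<lambda>n. foldr \<phi> (map i [0..<n]) ` K)" for T
      using that word_compact[OF prefix_in_lists[OF i]] compact_imp_closed by auto
    fix F assume F: "finite F" "F \<subseteq> range (\<lambda>n. foldr \<phi> (map i [0..<n]) ` K)"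
    then obtain N where N: "finite N" "F = (\<lambda>n. foldr \<phi> (map i [0..<n]) ` K) ` N"
      by (meson finite_subset_image)
    obtain k where k: "\<forall>n\<in>N. n \<le> k" using N(1) finite_nat_set_iff_bounded_le by auto
    obtain x where x: "x \<in> foldr \<phi> (map i [0..<k]) ` K" using K_ne by blast
    have "x \<in> K" using x word_in_K[OF prefix_in_lists[OF i]] by auto
    moreover have "x \<in> \<Inter> F" using N k x prefix_image_antimono[OF i] by blast
    ultimately show "K \<inter> \<Inter> F \<noteq> {}" by blast
  qed
  then show ?thesis by blast
qed

text \<open>A word codes exactly the point in all its cylinders, which turns the limit in the
  definition of the coding into a statement without limits.\<close>

lemma coding_eq_iff:
  assumes i: "i \<in> words m"
  shows "coding \<phi> K i = x \<longleftrightarrow> (\<forall>n. x \<in> foldr \<phi> (map i [0..<n]) ` K)"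
  using ex_code_point[OF i] coding_eqI[OF i] by metis

lemma coding_in_K: "i \<in> words m \<Longrightarrow> coding \<phi> K i \<in> K"
  using coding_eq_iff[of i "coding \<phi> K i"] by (auto dest: spec[of _ 0])

lemma coding_shift:
  assumes i: "i \<in> words m"
  shows "coding \<phi> K i = \<phi> (i 0) (coding \<phi> K (shift i))"
proof (rule coding_eqI[OF i])
  fix n
  let ?y = "coding \<phi> K (shift i)"
  have y: "?y \<in> foldr \<phi> (map (shift i) [0..<k]) ` K" for k
    using coding_eq_iff[OF shift_words[OF i], of ?y] by blast
  show "\<phi> (i 0) ?y \<in> foldr \<phi> (map i [0..<n]) ` K"
  proof (cases n)
    case 0
    then show ?thesis using maps_K words_nth[OF i] coding_in_K[OF shift_words[OF i]] by simp
  next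
    case (Suc k)
    then show ?thesis using y[of k] unfolding Suc prefix_Suc by auto
  qed
qed

lemma ex_code:
  assumes "x \<in> K"
  shows "\<exists>i\<in>words m. coding \<phi> K i = x"
proof -
  have "\<forall>y\<in>K. \<exists>j z. j \<in> {1..m} \<and> z \<in> K \<and> y = \<phi> j z" using K_cases by metis
  then obtain b s where bs: "\<And>y. y \<in> K \<Longrightarrow> b y \<in> {1..m} \<and> s y \<in> K \<and> y = \<phi> (b y) (s y)"
    by metis
  have sK: "(s ^^ n) x \<in> K" for n using bs assms by (induction n) auto
  define i where "i n = b ((s ^^ n) x)" for n
  have i: "i \<in> words m" using bs sK by (auto simp: words_def i_def)
  have "foldr \<phi> (map i [0..<n]) ((s ^^ n) x) = x" for n
  proof (induction n)
    case (Suc n)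
    have "\<phi> (i n) ((s ^^ Suc n) x) = (s ^^ n) x" using bs[OF sK[of n]] by (simp add: i_def)
    then show ?case using Suc by simp
  qed simp
  then have "x \<in> foldr \<phi> (map i [0..<n]) ` K" for n using sK by (metis image_eqI)
  then show ?thesis using coding_eqI[OF i] i by blast
qed

lemma coding_case_nat:
  assumes "j \<in> {1..m}" "i \<in> words m"
  shows "case_nat j i \<in> words m" "coding \<phi> K (case_nat j i) = \<phi> j (coding \<phi> K i)"
proof -
  show w: "case_nat j i \<in> words m" using assms by (auto simp: words_def Pi_iff split: nat.splits)
  have "shift (case_nat j i) = i" by (simp add: shift_def)
  then show "coding \<phi> K (case_nat j i) = \<phi> j (coding \<phi> K i)" using coding_shift[OF w] by simp
qed

lemma uniquely_coded_iff:
  "x \<in> uniquely_coded m \<phi> K \<longleftrightarrow> x \<in> K \<and> (\<exists>!i. i \<in> words m \<and> coding \<phi> K i = x)"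
proof -
  have "(card A = 1) = (\<exists>!i. i \<in> A)" for A :: "(nat \<Rightarrow> nat) set"
    unfolding is_singleton_altdef[symmetric] is_singleton_def by blast
  then show ?thesis by (auto simp: uniquely_coded_def)
qed

lemma uniquely_coded_no_overlap:
  assumes "x \<in> uniquely_coded m \<phi> K" "i \<in> {1..m}" "j \<in> {1..m}" "x \<in> \<phi> i ` K" "x \<in> \<phi> j ` K"
  shows "i = j"
proof -
  have "\<exists>w\<in>words m. w 0 = k \<and> coding \<phi> K w = x" if k: "k \<in> {1..m}" "x \<in> \<phi> k ` K" for k
  proof -
    obtain y where y: "y \<in> K" "x = \<phi> k y" using k by blast
    obtain w where "w \<in> words m" "coding \<phi> K w = y" using ex_code[OF y(1)] by blast
    then show ?thesis using coding_case_nat[OF k(1)] y by (metis old.nat.simps(4))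
  qed
  then show ?thesis using assms unfolding uniquely_coded_iff by metis
qed

text \<open>Prepending a letter is injective on codes, so a second code of \<open>x\<close> would give a second one of
  \<open>\<phi> j x\<close>.\<close>

lemma uniquely_coded_branch:
  assumes "j \<in> {1..m}" "x \<in> K" "\<phi> j x \<in> uniquely_coded m \<phi> K"
  shows "x \<in> uniquely_coded m \<phi> K"
proof -
  have "w = w'" if "w \<in> words m" "w' \<in> words m" "coding \<phi> K w = x" "coding \<phi> K w' = x" for w w'
  proof -
    have "case_nat j w = case_nat j w'"
      using assms coding_case_nat that unfolding uniquely_coded_iff by metis
    then show ?thesis by (metis ext old.nat.simps(5))
  qed
  then show ?thesis using ex_code[OF assms(2)] assms(2) unfolding uniquely_coded_iff by blast
qed

text \<open>Where the code is unique, dropping its first letter undoes the branch.\<close>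

lemma induced_map_branch:
  assumes "j \<in> {1..m}" "x \<in> K" "\<phi> j x \<in> uniquely_coded m \<phi> K"
  shows "induced_map m \<phi> K (\<phi> j x) = x"
proof -
  obtain i where i: "i \<in> words m" "coding \<phi> K i = x" using ex_code assms by blast
  note ci = coding_case_nat[OF assms(1) i(1)]
  have "the_inv_into (words m) (coding \<phi> K) (\<phi> j x) = case_nat j i"
    unfolding the_inv_into_def
  proof (rule the_equality)
    show "case_nat j i \<in> words m \<and> coding \<phi> K (case_nat j i) = \<phi> j x" using ci i by simp
  qed (use assms(3) ci i in \<open>auto simp: uniquely_coded_iff\<close>)
  then show ?thesis using assms i by (simp add: induced_map_def shift_def)
qed

definition overlap :: "'a set" where
  "overlap = (\<Union>i\<in>{1..m}. \<Union>j\<in>{1..m} - {i}. \<phi> i ` K \<inter> \<phi> j ` K)"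

text \<open>Two different codes of a point separate at some first letter, where the point seen from
  that cylinder lies in two different first-level pieces.\<close>

lemma K_minus_uniquely_coded:
  "K - uniquely_coded m \<phi> K = (\<Union>u\<in>lists {1..m}. foldr \<phi> u ` overlap)"
proof (intro equalityI subsetI)
  fix x assume x: "x \<in> K - uniquely_coded m \<phi> K"
  then have "x \<in> K" "\<not> (\<exists>!w. w \<in> words m \<and> coding \<phi> K w = x)"
    using uniquely_coded_iff by blast+
  then obtain w w' where w: "w \<in> words m" "w' \<in> words m" "w \<noteq> w'"
    "coding \<phi> K w = x" "coding \<phi> K w' = x"
    using ex_code[of x] by blast
  define n where "n = (LEAST n. w n \<noteq> w' n)"
  have "\<exists>n. w n \<noteq> w' n" using w(3) by auto
  then have n: "w n \<noteq> w' n" unfolding n_def by (rule LeastI_ex)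
  define u where "u = map w [0..<n]"
  have "w k = w' k" if "k < n" for k
    using not_less_Least[OF that[unfolded n_def]] by blast
  then have u: "u = map w' [0..<n]" unfolding u_def by simp
  have ul: "u \<in> lists {1..m}" using w prefix_in_lists by (simp add: u_def)
  have "\<exists>z\<in>K. x = foldr \<phi> u (\<phi> (w n) z)" "\<exists>z\<in>K. x = foldr \<phi> u (\<phi> (w' n) z)"
  proof -
    have "x \<in> foldr \<phi> (map w [0..<Suc n]) ` K" "x \<in> foldr \<phi> (map w' [0..<Suc n]) ` K"
      using coding_eq_iff w by blast+
    moreover have "map w [0..<Suc n] = u @ [w n]" "map w' [0..<Suc n] = u @ [w' n]"
      by (simp_all add: u_def[symmetric] u[symmetric])
    ultimately have "x \<in> foldr \<phi> (u @ [w n]) ` K" "x \<in> foldr \<phi> (u @ [w' n]) ` K"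
      by simp_all
    then show "\<exists>z\<in>K. x = foldr \<phi> u (\<phi> (w n) z)" "\<exists>z\<in>K. x = foldr \<phi> u (\<phi> (w' n) z)"
      by auto
  qed
  then obtain z z' where z: "z \<in> K" "z' \<in> K" "x = foldr \<phi> u (\<phi> (w n) z)"
    "x = foldr \<phi> u (\<phi> (w' n) z')" by blast
  have wn: "w n \<in> {1..m}" "w' n \<in> {1..m}" using words_nth w by auto
  have "\<phi> (w n) z \<in> \<Omega>" "\<phi> (w' n) z' \<in> \<Omega>" using wn z maps_K K_sub by auto
  then have "\<phi> (w n) z = \<phi> (w' n) z'"
    using z inj_onD[OF word_inj[OF ul]] by metis
  then have "\<phi> (w n) z \<in> \<phi> (w n) ` K \<inter> \<phi> (w' n) ` K"
    using z(1,2) by (metis IntI image_eqI)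
  then have "\<phi> (w n) z \<in> overlap"
    unfolding overlap_def using n wn by (intro UN_I[of "w n"] UN_I[of "w' n"]) auto
  then show "x \<in> (\<Union>u\<in>lists {1..m}. foldr \<phi> u ` overlap)" using ul z by blast
next
  fix x assume "x \<in> (\<Union>u\<in>lists {1..m}. foldr \<phi> u ` overlap)"
  then obtain u y where uy: "u \<in> lists {1..m}" "y \<in> overlap" "x = foldr \<phi> u y" by blast
  have y: "y \<in> K" "y \<notin> uniquely_coded m \<phi> K"
    using uy(2) maps_K uniquely_coded_no_overlap unfolding overlap_def by fast+
  have "foldr \<phi> u y \<in> K - uniquely_coded m \<phi> K" using uy(1)
  proof (induction u)
    case (Cons j u)
    then show ?case using uniquely_coded_branch[of j "foldr \<phi> u y"] maps_K by auto
  qed (use y in auto)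
  then show "x \<in> K - uniquely_coded m \<phi> K" using uy by simp
qed

lemma overlap_compact: "compact overlap"
  unfolding overlap_def
  using word_compact[of "[_]"] by (intro compact_UN finite_Diff compact_Int) auto

lemma overlap_sub: "overlap \<subseteq> K"
  unfolding overlap_def using maps_K by blast

lemma uniquely_coded_borel: "uniquely_coded m \<phi> K \<in> sets borel"
proof -
  have eq: "uniquely_coded m \<phi> K = K - (\<Union>u\<in>lists {1..m}. foldr \<phi> u ` overlap)"
    using K_minus_uniquely_coded uniquely_coded_iff by blast
  have "closed (foldr \<phi> u ` overlap)" if "u \<in> lists {1..m}" for u
    using word_cont[OF that] overlap_compact overlap_sub K_sub
    by (meson compact_continuous_image compact_imp_closed continuous_on_subset subset_trans)
  then have "(\<Union>u\<in>lists {1..m}. foldr \<phi> u ` overlap) \<in> sets borel"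
    by (intro sets.countable_UN') (auto intro: borel_closed simp: countable_lists)
  then show ?thesis
    unfolding eq by (rule sets.Diff[OF borel_compact[OF K_compact]])
qed

text \<open>On the uniquely coded part of a first-level piece the map is the inverse of an injective
  continuous map on a compact set, hence continuous; elsewhere it is the identity.\<close>

lemma induced_map_measurable: "induced_map m \<phi> K \<in> borel_measurable borel"
proof -
  define U where "U = uniquely_coded m \<phi> K"
  define \<A> where "\<A> = insert (- U) ((\<lambda>j. U \<inter> \<phi> j ` K) ` {1..m})"
  have U: "U \<in> sets borel" using uniquely_coded_borel by (simp add: U_def)
  have cl: "closed (\<phi> j ` K)" if "j \<in> {1..m}" for j
    using word_compact[of "[j]"] that compact_imp_closed by auto
  show ?thesis
  proof (rule measurable_piecewise_restrict[of \<A>])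
    show "countable \<A>" by (simp add: \<A>_def)
    show "space borel \<subseteq> \<Union>\<A>"
      using K_eq by (auto simp: \<A>_def U_def uniquely_coded_iff)
    fix A assume A: "A \<in> \<A>"
    show "A \<inter> space borel \<in> sets borel" using A U cl by (auto simp: \<A>_def)
    show "induced_map m \<phi> K \<in> borel_measurable (restrict_space borel A)"
    proof (cases "A = - U")
      case True
      have "(\<lambda>x. x) \<in> borel_measurable (restrict_space borel A)"
        by (intro measurable_restrict_space1) simp
      then show ?thesis
        by (rule measurable_cong[THEN iffD1, rotated])
           (auto simp: space_restrict_space True U_def induced_map_def)
    next
      case False
      then obtain j where j: "j \<in> {1..m}" "A = U \<inter> \<phi> j ` K" using A unfolding \<A>_def by blast
      have injK: "inj_on (\<phi> j) K" using inj j K_sub inj_on_subset by blast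
      have "continuous_on (\<phi> j ` K) (the_inv_into K (\<phi> j))"
        using j cont K_sub K_compact injK
        by (blast intro: continuous_on_inv_into continuous_on_subset)
      then have "the_inv_into K (\<phi> j) \<in> borel_measurable (restrict_space borel A)"
        using j by (intro borel_measurable_continuous_on_restrict) (auto intro: continuous_on_subset)
      then show ?thesis
        by (rule measurable_cong[THEN iffD1, rotated])
           (use j injK induced_map_branch in \<open>auto simp: space_restrict_space U_def the_inv_into_f_f\<close>)
    qed
  qed
qed

end

section \<open>Bounded multiplicity of cylinders\<close>

text \<open>A quantitative open mapping property. If the segment from \<open>f v\<close> to a point of the ball left the
  image, then up to the first exit point the inverse of \<open>f\<close> is defined and \<open>1 / l\<close>-Lipschitz along the
  segment. The preimage therefore stays in a closed ball strictly inside \<open>ball v e\<close>, and compactness puts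
  the exit point itself in the image.\<close>

lemma ball_subset_image:
  fixes f :: "'a::euclidean_space \<Rightarrow> 'a"
  assumes inj: "inj_on f (ball v e)" and l: "0 < l"
    and der: "\<And>x. x \<in> ball v e \<Longrightarrow> (f has_derivative D x) (at x)"
    and low: "\<And>x w. x \<in> ball v e \<Longrightarrow> l * norm w \<le> norm (D x w)"
  shows "ball (f v) (l * e) \<subseteq> f ` ball v e"
proof (rule ccontr)
  define S where "S = ball v e"
  define U where "U = f ` S"
  define g where "g = the_inv_into S f"
  assume "\<not> ?thesis"
  then obtain y where y: "dist (f v) y < l * e" "y \<notin> U"
    unfolding U_def S_def subset_iff mem_ball by blast
  have "0 < l * e" using y(1) zero_le_dist[of "f v" y] by linarith
  then have e: "0 < e" using l by (simp add: zero_less_mult_iff)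
  have vS: "v \<in> S" using e by (simp add: S_def)
  have contf: "continuous_on S f"
    using der by (auto simp: S_def intro!: continuous_at_imp_continuous_on has_derivative_continuous)
  have gf: "g (f x) = x" if "x \<in> S" for x
    using that inj by (simp add: g_def S_def the_inv_into_f_f)
  have fg: "f (g z) = z" if "z \<in> U" for z using that gf by (auto simp: U_def)
  have U: "open U" unfolding U_def
    by (rule invariance_of_domain[OF contf]) (use inj in \<open>auto simp: S_def\<close>)
  have contg: "continuous_on U g" unfolding U_def
    by (rule continuous_on_inverse_open[OF _ contf]) (auto simp: gf S_def)
  have derg: "\<exists>D'. (g has_derivative D') (at z) \<and> onorm D' \<le> 1 / l" if z: "z \<in> U" for z
  proof -
    have gz: "g z \<in> ball v e" using z gf by (auto simp: U_def S_def)
    have lin: "linear (D (g z))" using der[OF gz] by (rule has_derivative_linear)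
    have "inj (D (g z))"
      unfolding linear_injective_0[OF lin]
    proof (intro allI impI)
      fix w assume "D (g z) w = 0"
      then have "l * norm w \<le> 0" using low[OF gz, of w] by simp
      then show "w = 0" using l by (simp add: mult_le_0_iff)
    qed
    then obtain D' where D': "linear D'" "\<And>w. D' (D (g z) w) = w" "\<And>w. D (g z) (D' w) = w"
      using linear_injective_isomorphism[OF lin] by blast
    have "(g has_derivative D') (at z)"
    proof (rule has_derivative_inverse_basic[where f' = "D (g z)" and f = f and T = U])
      show "(f has_derivative D (g z)) (at (g z))" by (rule der[OF gz])
      show "continuous (at z) g" using contg U z by (simp add: continuous_on_eq_continuous_at)
    qed (use D' z U fg in \<open>auto simp: linear_conv_bounded_linear fun_eq_iff\<close>)
    moreover have "onorm D' \<le> 1 / l"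
    proof (rule onorm_le)
      fix w
      have "l * norm (D' w) \<le> norm w" using low[OF gz, of "D' w"] D' by simp
      then show "norm (D' w) \<le> 1 / l * norm w" using l by (simp add: field_simps)
    qed
    ultimately show ?thesis by blast
  qed
  then obtain D' where D': "\<And>z. z \<in> U \<Longrightarrow> (g has_derivative D' z) (at z)"
    "\<And>z. z \<in> U \<Longrightarrow> onorm (D' z) \<le> 1 / l" by metis
  \<comment> \<open>the first point \<open>q\<close> at which the segment from \<open>f v\<close> to \<open>y\<close> leaves the image\<close>
  define A where "A = closed_segment (f v) y \<inter> - U"
  have "compact A" "A \<noteq> {}"
    using U y by (auto simp: A_def closed_Compl intro!: compact_Int_closed)
  then obtain q where q: "q \<in> A" "\<And>a. a \<in> A \<Longrightarrow> dist (f v) q \<le> dist (f v) a"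
    using distance_attains_inf[of A "f v"] compact_imp_closed by blast
  define p where "p t = f v + t *\<^sub>R (q - f v)" for t
  define r where "r = dist (f v) q / l"
  have fvq: "f v \<noteq> q" using q vS by (auto simp: A_def U_def)
  have pU: "p t \<in> U" if t: "0 \<le> t" "t < 1" for t
  proof -
    have "dist (f v) (p t) = t * dist (f v) q"
      using t by (simp add: p_def dist_norm norm_minus_commute)
    also have "\<dots> < dist (f v) q" using t fvq by simp
    finally have "p t \<notin> A" using q by force
    moreover have "p t \<in> closed_segment (f v) q"
      unfolding closed_segment_def p_def using t by (auto simp: algebra_simps intro!: exI[of _ t])
    moreover have "closed_segment (f v) q \<subseteq> closed_segment (f v) y"
      using q by (auto simp: A_def subset_closed_segment)
    ultimately show ?thesis by (auto simp: A_def)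
  qed
  have gp: "g (p t) \<in> cball v r" if t: "0 \<le> t" "t < 1" for t
  proof -
    have seg: "closed_segment (f v) (p t) \<subseteq> U"
    proof
      fix z assume "z \<in> closed_segment (f v) (p t)"
      then obtain u where u: "0 \<le> u" "u \<le> 1" "z = (1 - u) *\<^sub>R f v + u *\<^sub>R p t"
        by (auto simp: closed_segment_def)
      then have "z = p (u * t)" by (simp add: p_def algebra_simps)
      moreover have "u * t < 1"
        using u t by (metis mult_left_le_one_le order.strict_trans1)
      ultimately show "z \<in> U" using pU u t by simp
    qed
    have "norm (g (p t) - g (f v)) \<le> 1 / l * norm (p t - f v)"
      by (rule differentiable_bound[where S = "closed_segment (f v) (p t)" and f' = D'])
        (use seg D' in \<open>auto intro: has_derivative_at_withinI\<close>)
    also have "\<dots> = t * r" using t by (simp add: p_def r_def dist_norm norm_minus_commute)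
    also have "\<dots> \<le> r" using t l by (intro mult_left_le_one_le) (auto simp: r_def)
    finally show ?thesis using gf[OF vS] by (simp add: dist_norm norm_minus_commute)
  qed
  have "dist (f v) q \<le> dist (f v) y"
    using q(1) dist_in_closed_segment[of q "f v" y] by (auto simp: A_def dist_commute)
  then have "r < e" using y l by (simp add: r_def field_simps)
  then have sub: "cball v r \<subseteq> S" by (auto simp: S_def)
  have "q \<in> f ` cball v r"
  proof (rule Lim_in_closed_set[where F = sequentially])
    show "closed (f ` cball v r)"
      using contf sub by (intro compact_imp_closed compact_continuous_image) (auto intro: continuous_on_subset)
    have "p (1 - 1 / real (Suc n)) \<in> f ` cball v r" for n
    proof -
      have t: "0 \<le> 1 - 1 / real (Suc n)" "1 - 1 / real (Suc n) < 1" by simp_all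
      show ?thesis using imageI[OF gp[OF t], of f] fg[OF pU[OF t]] by simp
    qed
    then show "\<forall>\<^sub>F n in sequentially. p (1 - 1 / real (Suc n)) \<in> f ` cball v r" by simp
    have "(\<lambda>n. p (1 - 1 / real (Suc n))) \<longlonglongrightarrow> f v + (1 - 0) *\<^sub>R (q - f v)"
      unfolding p_def by (intro tendsto_intros LIMSEQ_inverse_real_of_nat[unfolded inverse_eq_divide])
    then show "(\<lambda>n. p (1 - 1 / real (Suc n))) \<longlonglongrightarrow> q" by simp
  qed simp
  then show False using q(1) sub by (auto simp: A_def U_def)
qed

text \<open>A conformal derivative scales all norms by one factor, here \<open>ratio j x\<close>. The chain rule then
  makes the derivative of a composition a similarity too, scaling by the product of the ratios along the
  orbit, which is \<open>word_ratio\<close> below.\<close>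

locale conformal_attractor = ifs_attractor m \<phi> \<Omega> K c
  for m and \<phi> :: "nat \<Rightarrow> 'a::euclidean_space \<Rightarrow> 'a" and \<Omega> K c +
  fixes ratio :: "nat \<Rightarrow> 'a \<Rightarrow> real" and \<kappa> s G a :: real
  assumes \<Omega>_open: "open \<Omega>"
    and deriv: "j \<in> {1..m} \<Longrightarrow> x \<in> \<Omega> \<Longrightarrow>
      \<exists>D. (\<phi> j has_derivative D) (at x) \<and> (\<forall>v. norm (D v) = ratio j x * norm v)"
    and \<kappa>_pos: "0 < \<kappa>" and ratio_ge: "j \<in> {1..m} \<Longrightarrow> x \<in> \<Omega> \<Longrightarrow> \<kappa> \<le> ratio j x"
    and s_less: "s < 1" and ratio_le: "j \<in> {1..m} \<Longrightarrow> x \<in> \<Omega> \<Longrightarrow> ratio j x \<le> s"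
    and G_nonneg: "0 \<le> G" and a_pos: "0 < a"
    and ratio_holder: "j \<in> {1..m} \<Longrightarrow> x \<in> \<Omega> \<Longrightarrow> y \<in> \<Omega> \<Longrightarrow>
      ratio j y \<le> exp (G * dist y x powr a) * ratio j x"
begin

primrec word_ratio :: "nat list \<Rightarrow> 'a \<Rightarrow> real" where
  "word_ratio [] x = 1"
| "word_ratio (j # u) x = ratio j (foldr \<phi> u x) * word_ratio u x"

lemma word_ratio_append:
  "word_ratio (u @ w) x = word_ratio u (foldr \<phi> w x) * word_ratio w x"
  by (induction u) auto

lemma word_ratio_ge:
  "u \<in> lists {1..m} \<Longrightarrow> x \<in> \<Omega> \<Longrightarrow> \<kappa> ^ length u \<le> word_ratio u x"
proof (induction u)
  case (Cons j u)
  then show ?case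
    using ratio_ge[of j "foldr \<phi> u x"] word_in[of u x] \<kappa>_pos by (auto intro!: mult_mono)
qed simp

lemma word_ratio_pos: "u \<in> lists {1..m} \<Longrightarrow> x \<in> \<Omega> \<Longrightarrow> 0 < word_ratio u x"
  using word_ratio_ge \<kappa>_pos by (meson less_le_trans zero_less_power)

lemma word_deriv:
  assumes "u \<in> lists {1..m}" "x \<in> \<Omega>"
  shows "\<exists>D. (foldr \<phi> u has_derivative D) (at x) \<and> (\<forall>v. norm (D v) = word_ratio u x * norm v)"
  using assms(1)
proof (induction u)
  case Nil
  have "(foldr \<phi> [] has_derivative (\<lambda>v. v)) (at x)" by (simp add: id_def)
  then show ?case by (intro exI[of _ "\<lambda>v. v"]) simp
next
  case (Cons j u)
  then obtain D where D: "(foldr \<phi> u has_derivative D) (at x)"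
    "\<And>v. norm (D v) = word_ratio u x * norm v" by auto
  have j: "j \<in> {1..m}" using Cons by simp
  have "foldr \<phi> u x \<in> \<Omega>" using Cons assms word_in by auto
  then obtain E where E: "(\<phi> j has_derivative E) (at (foldr \<phi> u x))"
    "\<And>v. norm (E v) = ratio j (foldr \<phi> u x) * norm v"
    using deriv[OF j] by blast
  have "((\<lambda>y. \<phi> j (foldr \<phi> u y)) has_derivative (\<lambda>v. E (D v))) (at x)"
    by (rule has_derivative_compose[OF D(1) E(1)])
  then show ?case using D E by (intro exI[of _ "\<lambda>v. E (D v)"]) (simp add: o_def)
qed

text \<open>The orbits of \<open>x\<close> and \<open>y\<close> under the word approach each other geometrically, so the Hoelder bounds
  for the logarithms of the ratios met along them sum to a bound independent of the length of the word.\<close>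

lemma word_distortion:
  assumes "u \<in> lists {1..m}" "x \<in> \<Omega>" "y \<in> \<Omega>"
  shows "word_ratio u y \<le>
    exp (G * (\<Sum>k<length u. (c powr a) ^ k) * dist y x powr a) * word_ratio u x"
  using assms(1)
proof (induction u)
  case (Cons j u)
  define d where "d = dist y x"
  have fx: "foldr \<phi> u x \<in> \<Omega>" "foldr \<phi> u y \<in> \<Omega>" using Cons assms word_in by auto
  have "dist (foldr \<phi> u y) (foldr \<phi> u x) powr a \<le> (c ^ length u * d) powr a"
    using word_contr[of u y x] Cons assms a_pos by (intro powr_mono2) (auto simp: d_def)
  also have "\<dots> = (c powr a) ^ length u * d powr a"
    using c_pos by (simp add: powr_mult d_def powr_realpow[symmetric] powr_powr powr_gt_zero mult.commute)
  finally have le: "G * dist (foldr \<phi> u y) (foldr \<phi> u x) powr a \<le> G * ((c powr a) ^ length u * d powr a)"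
    using G_nonneg by (intro mult_left_mono) auto
  have "ratio j (foldr \<phi> u y) \<le> exp (G * dist (foldr \<phi> u y) (foldr \<phi> u x) powr a) * ratio j (foldr \<phi> u x)"
    using ratio_holder[of j] fx Cons by auto
  also have "\<dots> \<le> exp (G * ((c powr a) ^ length u * d powr a)) * ratio j (foldr \<phi> u x)"
    using le ratio_ge[of j "foldr \<phi> u x"] \<kappa>_pos fx Cons by (intro mult_right_mono) auto
  finally have 1: "ratio j (foldr \<phi> u y) \<le> exp (G * ((c powr a) ^ length u * d powr a)) * ratio j (foldr \<phi> u x)" .
  have "0 \<le> ratio j (foldr \<phi> u x)" using ratio_ge[of j "foldr \<phi> u x"] \<kappa>_pos fx Cons by auto
  then have "word_ratio (j # u) y \<le>
     (exp (G * ((c powr a) ^ length u * d powr a)) * ratio j (foldr \<phi> u x)) *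
     (exp (G * (\<Sum>k<length u. (c powr a) ^ k) * d powr a) * word_ratio u x)"
    using 1 Cons word_ratio_pos[of u y] assms by (auto intro!: mult_mono simp: d_def less_imp_le)
  also have "\<dots> = exp (G * (\<Sum>k<length (j # u). (c powr a) ^ k) * d powr a) * word_ratio (j # u) x"
    by (simp add: algebra_simps exp_add)
  finally show ?case by (simp add: d_def)
qed simp

lemma bounded_distortion:
  "\<exists>C\<ge>1. \<forall>u\<in>lists {1..m}. \<forall>x\<in>\<Omega>. \<forall>y\<in>\<Omega>. word_ratio u y \<le> C * word_ratio u x"
proof -
  obtain B where B: "\<And>x y. x \<in> \<Omega> \<Longrightarrow> y \<in> \<Omega> \<Longrightarrow> dist x y \<le> B"
    using bdd unfolding bounded_two_points by blast
  define \<theta> where "\<theta> = c powr a"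
  have \<theta>: "0 < \<theta>" "\<theta> < 1"
    using c_pos c_less a_pos powr_less_mono2[of a c 1] by (auto simp: \<theta>_def)
  define C where "C = exp (G * (1 / (1 - \<theta>)) * (max B 0) powr a)"
  have "word_ratio u y \<le> C * word_ratio u x" if u: "u \<in> lists {1..m}" and xy: "x \<in> \<Omega>" "y \<in> \<Omega>" for u x y
  proof -
    have "(\<Sum>k<length u. \<theta> ^ k) \<le> 1 / (1 - \<theta>)"
      using sum_le_suminf[OF summable_geometric[of \<theta>], of "{..<length u}"] suminf_geometric[of \<theta>] \<theta> by auto
    moreover have "dist y x powr a \<le> (max B 0) powr a"
      using B[OF xy(2,1)] a_pos by (intro powr_mono2) auto
    ultimately have "G * (\<Sum>k<length u. \<theta> ^ k) * dist y x powr a \<le> G * (1 / (1 - \<theta>)) * (max B 0) powr a"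
      using G_nonneg \<theta> by (intro mult_mono mult_left_mono mult_nonneg_nonneg sum_nonneg) auto
    then have "exp (G * (\<Sum>k<length u. \<theta> ^ k) * dist y x powr a) * word_ratio u x \<le> C * word_ratio u x"
      using word_ratio_pos[OF u xy(1)] by (intro mult_right_mono) (auto simp: C_def)
    then show ?thesis using word_distortion[OF u xy] by (simp add: \<theta>_def)
  qed
  moreover have "C \<ge> 1" using G_nonneg \<theta> by (auto simp: C_def)
  ultimately show ?thesis by blast
qed

text \<open>Lengthening a word by one letter multiplies its ratio at the corresponding point by a factor
  between \<open>\<kappa>\<close> and \<open>s < 1\<close>, so the ratio cannot jump over the interval from \<open>\<kappa> * r\<close> to \<open>r\<close>.\<close>

lemma word_extension:
  assumes "0 < r" "u \<in> lists {1..m}" "z \<in> K" "r < word_ratio u z"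
  shows "\<exists>w\<in>lists {1..m}. \<exists>y\<in>K. foldr \<phi> w y = z \<and>
    \<kappa> * r \<le> word_ratio (u @ w) y \<and> word_ratio (u @ w) y \<le> r"
proof -
  obtain j y where "j \<in> {1..m}" "y \<in> K" using K_cases[OF assms(3)] .
  then have s: "0 \<le> s"
    using order_trans[OF ratio_ge ratio_le, of j y] \<kappa>_pos K_sub by auto
  have *: "\<exists>w\<in>lists {1..m}. \<exists>y\<in>K. foldr \<phi> w y = z \<and>
    \<kappa> * r \<le> word_ratio (u @ w) y \<and> word_ratio (u @ w) y \<le> r"
    if "u \<in> lists {1..m}" "z \<in> K" "r < word_ratio u z" "word_ratio u z * s ^ k \<le> r" for k u z
    using that
  proof (induction k arbitrary: u z)
    case (Suc k)
    obtain j y where y: "j \<in> {1..m}" "y \<in> K" "z = \<phi> j y" using K_cases[OF Suc.prems(2)] .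
    have y\<Omega>: "y \<in> \<Omega>" using y K_sub by auto
    have wr: "word_ratio (u @ [j]) y = word_ratio u z * ratio j y"
      using y by (simp add: word_ratio_append)
    have uj: "u @ [j] \<in> lists {1..m}" using Suc y by auto
    show ?case
    proof (cases "word_ratio (u @ [j]) y \<le> r")
      case True
      have "r * \<kappa> \<le> word_ratio u z * ratio j y"
        using Suc.prems assms(1) \<kappa>_pos ratio_ge[OF y(1) y\<Omega>] by (intro mult_mono) auto
      then show ?thesis
        using True y wr by (intro bexI[of _ "[j]"] bexI[of _ y]) (auto simp: mult.commute)
    next
      case False
      have "word_ratio (u @ [j]) y * s ^ k \<le> word_ratio u z * s * s ^ k"
        unfolding wr using ratio_le[OF y(1) y\<Omega>] s Suc.prems assms(1)
        by (intro mult_right_mono mult_left_mono) auto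
      also have "\<dots> \<le> r" using Suc.prems by (simp add: mult_ac)
      finally obtain w y' where w: "w \<in> lists {1..m}" "y' \<in> K" "foldr \<phi> w y' = y"
        "\<kappa> * r \<le> word_ratio ((u @ [j]) @ w) y'" "word_ratio ((u @ [j]) @ w) y' \<le> r"
        using Suc.IH[OF uj y(2)] False by (meson not_le)
      then show ?thesis
        using y by (intro bexI[of _ "j # w"] bexI[of _ y']) auto
    qed
  qed auto
  have "(\<lambda>k. word_ratio u z * s ^ k) \<longlonglongrightarrow> 0"
    using s s_less by (auto intro!: tendsto_mult_right_zero LIMSEQ_power_zero)
  then have "eventually (\<lambda>k. word_ratio u z * s ^ k < r) sequentially"
    using assms(1) order_tendstoD(2) by blast
  then obtain k where "word_ratio u z * s ^ k < r"
    by (auto simp: eventually_sequentially)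
  then show ?thesis using *[of u z k] assms by simp
qed

lemma word_lipschitz_ball:
  assumes C: "\<And>u x y. u \<in> lists {1..m} \<Longrightarrow> x \<in> \<Omega> \<Longrightarrow> y \<in> \<Omega> \<Longrightarrow>
      word_ratio u y \<le> C * word_ratio u x"
    and u: "u \<in> lists {1..m}" and z: "ball z e \<subseteq> \<Omega>" and y: "y \<in> ball z e"
  shows "dist (foldr \<phi> u z) (foldr \<phi> u y) \<le> C * word_ratio u z * dist z y"
proof -
  have zb: "z \<in> ball z e" using y le_less_trans[OF zero_le_dist[of z y], of e] by simp
  obtain D where D: "\<And>x. x \<in> ball z e \<Longrightarrow> (foldr \<phi> u has_derivative D x) (at x)"
    "\<And>x v. x \<in> ball z e \<Longrightarrow> norm (D x v) = word_ratio u x * norm v"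
    using word_deriv[OF u] z by (metis subsetD)
  have "norm (foldr \<phi> u z - foldr \<phi> u y) \<le> C * word_ratio u z * norm (z - y)"
  proof (rule differentiable_bound[where S = "ball z e" and f' = D])
    fix x assume x: "x \<in> ball z e"
    show "onorm (D x) \<le> C * word_ratio u z"
      using C[OF u, of z x] x zb z D(2)[OF x]
      by (intro onorm_le) (metis mult_right_mono norm_ge_zero subsetD)
  qed (use D zb y in \<open>auto intro: has_derivative_at_withinI\<close>)
  then show ?thesis by (simp add: dist_norm)
qed

end

locale conformal_osc = conformal_attractor +
  fixes V
  assumes V_ne: "V \<noteq> {}" and V_open: "open V" and V_sub: "V \<subseteq> \<Omega>"
    and V_maps: "j \<in> {1..m} \<Longrightarrow> \<phi> j ` V \<subseteq> V"
    and V_disj: "i \<in> {1..m} \<Longrightarrow> j \<in> {1..m} \<Longrightarrow> i \<noteq> j \<Longrightarrow> \<phi> i ` V \<inter> \<phi> j ` V = {}"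
begin

lemma word_V: "u \<in> lists {1..m} \<Longrightarrow> foldr \<phi> u ` V \<subseteq> V"
proof (induction u)
  case (Cons j u)
  then show ?case using V_maps[of j] by auto
qed simp

lemma word_V_disjoint:
  assumes "u \<in> lists {1..m}" "w \<in> lists {1..m}" "length u = length w" "u \<noteq> w"
  shows "foldr \<phi> u ` V \<inter> foldr \<phi> w ` V = {}"
  using assms(3,1,2,4)
proof (induction rule: list_induct2)
  case (Cons i u j w)
  have uw: "u \<in> lists {1..m}" "w \<in> lists {1..m}" "i \<in> {1..m}" "j \<in> {1..m}" using Cons.prems by auto
  show ?case
  proof (cases "i = j")
    case False
    have "\<phi> i ` foldr \<phi> u ` V \<subseteq> \<phi> i ` V" "\<phi> j ` foldr \<phi> w ` V \<subseteq> \<phi> j ` V"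
      using word_V uw by (auto intro!: image_mono)
    then show ?thesis using V_disj[OF uw(3,4) False] by (auto simp: image_comp)
  next
    case True
    have "foldr \<phi> u ` V \<subseteq> \<Omega>" "foldr \<phi> w ` V \<subseteq> \<Omega>"
      using word_V V_sub uw by blast+
    moreover have "foldr \<phi> u ` V \<inter> foldr \<phi> w ` V = {}" using Cons True uw by auto
    ultimately have "\<phi> i ` foldr \<phi> u ` V \<inter> \<phi> i ` foldr \<phi> w ` V = {}"
      using inj_on_image_Int[OF inj[OF uw(3)]] by (metis image_empty)
    then show ?thesis using True by (simp add: image_comp)
  qed
qed simp

text \<open>A point of \<open>K\<close> lies in cylinders of any length, and such a cylinder is close to the image in \<open>V\<close> of
  an arbitrary point of \<open>V\<close>, because the contraction acts on all of \<open>\<Omega>\<close>.\<close>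

lemma K_sub_closure_V: "K \<subseteq> closure V"
proof
  fix x assume x: "x \<in> K"
  obtain v where v: "v \<in> V" using V_ne by blast
  obtain B where B: "\<And>a b. a \<in> \<Omega> \<Longrightarrow> b \<in> \<Omega> \<Longrightarrow> dist a b \<le> B"
    using bdd unfolding bounded_two_points by blast
  show "x \<in> closure V" unfolding closure_approachable
  proof (intro allI impI)
    fix e :: real assume e: "0 < e"
    have "(\<lambda>n. c ^ n * B) \<longlonglongrightarrow> 0"
      using c_pos c_less by (auto intro!: tendsto_mult_left_zero LIMSEQ_power_zero)
    then have "eventually (\<lambda>n. c ^ n * B < e) sequentially" using e order_tendstoD(2) by blast
    then obtain n where n: "c ^ n * B < e" by (auto simp: eventually_sequentially)
    obtain u z where u: "u \<in> lists {1..m}" "length u = n" "z \<in> K" "x = foldr \<phi> u z"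
      using K_word_cases[OF x] by blast
    have "dist (foldr \<phi> u v) x \<le> c ^ n * dist v z"
      using word_contr[OF u(1), of v z] u v V_sub K_sub by auto
    also have "\<dots> \<le> c ^ n * B" using B v u V_sub K_sub c_pos by (intro mult_left_mono) auto
    finally show "\<exists>y\<in>V. dist y x < e"
      using n word_V[OF u(1)] v by (intro bexI[of _ "foldr \<phi> u v"]) auto
  qed
qed

text \<open>The open set \<open>V\<close> need not meet \<open>K\<close>, but it accumulates at every point of it. Choosing the ball in
  \<open>V\<close> near the given point of \<open>K\<close> keeps both inside one convex ball of \<open>\<Omega>\<close>, where the mean value
  inequality applies; compactness makes the radius uniform.\<close>

lemma uniform_balls:
  assumes "0 < e"
  shows "\<exists>d>0. \<forall>z\<in>K. \<exists>v. ball v d \<subseteq> V \<inter> ball z e"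
proof -
  have cover: "K \<subseteq> (\<Union>x\<in>K. ball x (e / 2))" using assms by force
  obtain F where F: "F \<subseteq> K" "finite F" "K \<subseteq> (\<Union>x\<in>F. ball x (e / 2))"
    by (rule compactE_image[OF K_compact _ cover]) simp_all
  have "\<exists>v d. 0 < d \<and> ball v d \<subseteq> V \<inter> ball x (e / 2)" if "x \<in> F" for x
  proof -
    have "x \<in> closure V" using that F K_sub_closure_V by auto
    then obtain v where "v \<in> V" "dist v x < e / 2" using assms unfolding closure_approachable
      by (meson half_gt_zero)
    then have "v \<in> V \<inter> ball x (e / 2)" by (simp add: dist_commute)
    then show ?thesis using V_open open_contains_ball[of "V \<inter> ball x (e / 2)"] by (metis open_Int open_ball)
  qed
  then obtain v d where vd: "\<And>x. x \<in> F \<Longrightarrow> 0 < d x \<and> ball (v x) (d x) \<subseteq> V \<inter> ball x (e / 2)" by metis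
  define d0 where "d0 = Min (insert 1 (d ` F))"
  have d0: "0 < d0" "\<And>x. x \<in> F \<Longrightarrow> d0 \<le> d x" using F vd by (auto simp: d0_def)
  have "\<exists>w. ball w d0 \<subseteq> V \<inter> ball z e" if z: "z \<in> K" for z
  proof -
    obtain x where x: "x \<in> F" "dist x z < e / 2" using F z by auto
    have "ball x (e / 2) \<subseteq> ball z e"
    proof
      fix y assume "y \<in> ball x (e / 2)"
      then have "dist z y < e" using x dist_triangle2[of z y x] by (simp add: dist_commute)
      then show "y \<in> ball z e" by simp
    qed
    moreover have "ball (v x) d0 \<subseteq> ball (v x) (d x)" using d0 x by (intro subset_ball) auto
    ultimately show ?thesis using vd[OF x(1)] by blast
  qed
  then show ?thesis using d0 by blast
qed

text \<open>The images of \<open>V\<close> under different words of one length are disjoint. Prolonging each word through a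
  point \<open>x\<close> until its contraction ratio is comparable to a common small \<open>r\<close>, one finds in these
  images disjoint balls of radius comparable to \<open>r\<close>, all at distance at most a multiple of \<open>r\<close> from
  \<open>x\<close>, so that comparing volumes bounds the number of words.\<close>

proposition bounded_multiplicity:
  "\<exists>N. \<forall>n. \<forall>x\<in>K. card {u \<in> lists {1..m}. length u = n \<and> x \<in> foldr \<phi> u ` K} \<le> N"
proof -
  obtain C where "C \<ge> 1" and C: "\<And>u x y. u \<in> lists {1..m} \<Longrightarrow> x \<in> \<Omega> \<Longrightarrow> y \<in> \<Omega> \<Longrightarrow>
      word_ratio u y \<le> C * word_ratio u x"
    using bounded_distortion by blast
  obtain e where e: "0 < e" "(\<Union>x\<in>K. ball x e) \<subseteq> \<Omega>"
    using compact_subset_open_imp_ball_epsilon_subset[OF K_compact \<Omega>_open K_sub] .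
  obtain d where d: "0 < d" "\<And>z. z \<in> K \<Longrightarrow> \<exists>v. ball v d \<subseteq> V \<inter> ball z e"
    using uniform_balls[OF e(1)] by blast
  (* ratio of the radius C * r * e of the large ball to that of the small disjoint balls *)
  define q where "q = C * e / (\<kappa> / C * d)"
  have "card {u \<in> lists {1..m}. length u = n \<and> x \<in> foldr \<phi> u ` K} \<le> nat \<lfloor>q ^ DIM('a)\<rfloor>"
    if x: "x \<in> K" for n x
  proof -
    define A where "A = {u \<in> lists {1..m}. length u = n \<and> x \<in> foldr \<phi> u ` K}"
    have fA: "finite A" unfolding A_def
      by (rule finite_subset[OF _ finite_lists_length_eq[of "{1..m}" n]]) auto
    (* smaller than the ratio of every word of length n, so that all of them can be prolonged *)
    define r where "r = \<kappa> ^ n / 2"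
    have r: "0 < r" using \<kappa>_pos by (simp add: r_def)
    (* radius of a ball inside the image of a ball of radius d under a word of ratio at least \<kappa> * r *)
    define \<rho> where "\<rho> = \<kappa> * r / C * d"
    have \<rho>: "0 < \<rho>" using r \<kappa>_pos \<open>C \<ge> 1\<close> d by (simp add: \<rho>_def)
    have "\<exists>y. ball y \<rho> \<subseteq> foldr \<phi> u ` V \<inter> ball x (C * r * e)" if u: "u \<in> A" for u
    proof -
      obtain z where z: "z \<in> K" "foldr \<phi> u z = x" and ul: "u \<in> lists {1..m}" "length u = n"
        using u by (auto simp: A_def)
      have "r < word_ratio u z" using word_ratio_ge[OF ul(1), of z] z K_sub r by (auto simp: r_def ul)
      then obtain w y where w: "w \<in> lists {1..m}" "y \<in> K" "foldr \<phi> w y = z"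
        "\<kappa> * r \<le> word_ratio (u @ w) y" "word_ratio (u @ w) y \<le> r"
        using word_extension[OF r ul(1) z(1)] by blast
      define t where "t = u @ w"
      have t: "t \<in> lists {1..m}" "foldr \<phi> t y = x" using ul w z by (auto simp: t_def)
      have y\<Omega>: "y \<in> \<Omega>" using w K_sub by auto
      obtain v where v: "ball v d \<subseteq> V \<inter> ball y e" using d w by blast
      have v\<Omega>: "ball v d \<subseteq> \<Omega>" using v V_sub by blast
      obtain D where D: "\<And>x. x \<in> ball v d \<Longrightarrow> (foldr \<phi> t has_derivative D x) (at x)"
        "\<And>x h. x \<in> ball v d \<Longrightarrow> norm (D x h) = word_ratio t x * norm h"
        using word_deriv[OF t(1)] v\<Omega> by (metis subsetD)
      have low: "\<kappa> * r / C \<le> word_ratio t p" if "p \<in> ball v d" for p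
      proof -
        have "word_ratio t y \<le> C * word_ratio t p" using C[OF t(1)] that v\<Omega> y\<Omega> by blast
        then have "\<kappa> * r \<le> C * word_ratio t p" using w by (simp add: t_def)
        then show ?thesis using \<open>C \<ge> 1\<close> by (simp add: field_simps)
      qed
      have "ball (foldr \<phi> t v) (\<kappa> * r / C * d) \<subseteq> foldr \<phi> t ` ball v d"
      proof (rule ball_subset_image[OF _ _ D(1)])
        show "inj_on (foldr \<phi> t) (ball v d)" using word_inj[OF t(1)] v\<Omega> inj_on_subset by blast
        show "0 < \<kappa> * r / C" using \<kappa>_pos r \<open>C \<ge> 1\<close> by simp
        show "\<kappa> * r / C * norm h \<le> norm (D p h)" if "p \<in> ball v d" for p h
          using low[OF that] D(2)[OF that] by (metis mult_right_mono norm_ge_zero)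
      qed
      moreover have "foldr \<phi> t ` ball v d \<subseteq> foldr \<phi> u ` V"
        using v word_V[OF w(1)] unfolding t_def by auto
      moreover have "foldr \<phi> t p \<in> ball x (C * r * e)" if p: "p \<in> ball v d" for p
      proof -
        have pe: "p \<in> ball y e" using v p by blast
        have "dist (foldr \<phi> t y) (foldr \<phi> t p) \<le> C * word_ratio t y * dist y p"
          using word_lipschitz_ball[OF C t(1) _ pe] e w by blast
        also have "\<dots> \<le> C * r * dist y p" using w \<open>C \<ge> 1\<close>
          by (intro mult_right_mono mult_left_mono) (auto simp: t_def)
        also have "\<dots> < C * r * e" using pe r \<open>C \<ge> 1\<close> by simp
        finally show ?thesis using t by simp
      qed
      ultimately show ?thesis unfolding \<rho>_def by blast
    qed
    then obtain b where b: "\<And>u. u \<in> A \<Longrightarrow> ball (b u) \<rho> \<subseteq> foldr \<phi> u ` V \<inter> ball x (C * r * e)" by metis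
    have disj: "disjoint_family_on (\<lambda>u. ball (b u) \<rho>) A"
      unfolding disjoint_family_on_def
    proof (intro ballI impI)
      fix u w assume uw: "u \<in> A" "w \<in> A" "u \<noteq> w"
      have "foldr \<phi> u ` V \<inter> foldr \<phi> w ` V = {}"
        using uw by (intro word_V_disjoint) (auto simp: A_def)
      then show "ball (b u) \<rho> \<inter> ball (b w) \<rho> = {}" using b[OF uw(1)] b[OF uw(2)] by blast
    qed
    define \<omega> where "\<omega> = measure lborel (ball (0::'a) 1)"
    have \<omega>: "0 < \<omega>" by (simp add: \<omega>_def content_ball_pos)
    have vol: "measure lborel (ball p t) = t ^ DIM('a) * \<omega>" if "0 \<le> t" for p :: 'a and t
      unfolding \<omega>_def by (rule content_ball_conv_unit_ball[OF that])
    have "real (card A) * (\<rho> ^ DIM('a) * \<omega>) = (\<Sum>u\<in>A. measure lborel (ball (b u) \<rho>))"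
      using \<rho> by (simp add: vol)
    also have "\<dots> = measure lborel (\<Union>u\<in>A. ball (b u) \<rho>)"
      using emeasure_lborel_ball_finite
      by (intro measure_finite_Union[symmetric] fA disj) (auto simp: less_top[symmetric])
    also have "\<dots> \<le> measure lborel (ball x (C * r * e))"
    proof (rule measure_mono_fmeasurable)
      show "ball x (C * r * e) \<in> fmeasurable lborel"
        by (rule fmeasurableI) (use emeasure_lborel_ball_finite in auto)
    qed (use b fA in auto)
    also have "\<dots> = (C * r * e) ^ DIM('a) * \<omega>"
      using r e \<open>C \<ge> 1\<close> by (simp add: vol)
    also have "C * r * e = q * \<rho>"
    proof -
      have "\<kappa> / C * d \<noteq> 0" using d \<kappa>_pos \<open>C \<ge> 1\<close> by auto
      moreover have "\<rho> = \<kappa> / C * d * r" by (simp add: \<rho>_def)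
      ultimately show ?thesis unfolding q_def by simp
    qed
    also have "(q * \<rho>) ^ DIM('a) * \<omega> = q ^ DIM('a) * (\<rho> ^ DIM('a) * \<omega>)"
      by (simp add: power_mult_distrib)
    finally have "real (card A) \<le> q ^ DIM('a)"
      by (rule mult_right_le_imp_le) (use \<rho> \<omega> in simp)
    then show ?thesis unfolding A_def[symmetric] by (simp add: le_nat_floor)
  qed
  then show ?thesis by blast
qed

end

section \<open>Stationary measures and overlaps\<close>

lemma borel_measure_eqI_closed:
  fixes M N :: "'a::topological_space measure"
  assumes "finite_measure M" "sets M = sets borel" "sets N = sets borel"
    and "\<And>A. closed A \<Longrightarrow> emeasure M A = emeasure N A"
  shows "M = N"
proof (rule measure_eqI_generator_eq[where E = "{A. closed A}" and \<Omega> = UNIV and A = "\<lambda>_. UNIV"])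
  show "emeasure M UNIV \<noteq> \<infinity>" for i :: nat
    using finite_measure.emeasure_finite[OF assms(1)] by simp
qed (use assms in \<open>auto simp: Int_stable_def borel_eq_closed\<close>)

lemma closed_indicator_limit:
  fixes A :: "'a::metric_space set"
  assumes "closed A" "A \<noteq> {}"
  shows "(\<lambda>n. max 0 (1 - real n * infdist x A)) \<longlonglongrightarrow> indicator A x"
proof (cases "x \<in> A")
  case False
  then have pos: "0 < infdist x A"
    using assms in_closed_iff_infdist_zero[OF assms] infdist_nonneg[of x A] by fastforce
  obtain k :: nat where k: "1 / infdist x A \<le> real k" using real_arch_simple by blast
  have "max 0 (1 - real n * infdist x A) = 0" if "k \<le> n" for n
  proof -
    have "1 / infdist x A \<le> real n" using k that by (meson of_nat_mono order_trans)
    then show ?thesis using pos by (simp add: field_simps)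
  qed
  then have "eventually (\<lambda>n. max 0 (1 - real n * infdist x A) = 0) sequentially"
    unfolding eventually_sequentially by blast
  then show ?thesis using False by (auto intro: tendsto_eventually)
qed simp

text \<open>The measure is kept on the space \<open>K\<close>, where all branches are measurable maps. Stationarity says
  that \<open>M\<close> is the law of \<open>\<phi> j x\<close> when \<open>x\<close> has law \<open>M\<close> and \<open>j\<close> is then drawn with probabilities \<open>p j x\<close>.\<close>

locale stationary_ifs = ifs_attractor m \<phi> \<Omega> K c
  for m and \<phi> :: "nat \<Rightarrow> 'a::metric_space \<Rightarrow> 'a" and \<Omega> K c +
  fixes M :: "'a measure" and p :: "nat \<Rightarrow> 'a \<Rightarrow> real"
  assumes prob: "prob_space M" and sets_M: "sets M = sets (restrict_space borel K)"
    and p_pos: "j \<in> {1..m} \<Longrightarrow> x \<in> K \<Longrightarrow> 0 < p j x"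
    and p_sum: "x \<in> K \<Longrightarrow> (\<Sum>j=1..m. p j x) = 1"
    and p_cont: "j \<in> {1..m} \<Longrightarrow> continuous_on K (p j)"
    and stationary_cont: "\<And>f::'a \<Rightarrow> real. continuous_on K f \<Longrightarrow>
      (\<integral>x. f x \<partial>M) = (\<integral>x. (\<Sum>j=1..m. p j x * f (\<phi> j x)) \<partial>M)"
begin

sublocale prob_space M by (rule prob)

lemma space_M: "space M = K"
  using sets_eq_imp_space_eq[OF sets_M] by (simp add: space_restrict_space)

lemma measurable_M: "measurable M N = measurable (restrict_space borel K) N"
  by (rule measurable_cong_sets[OF sets_M refl])

lemma continuous_measurable_M:
  fixes f :: "'a \<Rightarrow> 'b::topological_space"
  shows "continuous_on K f \<Longrightarrow> f \<in> borel_measurable M"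
  unfolding measurable_M by (rule borel_measurable_continuous_on_restrict)

lemma borel_measurable_M: "f \<in> measurable borel N \<Longrightarrow> f \<in> measurable M N"
  unfolding measurable_M by (rule measurable_restrict_space1)

lemma measurable_to_M:
  assumes "f \<in> borel_measurable N" "\<And>x. x \<in> space N \<Longrightarrow> f x \<in> K"
  shows "f \<in> measurable N M"
  unfolding measurable_cong_sets[OF refl sets_M]
  using assms by (intro measurable_restrict_space2) auto

lemma \<phi>_cont_K: "j \<in> {1..m} \<Longrightarrow> continuous_on K (\<phi> j)"
  using cont K_sub continuous_on_subset by blast

lemma \<phi>_measurable: "j \<in> {1..m} \<Longrightarrow> \<phi> j \<in> measurable M M"
  using \<phi>_cont_K maps_K by (intro measurable_to_M continuous_measurable_M) (auto simp: space_M)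

lemma p_measurable: "j \<in> {1..m} \<Longrightarrow> p j \<in> borel_measurable M"
  using p_cont continuous_measurable_M by blast

lemma closed_sets_M: "closed A \<Longrightarrow> A \<subseteq> K \<Longrightarrow> A \<in> sets M"
  unfolding sets_M sets_restrict_space by (auto intro!: image_eqI[of _ _ A])

lemma stationary_closed:
  assumes A: "closed A" "A \<noteq> {}"
  shows "measure M (A \<inter> K) = (\<integral>x. (\<Sum>j=1..m. p j x * indicator A (\<phi> j x)) \<partial>M)"
proof -
  define f where "f n x = max 0 (1 - real n * infdist x A)" for n x
  have f01: "0 \<le> f n x" "f n x \<le> 1" for n x by (auto simp: f_def infdist_nonneg)
  have fc: "continuous_on S (f n)" for n S
    unfolding f_def by (intro continuous_intros)
  have fm: "f n \<in> borel_measurable borel" for n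
    using fc by (intro borel_measurable_continuous_onI)
  have lim: "(\<lambda>n. f n x) \<longlonglongrightarrow> indicator A x" for x
    unfolding f_def by (rule closed_indicator_limit[OF A])
  have iA: "(indicator A :: 'a \<Rightarrow> real) \<in> borel_measurable borel" using A by auto
  have "(\<lambda>n. \<integral>x. f n x \<partial>M) \<longlonglongrightarrow> (\<integral>x. indicator A x \<partial>M)"
    by (rule integral_dominated_convergence[where w = "\<lambda>_. 1"])
       (use lim f01 borel_measurable_M[OF fm] borel_measurable_M[OF iA] in auto)
  moreover have "(\<lambda>n. \<integral>x. (\<Sum>j=1..m. p j x * f n (\<phi> j x)) \<partial>M)
      \<longlonglongrightarrow> (\<integral>x. (\<Sum>j=1..m. p j x * indicator A (\<phi> j x)) \<partial>M)"
  proof (rule integral_dominated_convergence[where w = "\<lambda>_. 1"])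
    show "(\<lambda>x. \<Sum>j=1..m. p j x * indicator A (\<phi> j x)) \<in> borel_measurable M"
      using p_measurable measurable_compose[OF \<phi>_measurable borel_measurable_M[OF iA]]
      by (intro borel_measurable_sum borel_measurable_times)
    show "(\<lambda>x. \<Sum>j=1..m. p j x * f n (\<phi> j x)) \<in> borel_measurable M" for n
      using p_measurable measurable_compose[OF \<phi>_measurable borel_measurable_M[OF fm]]
      by (intro borel_measurable_sum borel_measurable_times)
    show "AE x in M. (\<lambda>n. \<Sum>j=1..m. p j x * f n (\<phi> j x)) \<longlonglongrightarrow> (\<Sum>j=1..m. p j x * indicator A (\<phi> j x))"
      by (intro always_eventually allI tendsto_sum tendsto_mult_left lim)
    have "\<bar>\<Sum>j=1..m. p j x * f n (\<phi> j x)\<bar> \<le> 1" if x: "x \<in> K" for n x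
    proof -
      have "0 \<le> (\<Sum>j=1..m. p j x * f n (\<phi> j x))"
        using p_pos[OF _ x] f01 by (intro sum_nonneg mult_nonneg_nonneg) (auto simp: less_imp_le)
      moreover have "(\<Sum>j=1..m. p j x * f n (\<phi> j x)) \<le> (\<Sum>j=1..m. p j x)"
        using p_pos[OF _ x] f01 by (intro sum_mono mult_left_le) (auto simp: less_imp_le)
      ultimately show ?thesis using p_sum[OF x] by simp
    qed
    then show "AE x in M. norm (\<Sum>j=1..m. p j x * f n (\<phi> j x)) \<le> 1" for n
      by (intro AE_I2) (simp add: space_M)
  qed simp
  moreover have "(\<integral>x. f n x \<partial>M) = (\<integral>x. (\<Sum>j=1..m. p j x * f n (\<phi> j x)) \<partial>M)" for n
    by (rule stationary_cont[OF fc])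
  ultimately have "(\<integral>x. indicator A x \<partial>M) = (\<integral>x. (\<Sum>j=1..m. p j x * indicator A (\<phi> j x)) \<partial>M)"
    using LIMSEQ_unique by simp
  then show ?thesis by (simp add: space_M)
qed

text \<open>Both sides define measures, so it suffices to compare them on closed sets, whose indicators
  are limits of continuous functions.\<close>

lemma stationary:
  assumes f: "f \<in> borel_measurable M"
  shows "(\<integral>\<^sup>+x. f x \<partial>M) = (\<integral>\<^sup>+x. (\<Sum>j=1..m. ennreal (p j x) * f (\<phi> j x)) \<partial>M)"
proof -
  define Q where "Q = count_space {1..m} \<Otimes>\<^sub>M M"
  define N where "N = distr (density Q (\<lambda>(j, x). ennreal (p j x))) M (\<lambda>(j, x). \<phi> j x)"
  (* The right-hand side is the integral over the law of the randomly chosen image. *)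
  have \<phi>Q: "(\<lambda>(j, x). \<phi> j x) \<in> measurable Q M" unfolding Q_def
    by (rule measurable_pair_measure_countable1) (auto simp: \<phi>_measurable)
  have pQ: "(\<lambda>(j, x). ennreal (p j x)) \<in> borel_measurable Q" unfolding Q_def
    by (rule measurable_pair_measure_countable1) (auto intro!: measurable_compose[OF p_measurable])
  have nnN: "(\<integral>\<^sup>+x. g x \<partial>N) = (\<integral>\<^sup>+x. (\<Sum>j=1..m. ennreal (p j x) * g (\<phi> j x)) \<partial>M)"
    if g: "g \<in> borel_measurable M" for g
  proof -
    have gQ: "(\<lambda>(j, x). g (\<phi> j x)) \<in> borel_measurable Q"
      using measurable_compose[OF \<phi>Q g] by (simp add: case_prod_beta')
    have "(\<integral>\<^sup>+x. g x \<partial>N) = (\<integral>\<^sup>+z. (case z of (j, x) \<Rightarrow> ennreal (p j x)) * (case z of (j, x) \<Rightarrow> g (\<phi> j x)) \<partial>Q)"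
      unfolding N_def using \<phi>Q g pQ gQ
      by (subst nn_integral_distr) (auto simp: nn_integral_density case_prod_beta')
    also have "\<dots> = (\<integral>\<^sup>+z. (case z of (j, x) \<Rightarrow> ennreal (p j x) * g (\<phi> j x)) \<partial>Q)"
      by (simp add: case_prod_beta')
    also have "\<dots> = (\<integral>\<^sup>+j. \<integral>\<^sup>+x. ennreal (p j x) * g (\<phi> j x) \<partial>M \<partial>count_space {1..m})"
      using borel_measurable_times_ennreal[OF pQ gQ] unfolding Q_def
      by (subst nn_integral_fst[symmetric]) (auto simp: case_prod_beta')
    also have "\<dots> = (\<Sum>j=1..m. \<integral>\<^sup>+x. ennreal (p j x) * g (\<phi> j x) \<partial>M)"
      by (simp add: nn_integral_count_space_finite)
    also have "\<dots> = (\<integral>\<^sup>+x. (\<Sum>j=1..m. ennreal (p j x) * g (\<phi> j x)) \<partial>M)"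
      using p_measurable measurable_compose[OF \<phi>_measurable g]
      by (intro nn_integral_sum[symmetric] borel_measurable_times_ennreal measurable_compose[OF _ measurable_ennreal])
    finally show ?thesis .
  qed
  have sN: "sets N = sets M" "space N = K" by (simp_all add: N_def space_M)
  have idM: "(\<lambda>x. x) \<in> borel_measurable M" by (rule borel_measurable_M) simp
  have idN: "(\<lambda>x. x) \<in> borel_measurable N" using idM measurable_cong_sets[OF sN(1) refl] by blast
  have "distr M borel (\<lambda>x. x) = distr N borel (\<lambda>x. x)"
  proof (rule borel_measure_eqI_closed)
    show "finite_measure (distr M borel (\<lambda>x. x))" by (rule finite_measure_distr[OF idM])
    fix A :: "'a set" assume A: "closed A"
    have AK: "A \<inter> K \<in> sets M" by (rule closed_sets_M) (use A K_compact compact_imp_closed in auto)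
    have "emeasure M (A \<inter> K) = emeasure N (A \<inter> K)"
    proof (cases "A = {}")
      case False
      have "emeasure N (A \<inter> K) = (\<integral>\<^sup>+x. indicator (A \<inter> K) x \<partial>N)" using AK sN by simp
      also have "\<dots> = (\<integral>\<^sup>+x. (\<Sum>j=1..m. ennreal (p j x) * indicator (A \<inter> K) (\<phi> j x)) \<partial>M)"
        using AK by (intro nnN) auto
      also have "\<dots> = (\<integral>\<^sup>+x. ennreal (\<Sum>j=1..m. p j x * indicator A (\<phi> j x)) \<partial>M)"
      proof (rule nn_integral_cong)
        fix x assume "x \<in> space M"
        then have x: "x \<in> K" by (simp add: space_M)
        show "(\<Sum>j=1..m. ennreal (p j x) * indicator (A \<inter> K) (\<phi> j x)) = ennreal (\<Sum>j=1..m. p j x * indicator A (\<phi> j x))"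
        proof -
          have "(\<Sum>j=1..m. ennreal (p j x) * indicator (A \<inter> K) (\<phi> j x)) =
              (\<Sum>j=1..m. ennreal (p j x * indicator A (\<phi> j x)))"
            using maps_K[OF _ x] by (intro sum.cong) (auto simp: indicator_def)
          then show ?thesis
            using p_pos[OF _ x] by (simp only: sum_ennreal mult_nonneg_nonneg less_imp_le indicator_pos_le)
        qed
      qed
      also have "\<dots> = ennreal (\<integral>x. (\<Sum>j=1..m. p j x * indicator A (\<phi> j x)) \<partial>M)"
      proof (rule nn_integral_eq_integral)
        have iA: "(indicator A :: 'a \<Rightarrow> real) \<in> borel_measurable borel" using A by auto
        have meas: "(\<lambda>x. \<Sum>j=1..m. p j x * indicator A (\<phi> j x)) \<in> borel_measurable M"
          using p_measurable measurable_compose[OF \<phi>_measurable borel_measurable_M[OF iA]]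
          by (intro borel_measurable_sum borel_measurable_times)
        have bd: "0 \<le> (\<Sum>j=1..m. p j x * indicator A (\<phi> j x)) \<and> (\<Sum>j=1..m. p j x * indicator A (\<phi> j x)) \<le> 1"
          if x: "x \<in> K" for x
        proof
          show "0 \<le> (\<Sum>j=1..m. p j x * indicator A (\<phi> j x))"
            using p_pos[OF _ x] by (intro sum_nonneg mult_nonneg_nonneg) (auto simp: less_imp_le)
          have "(\<Sum>j=1..m. p j x * indicator A (\<phi> j x)) \<le> (\<Sum>j=1..m. p j x)"
            using p_pos[OF _ x] by (intro sum_mono mult_left_le) (auto simp: less_imp_le indicator_def)
          then show "(\<Sum>j=1..m. p j x * indicator A (\<phi> j x)) \<le> 1" using p_sum[OF x] by simp
        qed
        then show "integrable M (\<lambda>x. \<Sum>j=1..m. p j x * indicator A (\<phi> j x))"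
          by (intro integrable_const_bound[where B = 1] meas AE_I2) (simp add: space_M)
        show "AE x in M. 0 \<le> (\<Sum>j=1..m. p j x * indicator A (\<phi> j x))"
          using bd by (intro AE_I2) (simp add: space_M)
      qed
      also have "\<dots> = emeasure M (A \<inter> K)"
        using stationary_closed[OF A False] by (simp add: emeasure_eq_measure)
      finally show ?thesis ..
    qed simp
    then show "emeasure (distr M borel (\<lambda>x. x)) A = emeasure (distr N borel (\<lambda>x. x)) A"
      using A idM idN sN by (simp add: emeasure_distr space_M)
  qed simp_all
  then have eq: "emeasure (distr M borel (\<lambda>x. x)) A = emeasure (distr N borel (\<lambda>x. x)) A" for A
    by simp
  have "M = N"
  proof (rule measure_eqI)
    fix A assume "A \<in> sets M"
    then obtain A' where "A' \<in> sets borel" "A = K \<inter> A'"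
      unfolding sets_M sets_restrict_space by auto
    then show "emeasure M A = emeasure N A"
      using eq[of A'] idM idN sN by (simp add: emeasure_distr space_M Int_commute)
  qed (simp add: sN)
  then show ?thesis using nnN[OF f] by simp
qed

lemma weights_sum_ennreal: "x \<in> K \<Longrightarrow> (\<Sum>j=1..m. ennreal (p j x)) = 1"
  using p_sum[of x] p_pos[of _ x] by (subst sum_ennreal) (auto simp: less_imp_le)

definition cover_words :: "nat \<Rightarrow> 'a \<Rightarrow> nat list set" where
  "cover_words n x = {u \<in> lists {1..m}. length u = n \<and> x \<in> foldr \<phi> u ` K}"

lemma finite_words: "finite {u \<in> lists {1..m}. length u = n}"
  by (rule finite_subset[OF _ finite_lists_length_eq[of "{1..m}" n]]) auto

lemma finite_cover_words: "finite (cover_words n x)"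
  unfolding cover_words_def by (rule finite_subset[OF _ finite_words[of n]]) auto

lemma card_cover_words_measurable:
  "(\<lambda>x. ennreal (card (cover_words n x))) \<in> borel_measurable M"
proof -
  let ?W = "{u \<in> lists {1..m}. length u = n}"
  have "ennreal (card (cover_words n x)) = (\<Sum>u\<in>?W. indicator (foldr \<phi> u ` K) x)" for x
  proof -
    have "cover_words n x = {u \<in> ?W. x \<in> foldr \<phi> u ` K}" by (auto simp: cover_words_def)
    then show ?thesis
      using finite_words[of n] by (simp add: sum.If_cases indicator_def Int_def ennreal_of_nat_eq_real_of_nat)
  qed
  moreover have "foldr \<phi> u ` K \<in> sets M" if "u \<in> ?W" for u
    using that word_compact[of u] word_in_K[of u] by (intro closed_sets_M compact_imp_closed) auto
  ultimately show ?thesis by simp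
qed

text \<open>Prepending \<open>j\<close> carries the cylinders around \<open>x\<close> to cylinders around \<open>\<phi> j x\<close>. In the overlap the
  image lies moreover in a piece with another first letter, which supplies a further cylinder.\<close>

lemma card_cover_words_branch:
  assumes j: "j \<in> {1..m}" and x: "x \<in> K"
  shows "card (cover_words n x) + indicator overlap (\<phi> j x) \<le> card (cover_words (Suc n) (\<phi> j x))"
proof -
  have sub: "(#) j ` cover_words n x \<subseteq> cover_words (Suc n) (\<phi> j x)"
    using j by (auto simp: cover_words_def)
  have card: "card ((#) j ` cover_words n x) = card (cover_words n x)"
    by (intro card_image) simp
  show ?thesis
  proof (cases "\<phi> j x \<in> overlap")
    case True
    then obtain k where k: "k \<in> {1..m}" "k \<noteq> j" "\<phi> j x \<in> \<phi> k ` K"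
      unfolding overlap_def by auto
    then obtain z where z: "z \<in> K" "\<phi> j x = \<phi> k z" by blast
    obtain u y where u: "u \<in> lists {1..m}" "length u = n" "y \<in> K" "z = foldr \<phi> u y"
      using K_word_cases[OF z(1), of n] by blast
    have "k # u \<in> cover_words (Suc n) (\<phi> j x)"
      using u k z by (auto simp: cover_words_def)
    then have "insert (k # u) ((#) j ` cover_words n x) \<subseteq> cover_words (Suc n) (\<phi> j x)"
      using sub by auto
    then have "card (insert (k # u) ((#) j ` cover_words n x)) \<le> card (cover_words (Suc n) (\<phi> j x))"
      by (intro card_mono finite_cover_words)
    moreover have "k # u \<notin> (#) j ` cover_words n x" using k by auto
    ultimately show ?thesis using True card finite_cover_words by simp
  next
    case False
    then show ?thesis using card card_mono[OF finite_cover_words sub] by simp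
  qed
qed

lemma overlap_sets: "overlap \<in> sets M"
  using overlap_compact overlap_sub by (intro closed_sets_M compact_imp_closed)

text \<open>Applying a branch to a point preserves all its coverings by cylinders and adds one whenever
  the image lies in the overlap. By stationarity the mean number of coverings by cylinders of
  length \<open>n\<close> therefore grows by at least the measure of the overlap with every step, which a bounded
  number cannot do unless that measure is zero.\<close>

proposition overlap_null:
  assumes N: "\<And>n x. x \<in> K \<Longrightarrow> card (cover_words n x) \<le> N"
  shows "emeasure M overlap = 0"
proof -
  define I where "I n = (\<integral>\<^sup>+x. ennreal (card (cover_words n x)) \<partial>M)" for n
  have step: "I n + emeasure M overlap \<le> I (Suc n)" for n
  proof -
    have mo: "(\<lambda>x. \<Sum>j=1..m. ennreal (p j x) * indicator overlap (\<phi> j x)) \<in> borel_measurable M"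
      using p_measurable \<phi>_measurable overlap_sets
      by (intro borel_measurable_sum borel_measurable_times_ennreal measurable_compose[OF _ measurable_ennreal]
          measurable_compose[OF _ borel_measurable_indicator])
    have "I n + emeasure M overlap =
       (\<integral>\<^sup>+x. ennreal (card (cover_words n x)) \<partial>M) + (\<integral>\<^sup>+x. indicator overlap x \<partial>M)"
      using overlap_sets by (simp add: I_def)
    also have "(\<integral>\<^sup>+x. indicator overlap x \<partial>M) = (\<integral>\<^sup>+x. (\<Sum>j=1..m. ennreal (p j x) * indicator overlap (\<phi> j x)) \<partial>M)"
      using overlap_sets by (intro stationary) auto
    also have "(\<integral>\<^sup>+x. ennreal (card (cover_words n x)) \<partial>M) + \<dots> =
      (\<integral>\<^sup>+x. ennreal (card (cover_words n x)) + (\<Sum>j=1..m. ennreal (p j x) * indicator overlap (\<phi> j x)) \<partial>M)"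
      by (intro nn_integral_add[symmetric] card_cover_words_measurable mo)
    also have "\<dots> \<le> (\<integral>\<^sup>+x. (\<Sum>j=1..m. ennreal (p j x) * ennreal (card (cover_words (Suc n) (\<phi> j x)))) \<partial>M)"
    proof (rule nn_integral_mono)
      fix x assume "x \<in> space M"
      then have x: "x \<in> K" by (simp add: space_M)
      have "ennreal (card (cover_words n x)) = (\<Sum>j=1..m. ennreal (p j x)) * ennreal (card (cover_words n x))"
        using weights_sum_ennreal[OF x] by simp
      then have "ennreal (card (cover_words n x)) + (\<Sum>j=1..m. ennreal (p j x) * indicator overlap (\<phi> j x))
         = (\<Sum>j=1..m. ennreal (p j x) * (ennreal (card (cover_words n x)) + indicator overlap (\<phi> j x)))"
        by (simp add: distrib_left sum.distrib sum_distrib_right)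
      also have "\<dots> \<le> (\<Sum>j=1..m. ennreal (p j x) * ennreal (card (cover_words (Suc n) (\<phi> j x))))"
      proof (intro sum_mono mult_left_mono)
        fix j assume j: "j \<in> {1..m}"
        have "ennreal (card (cover_words n x)) + indicator overlap (\<phi> j x)
          = ennreal (real (card (cover_words n x) + indicator overlap (\<phi> j x)))"
          by (auto simp: indicator_def)
        also have "\<dots> \<le> ennreal (card (cover_words (Suc n) (\<phi> j x)))"
          using card_cover_words_branch[OF j x, of n] by (intro ennreal_leI of_nat_mono)
        finally show "ennreal (card (cover_words n x)) + indicator overlap (\<phi> j x)
          \<le> ennreal (card (cover_words (Suc n) (\<phi> j x)))" .
      qed simp
      finally show "ennreal (card (cover_words n x)) + (\<Sum>j=1..m. ennreal (p j x) * indicator overlap (\<phi> j x))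
         \<le> (\<Sum>j=1..m. ennreal (p j x) * ennreal (card (cover_words (Suc n) (\<phi> j x))))" .
    qed
    also have "\<dots> = I (Suc n)"
      unfolding I_def by (rule stationary[OF card_cover_words_measurable, symmetric])
    finally show ?thesis .
  qed
  have lower: "of_nat n * emeasure M overlap \<le> I n" for n
  proof (induction n)
    case (Suc n)
    have "of_nat (Suc n) * emeasure M overlap = of_nat n * emeasure M overlap + emeasure M overlap"
      by (simp add: distrib_right add.commute)
    also have "\<dots> \<le> I n + emeasure M overlap" by (intro add_right_mono Suc.IH)
    finally show ?case using step[of n] by (rule order_trans)
  qed simp
  have upper: "I n \<le> ennreal N" for n
  proof -
    have "I n \<le> (\<integral>\<^sup>+x. ennreal N \<partial>M)"
      unfolding I_def using N by (intro nn_integral_mono ennreal_leI) (simp add: space_M)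
    then show ?thesis by (simp add: emeasure_space_1)
  qed
  have "real n * measure M overlap \<le> real N" for n
  proof -
    have "ennreal (real n * measure M overlap) \<le> ennreal N"
      using order_trans[OF lower[of n] upper]
      by (simp add: emeasure_eq_measure ennreal_mult'' ennreal_of_nat_eq_real_of_nat)
    then show ?thesis by (simp add: ennreal_le_iff)
  qed
  then have "measure M overlap \<le> 0"
    using reals_Archimedean3[of "measure M overlap"] by (meson not_le)
  then show ?thesis using measure_nonneg[of M overlap] by (simp add: emeasure_eq_measure)
qed

end

locale nonoverlapping_ifs = stationary_ifs +
  assumes overlap_0: "emeasure M overlap = 0"
begin

text \<open>Mass can reach \<open>\<phi> j ` N\<close> through the branch \<open>j\<close>, coming from \<open>N\<close>, or through another branch,
  landing in the overlap. Both sources are null.\<close>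

lemma image_null:
  assumes j: "j \<in> {1..m}" and N: "compact N" "N \<subseteq> K" "emeasure M N = 0"
  shows "emeasure M (\<phi> j ` N) = 0"
proof -
  have cN: "compact (\<phi> j ` N)"
    using N \<phi>_cont_K[OF j] by (meson compact_continuous_image continuous_on_subset)
  have sets: "N \<in> sets M" "\<phi> j ` N \<in> sets M"
    using N cN maps_K[OF j] by (auto intro!: closed_sets_M compact_imp_closed)
  have mo: "(\<lambda>x. \<Sum>k=1..m. ennreal (p k x) * indicator overlap (\<phi> k x)) \<in> borel_measurable M"
    using p_measurable \<phi>_measurable overlap_sets
    by (intro borel_measurable_sum borel_measurable_times_ennreal measurable_compose[OF _ measurable_ennreal]
        measurable_compose[OF _ borel_measurable_indicator])
  have "emeasure M (\<phi> j ` N) = (\<integral>\<^sup>+x. indicator (\<phi> j ` N) x \<partial>M)" using sets by simp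
  also have "\<dots> = (\<integral>\<^sup>+x. (\<Sum>k=1..m. ennreal (p k x) * indicator (\<phi> j ` N) (\<phi> k x)) \<partial>M)"
    using sets by (intro stationary) auto
  also have "\<dots> \<le> (\<integral>\<^sup>+x. indicator N x + (\<Sum>k=1..m. ennreal (p k x) * indicator overlap (\<phi> k x)) \<partial>M)"
  proof (rule nn_integral_mono)
    fix x assume "x \<in> space M"
    then have x: "x \<in> K" by (simp add: space_M)
    have "(indicator (\<phi> j ` N) (\<phi> k x) :: ennreal) \<le> indicator N x + indicator overlap (\<phi> k x)"
      if k: "k \<in> {1..m}" for k
    proof (cases "\<phi> k x \<in> \<phi> j ` N")
      case True
      then obtain y where y: "y \<in> N" "\<phi> k x = \<phi> j y" by blast
      show ?thesis
      proof (cases "k = j")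
        case True
        then have "x = y" using y inj_onD[OF inj[OF j]] x N K_sub by (metis subsetD)
        then show ?thesis using y by (simp add: indicator_def)
      next
        case False
        have "\<phi> k x \<in> \<phi> k ` K" "\<phi> k x \<in> \<phi> j ` K" using x y N by (blast, metis imageI subsetD)
        then have "\<phi> k x \<in> overlap" unfolding overlap_def using k j False by blast
        then show ?thesis by (simp add: indicator_def)
      qed
    qed simp
    then have "(\<Sum>k=1..m. ennreal (p k x) * indicator (\<phi> j ` N) (\<phi> k x)) \<le>
        (\<Sum>k=1..m. ennreal (p k x) * (indicator N x + indicator overlap (\<phi> k x)))"
      by (intro sum_mono mult_left_mono) auto
    also have "\<dots> = (\<Sum>k=1..m. ennreal (p k x)) * indicator N x
        + (\<Sum>k=1..m. ennreal (p k x) * indicator overlap (\<phi> k x))"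
      by (simp only: distrib_left sum.distrib sum_distrib_right)
    finally show "(\<Sum>k=1..m. ennreal (p k x) * indicator (\<phi> j ` N) (\<phi> k x)) \<le>
        indicator N x + (\<Sum>k=1..m. ennreal (p k x) * indicator overlap (\<phi> k x))"
      using weights_sum_ennreal[OF x] by simp
  qed
  also have "\<dots> = (\<integral>\<^sup>+x. indicator N x \<partial>M) +
      (\<integral>\<^sup>+x. (\<Sum>k=1..m. ennreal (p k x) * indicator overlap (\<phi> k x)) \<partial>M)"
    using sets by (intro nn_integral_add mo) auto
  also have "(\<integral>\<^sup>+x. (\<Sum>k=1..m. ennreal (p k x) * indicator overlap (\<phi> k x)) \<partial>M) =
      (\<integral>\<^sup>+x. indicator overlap x \<partial>M)"
    using overlap_sets by (intro stationary[symmetric]) auto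
  finally show ?thesis using sets overlap_sets N overlap_0 by simp
qed

lemma word_overlap_null: "u \<in> lists {1..m} \<Longrightarrow> emeasure M (foldr \<phi> u ` overlap) = 0"
proof (induction rule: lists.induct)
  case (Cons j u)
  have "compact (foldr \<phi> u ` overlap)"
    using word_cont[OF Cons(2)] overlap_compact overlap_sub K_sub
    by (meson compact_continuous_image continuous_on_subset subset_trans)
  moreover have "foldr \<phi> u ` overlap \<subseteq> K" using word_in_K[OF Cons(2)] overlap_sub by auto
  ultimately have "emeasure M (\<phi> j ` foldr \<phi> u ` overlap) = 0"
    using Cons by (intro image_null) auto
  then show ?case by (simp add: image_comp)
qed (simp add: overlap_0)

lemma not_uniquely_coded_null: "K - uniquely_coded m \<phi> K \<in> null_sets M"
  unfolding K_minus_uniquely_coded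
proof (rule null_sets_UN')
  fix u assume u: "u \<in> lists {1..m}"
  have "compact (foldr \<phi> u ` overlap)"
    using word_cont[OF u] overlap_compact overlap_sub K_sub
    by (meson compact_continuous_image continuous_on_subset subset_trans)
  then show "foldr \<phi> u ` overlap \<in> null_sets M"
    using word_in_K[OF u] overlap_sub word_overlap_null[OF u]
    by (intro null_setsI closed_sets_M compact_imp_closed) auto
qed simp

abbreviation T :: "'a \<Rightarrow> 'a" where "T \<equiv> induced_map m \<phi> K"

lemma T_measurable: "T \<in> measurable M M"
proof (rule measurable_to_M)
  show "T \<in> borel_measurable M" by (rule borel_measurable_M[OF induced_map_measurable])
  show "T x \<in> K" if "x \<in> space M" for x
  proof (cases "x \<in> uniquely_coded m \<phi> K")
    case True
    have "x \<in> K" using that by (simp add: space_M)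
    then show ?thesis using True induced_map_branch K_cases by metis
  qed (use that in \<open>simp add: induced_map_def space_M\<close>)
qed

lemma T_branch_AE: "AE x in M. \<forall>j\<in>{1..m}. T (\<phi> j x) = x"
proof -
  let ?N = "K - uniquely_coded m \<phi> K"
  have meas: "(\<lambda>x. \<Sum>j=1..m. ennreal (p j x) * indicator ?N (\<phi> j x)) \<in> borel_measurable M"
    using p_measurable \<phi>_measurable not_uniquely_coded_null
    by (intro borel_measurable_sum borel_measurable_times_ennreal measurable_compose[OF _ measurable_ennreal]
        measurable_compose[OF _ borel_measurable_indicator]) auto
  have "(\<integral>\<^sup>+x. (\<Sum>j=1..m. ennreal (p j x) * indicator ?N (\<phi> j x)) \<partial>M) = (\<integral>\<^sup>+x. indicator ?N x \<partial>M)"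
    using not_uniquely_coded_null by (intro stationary[symmetric]) auto
  also have "\<dots> = 0" using not_uniquely_coded_null by (simp add: null_setsD1 null_setsD2)
  finally have "AE x in M. (\<Sum>j=1..m. ennreal (p j x) * indicator ?N (\<phi> j x)) = 0"
    using nn_integral_0_iff_AE[OF meas] by simp
  then show ?thesis using AE_space
  proof (eventually_elim, intro ballI)
    fix x j
    assume z: "(\<Sum>j=1..m. ennreal (p j x) * indicator ?N (\<phi> j x)) = 0" and j: "j \<in> {1..m}"
      and "x \<in> space M"
    then have x: "x \<in> K" by (simp add: space_M)
    have "\<forall>k\<in>{1..m}. ennreal (p k x) * indicator ?N (\<phi> k x) = 0"
      using z by (subst (asm) sum_eq_0_iff) auto
    then have "ennreal (p j x) * indicator ?N (\<phi> j x) = 0" using j by blast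
    then have "\<phi> j x \<notin> ?N" using p_pos[OF j x] by (auto simp: indicator_def split: if_splits)
    then show "T (\<phi> j x) = x" using induced_map_branch[OF j x] maps_K[OF j x] by blast
  qed
qed

definition transfer :: "('a \<Rightarrow> real) \<Rightarrow> 'a \<Rightarrow> real" where
  "transfer f x = (\<Sum>j=1..m. p j x * f (\<phi> j x))"

lemma transfer_nonneg: "(\<And>x. x \<in> K \<Longrightarrow> 0 \<le> f x) \<Longrightarrow> x \<in> K \<Longrightarrow> 0 \<le> transfer f x"
  unfolding transfer_def using p_pos maps_K by (intro sum_nonneg mult_nonneg_nonneg) (auto intro: less_imp_le)

lemma transfer_measurable: "f \<in> borel_measurable M \<Longrightarrow> transfer f \<in> borel_measurable M"
  unfolding transfer_def[abs_def] using p_measurable measurable_compose[OF \<phi>_measurable]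
  by (intro borel_measurable_sum borel_measurable_times)

lemma funpow_transfer_nonneg:
  "(\<And>x. x \<in> K \<Longrightarrow> 0 \<le> f x) \<Longrightarrow> x \<in> K \<Longrightarrow> 0 \<le> (transfer ^^ n) f x"
  by (induction n arbitrary: x) (auto intro: transfer_nonneg)

lemma funpow_transfer_measurable: "f \<in> borel_measurable M \<Longrightarrow> (transfer ^^ n) f \<in> borel_measurable M"
  by (induction n) (auto intro: transfer_measurable)

lemma funpow_T_measurable: "T ^^ n \<in> measurable M M"
proof (induction n)
  case (Suc n)
  then show ?case using measurable_comp[OF Suc.IH T_measurable] by (simp add: o_def)
qed (simp add: id_def)

text \<open>The map \<open>T\<close> inverts almost surely every branch, hence the transfer operator is the adjoint of
  composition with \<open>T\<close>.\<close>

lemma transfer_duality: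
  assumes "f \<in> borel_measurable M" "\<And>x. x \<in> K \<Longrightarrow> 0 \<le> f x" and F: "F \<in> borel_measurable M"
  shows "(\<integral>\<^sup>+x. ennreal (f x) * F ((T ^^ n) x) \<partial>M) = (\<integral>\<^sup>+x. ennreal ((transfer ^^ n) f x) * F x \<partial>M)"
  using assms(1,2)
proof (induction n arbitrary: f)
  case (Suc n)
  have FT: "(\<lambda>x. F ((T ^^ k) x)) \<in> borel_measurable M" for k
    by (rule measurable_compose[OF funpow_T_measurable F])
  have "(\<integral>\<^sup>+x. ennreal (f x) * F ((T ^^ Suc n) x) \<partial>M)
      = (\<integral>\<^sup>+x. (\<Sum>j=1..m. ennreal (p j x) * (ennreal (f (\<phi> j x)) * F ((T ^^ Suc n) (\<phi> j x)))) \<partial>M)"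
    using Suc.prems FT[of "Suc n"]
    by (intro stationary borel_measurable_times_ennreal measurable_compose[OF _ measurable_ennreal])
  also have "\<dots> = (\<integral>\<^sup>+x. ennreal (transfer f x) * F ((T ^^ n) x) \<partial>M)"
  proof (rule nn_integral_cong_AE)
    show "AE x in M. (\<Sum>j=1..m. ennreal (p j x) * (ennreal (f (\<phi> j x)) * F ((T ^^ Suc n) (\<phi> j x))))
      = ennreal (transfer f x) * F ((T ^^ n) x)"
      using T_branch_AE AE_space
    proof eventually_elim
      fix x assume T: "\<forall>j\<in>{1..m}. T (\<phi> j x) = x" and "x \<in> space M"
      then have x: "x \<in> K" by (simp add: space_M)
      have "(\<Sum>j=1..m. ennreal (p j x) * (ennreal (f (\<phi> j x)) * F ((T ^^ Suc n) (\<phi> j x))))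
         = (\<Sum>j=1..m. ennreal (p j x * f (\<phi> j x))) * F ((T ^^ n) x)"
        unfolding sum_distrib_right
        using T p_pos[OF _ x] maps_K[OF _ x] Suc.prems
        by (intro sum.cong refl) (simp add: funpow_swap1[of T n] ennreal_mult less_imp_le mult.assoc)
      also have "(\<Sum>j=1..m. ennreal (p j x * f (\<phi> j x))) = ennreal (transfer f x)"
        unfolding transfer_def using p_pos[OF _ x] maps_K[OF _ x] Suc.prems
        by (intro sum_ennreal) (simp add: less_imp_le)
      finally show "(\<Sum>j=1..m. ennreal (p j x) * (ennreal (f (\<phi> j x)) * F ((T ^^ Suc n) (\<phi> j x))))
         = ennreal (transfer f x) * F ((T ^^ n) x)" .
    qed
  qed
  also have "\<dots> = (\<integral>\<^sup>+x. ennreal ((transfer ^^ n) (transfer f) x) * F x \<partial>M)"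
    using Suc.prems by (intro Suc.IH transfer_measurable transfer_nonneg)
  finally show ?case by (simp add: funpow_swap1)
qed simp

lemma funpow_T_emeasure:
  assumes "A \<in> sets M"
  shows "emeasure M ((T ^^ n) -` A \<inter> K) = emeasure M A"
proof -
  have t1: "x \<in> K \<Longrightarrow> (transfer ^^ n) (\<lambda>_. 1) x = 1" for x
  proof (induction n arbitrary: x)
    case (Suc n)
    then show ?case using p_sum[OF Suc.prems] maps_K[OF _ Suc.prems] by (simp add: transfer_def)
  qed simp
  have pre: "(T ^^ n) -` A \<inter> K \<in> sets M"
    using measurable_sets[OF funpow_T_measurable assms] by (simp add: space_M)
  have "emeasure M ((T ^^ n) -` A \<inter> K) = (\<integral>\<^sup>+x. indicator ((T ^^ n) -` A \<inter> K) x \<partial>M)" using pre by simp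
  also have "\<dots> = (\<integral>\<^sup>+x. ennreal 1 * indicator A ((T ^^ n) x) \<partial>M)"
    by (intro nn_integral_cong) (auto simp: indicator_def space_M)
  also have "\<dots> = (\<integral>\<^sup>+x. ennreal ((transfer ^^ n) (\<lambda>_. 1) x) * indicator A x \<partial>M)"
    using assms by (intro transfer_duality) auto
  also have "\<dots> = (\<integral>\<^sup>+x. indicator A x \<partial>M)"
    by (intro nn_integral_cong) (simp add: t1 space_M)
  finally show ?thesis using assms by simp
qed

end

section \<open>Contraction of the transfer operator\<close>

text \<open>The right-hand bracket \<open>1 - exp (- u)\<close> exceeds \<open>1 - exp (- \<theta> * u)\<close> by
  \<open>exp (- \<theta> * u) - exp (- u)\<close>, which is at least \<open>exp (- u) * (1 - \<theta>) * u\<close> and so, for \<open>u \<le> U\<close>, a fixed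
  proportion of \<open>1 - exp (- u)\<close>.\<close>

lemma exp_contraction:
  fixes \<theta> u U :: real
  assumes "\<theta> \<le> 1" "0 \<le> u" "u \<le> U"
  shows "1 - exp (- \<theta> * u) \<le> (1 - (1 - \<theta>) * exp (- U)) * (1 - exp (- u))"
proof -
  have "(1 - \<theta>) * exp (- U) * (1 - exp (- u)) \<le> (1 - \<theta>) * exp (- u) * u"
    using assms exp_ge_add_one_self[of "- u"] by (intro mult_mono) auto
  also have "\<dots> = exp (- u) * ((1 - \<theta>) * u)" by simp
  also have "\<dots> \<le> exp (- u) * (exp ((1 - \<theta>) * u) - 1)"
  proof (intro mult_left_mono)
    show "(1 - \<theta>) * u \<le> exp ((1 - \<theta>) * u) - 1"
      using exp_ge_add_one_self[of "(1 - \<theta>) * u"] by linarith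
  qed simp
  also have "\<dots> = exp (- \<theta> * u) - exp (- u)"
    by (simp add: algebra_simps exp_add[symmetric])
  finally show ?thesis by (simp add: algebra_simps)
qed

locale gibbs_ifs = nonoverlapping_ifs m \<phi> \<Omega> K c M p
  for m and \<phi> :: "nat \<Rightarrow> 'a::metric_space \<Rightarrow> 'a" and \<Omega> K c M p +
  fixes A b :: real
  assumes A_pos: "0 < A" and b_pos: "0 < b" and b_le: "b \<le> 1"
    and p_holder: "j \<in> {1..m} \<Longrightarrow> x \<in> K \<Longrightarrow> y \<in> K \<Longrightarrow>
      p j x \<le> exp (A * dist x y powr b) * p j y"
begin

text \<open>The rate is chosen so that \<open>A + rate * c powr b = ((1 + c powr b) / 2) * rate\<close>: the exponent gained
  in one step by the contraction exceeds the loss \<open>A\<close> caused by the variation of the weights.\<close>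

definition rate where "rate = 2 * A / (1 - c powr b)"

text \<open>A Hoelder-type distance on \<open>K\<close>. Its exponential form matches the coupling probability
  \<open>exp (- A * dist x y powr b)\<close>, so that the failure of the coupling and the remaining distance combine
  into a single exponential and one application of the transfer operator already contracts, near and far.\<close>

definition gap where "gap x y = 1 - exp (- rate * dist x y powr b)"

lemma cb: "0 < c powr b" "c powr b < 1"
  using c_pos c_less b_pos powr_less_mono2[of b c 1] by auto

lemma rate_pos: "0 < rate"
  using A_pos cb by (simp add: rate_def)

lemma gap_nonneg: "0 \<le> gap x y" and gap_le: "gap x y \<le> 1"
  using rate_pos by (auto simp: gap_def)

text \<open>The weights at \<open>y\<close> dominate the multiple \<open>\<epsilon>\<close> of those at \<open>x\<close>. On this common part both points follow
  the same branch and come closer; the remaining mass \<open>1 - \<epsilon>\<close> costs at most the full oscillation \<open>L\<close>.\<close>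

lemma transfer_contraction_le:
  assumes L: "0 \<le> L" and f: "\<And>x y. x \<in> K \<Longrightarrow> y \<in> K \<Longrightarrow> f x - f y \<le> L * gap x y"
    and x: "x \<in> K" and y: "y \<in> K"
  shows "transfer f x - transfer f y \<le> L * (1 - exp (- ((1 + c powr b) / 2) * (rate * dist x y powr b)))"
proof -
  define s where "s = dist x y powr b"
  define \<theta> where "\<theta> = c powr b"
  define \<epsilon> where "\<epsilon> = exp (- A * s)"
  have s: "0 \<le> s" by (simp add: s_def)
  have \<epsilon>: "0 < \<epsilon>" "\<epsilon> \<le> 1" using s A_pos by (auto simp: \<epsilon>_def)
  define r where "r j = p j y - \<epsilon> * p j x" for j
  have r: "0 \<le> r j" if j: "j \<in> {1..m}" for j
  proof -
    have "\<epsilon> * p j x \<le> \<epsilon> * (exp (A * s) * p j y)"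
      using p_holder[OF j x y] \<epsilon> by (intro mult_left_mono) (auto simp: s_def)
    also have "\<dots> = p j y" by (simp add: \<epsilon>_def mult.assoc[symmetric] exp_add[symmetric])
    finally show ?thesis by (simp add: r_def)
  qed
  have r_sum: "(\<Sum>j=1..m. r j) = 1 - \<epsilon>"
    using p_sum[OF x] p_sum[OF y] by (simp add: r_def sum_subtractf sum_distrib_left[symmetric])
  have close: "f (\<phi> j x) - f (\<phi> j y) \<le> L * (1 - exp (- rate * (\<theta> * s)))" if j: "j \<in> {1..m}" for j
  proof -
    have "dist (\<phi> j x) (\<phi> j y) powr b \<le> (c * dist x y) powr b"
      using contr[OF j, of x y] x y K_sub b_pos by (intro powr_mono2) auto
    also have "\<dots> = \<theta> * s" using c_pos by (simp add: powr_mult \<theta>_def s_def)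
    finally have "gap (\<phi> j x) (\<phi> j y) \<le> 1 - exp (- rate * (\<theta> * s))"
      using rate_pos by (simp add: gap_def)
    then show ?thesis
      using f[OF maps_K[OF j x] maps_K[OF j y]] L by (meson mult_left_mono order_trans)
  qed
  define t where "t = transfer f x"
  have far: "t - L \<le> f (\<phi> k y)" if k: "k \<in> {1..m}" for k
  proof -
    have "f (\<phi> j x) \<le> f (\<phi> k y) + L" if j: "j \<in> {1..m}" for j
    proof -
      have "f (\<phi> j x) - f (\<phi> k y) \<le> L * gap (\<phi> j x) (\<phi> k y)"
        by (rule f[OF maps_K[OF j x] maps_K[OF k y]])
      also have "\<dots> \<le> L" using L gap_le gap_nonneg by (intro mult_left_le) auto
      finally show ?thesis by simp
    qed
    then have "t \<le> (\<Sum>j=1..m. p j x * (f (\<phi> k y) + L))"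
      unfolding t_def transfer_def using p_pos[OF _ x] by (intro sum_mono mult_left_mono) (auto simp: less_imp_le)
    also have "\<dots> = f (\<phi> k y) + L" using p_sum[OF x] by (simp add: sum_distrib_right[symmetric])
    finally show ?thesis by simp
  qed
  have "(1 - \<epsilon>) * (t - L) = (\<Sum>j=1..m. r j * (t - L))"
    by (simp add: r_sum[symmetric] sum_distrib_right)
  also have "\<dots> \<le> (\<Sum>j=1..m. r j * f (\<phi> j y))"
    using far r by (intro sum_mono mult_left_mono) auto
  finally have 1: "(1 - \<epsilon>) * (t - L) \<le> (\<Sum>j=1..m. r j * f (\<phi> j y))" .
  have "(\<Sum>j=1..m. p j x * (f (\<phi> j x) - f (\<phi> j y))) \<le> (\<Sum>j=1..m. p j x * (L * (1 - exp (- rate * (\<theta> * s)))))"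
    using close p_pos[OF _ x] by (intro sum_mono mult_left_mono) (auto simp: less_imp_le)
  also have "\<dots> = L * (1 - exp (- rate * (\<theta> * s)))"
    using p_sum[OF x] by (simp add: sum_distrib_right[symmetric])
  finally have 2: "(\<Sum>j=1..m. p j x * (f (\<phi> j x) - f (\<phi> j y))) \<le> L * (1 - exp (- rate * (\<theta> * s)))" .
  have "transfer f x - transfer f y =
      \<epsilon> * (\<Sum>j=1..m. p j x * (f (\<phi> j x) - f (\<phi> j y))) + (1 - \<epsilon>) * t - (\<Sum>j=1..m. r j * f (\<phi> j y))"
    unfolding t_def transfer_def r_def
    by (simp add: algebra_simps sum_subtractf sum_distrib_left)
  also have "\<dots> \<le> \<epsilon> * (L * (1 - exp (- rate * (\<theta> * s)))) + (1 - \<epsilon>) * t - (1 - \<epsilon>) * (t - L)"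
    using 1 2 \<epsilon> by (intro diff_mono add_mono mult_left_mono) auto
  also have "\<dots> = L * (1 - \<epsilon> * exp (- rate * (\<theta> * s)))" by (simp add: algebra_simps)
  also have "\<epsilon> * exp (- rate * (\<theta> * s)) = exp (- (A + rate * \<theta>) * s)"
    by (simp add: \<epsilon>_def exp_add[symmetric] algebra_simps)
  also have "A + rate * \<theta> = (1 + \<theta>) / 2 * rate"
  proof -
    have "1 - \<theta> \<noteq> 0" using cb by (simp add: \<theta>_def)
    then have "A = rate * (1 - \<theta>) / 2" by (simp add: rate_def \<theta>_def)
    then show ?thesis by (simp add: field_simps)
  qed
  finally show ?thesis by (simp add: s_def \<theta>_def mult.assoc)
qed

lemma transfer_contraction:
  "\<exists>\<kappa>. 0 < \<kappa> \<and> \<kappa> < 1 \<and> (\<forall>f L. 0 \<le> L \<longrightarrow> (\<forall>x\<in>K. \<forall>y\<in>K. f x - f y \<le> L * gap x y) \<longrightarrow>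
     (\<forall>x\<in>K. \<forall>y\<in>K. transfer f x - transfer f y \<le> \<kappa> * L * gap x y))"
proof -
  obtain B where B: "\<And>x y. x \<in> \<Omega> \<Longrightarrow> y \<in> \<Omega> \<Longrightarrow> dist x y \<le> B"
    using bdd unfolding bounded_two_points by blast
  define U where "U = rate * (max B 0) powr b"
  define \<eta> where "\<eta> = (1 + c powr b) / 2"
  define \<kappa> where "\<kappa> = 1 - (1 - \<eta>) * exp (- U)"
  have "c powr b / 2 > 0" using cb(1) by (rule half_gt_zero)
  then have \<eta>: "0 < \<eta>" "\<eta> < 1" using cb(2) unfolding \<eta>_def add_divide_distrib by linarith+
  have "0 \<le> U" using rate_pos by (simp add: U_def)
  then have "(1 - \<eta>) * exp (- U) \<le> 1 - \<eta>" using \<eta> by (intro mult_left_le) auto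
  then have "(1 - \<eta>) * exp (- U) < 1" by (rule le_less_trans) (simp add: \<eta>(1))
  then have "0 < \<kappa>" by (simp add: \<kappa>_def)
  moreover have "\<kappa> < 1" using \<eta>(2) by (simp add: \<kappa>_def)
  moreover have "transfer f x - transfer f y \<le> \<kappa> * L * gap x y"
    if L: "0 \<le> L" and f: "\<forall>x\<in>K. \<forall>y\<in>K. f x - f y \<le> L * gap x y" and xy: "x \<in> K" "y \<in> K" for f L x y
  proof -
    have "dist x y \<le> B" using B xy K_sub by blast
    then have "dist x y powr b \<le> (max B 0) powr b" using b_pos by (intro powr_mono2) auto
    then have u: "rate * dist x y powr b \<le> U" unfolding U_def using rate_pos by (intro mult_left_mono) auto
    have "transfer f x - transfer f y \<le> L * (1 - exp (- \<eta> * (rate * dist x y powr b)))"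
      unfolding \<eta>_def using f by (intro transfer_contraction_le L xy) auto
    also have "\<dots> \<le> L * (\<kappa> * gap x y)"
      unfolding \<kappa>_def gap_def using exp_contraction[OF _ _ u, of \<eta>] \<eta> rate_pos
      by (intro mult_left_mono L) simp
    finally show ?thesis by (simp add: mult_ac)
  qed
  ultimately show ?thesis by blast
qed

text \<open>Near the diagonal the gap is comparable to \<open>dist x y powr b\<close>, which dominates the distance because
  \<open>b \<le> 1\<close> and \<open>K\<close> is bounded.\<close>

lemma lipschitz_gap:
  "\<exists>D>0. \<forall>x\<in>K. \<forall>y\<in>K. dist x y \<le> D * gap x y"
proof -
  obtain B' where B': "\<And>x y. x \<in> \<Omega> \<Longrightarrow> y \<in> \<Omega> \<Longrightarrow> dist x y \<le> B'"
    using bdd unfolding bounded_two_points by blast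
  define B where "B = max B' 1"
  define D where "D = B powr (1 - b) * ((1 + rate * B powr b) / rate)"
  have "dist x y \<le> D * gap x y" if xy: "x \<in> K" "y \<in> K" for x y
  proof (cases "x = y")
    case False
    define d where "d = dist x y"
    define t where "t = rate * d powr b"
    have "dist x y \<le> B'" using B' xy K_sub by blast
    then have d: "0 < d" "d \<le> B" using False by (auto simp: d_def B_def)
    have t: "0 \<le> t" "t \<le> rate * B powr b"
      using d rate_pos b_pos by (auto simp: t_def intro!: mult_left_mono powr_mono2)
    (* The elementary bound t / (1 + t) <= 1 - exp (- t) makes the gap linear in t on bounded sets. *)
    have "(1 + t) * exp (- t) \<le> exp t * exp (- t)"
      using exp_ge_add_one_self[of t] by (intro mult_right_mono) auto
    then have "t \<le> (1 + t) * (1 - exp (- t))" by (simp add: exp_add[symmetric] algebra_simps)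
    also have "\<dots> \<le> (1 + rate * B powr b) * (1 - exp (- t))"
      using t by (intro mult_right_mono) auto
    finally have "t \<le> (1 + rate * B powr b) * gap x y" by (simp add: gap_def t_def d_def)
    then have 1: "d powr b \<le> (1 + rate * B powr b) / rate * gap x y"
      using rate_pos by (simp add: t_def field_simps)
    have "d = d powr (1 - b) * d powr b" using d by (simp add: powr_add[symmetric])
    also have "\<dots> \<le> B powr (1 - b) * ((1 + rate * B powr b) / rate * gap x y)"
      using 1 d b_le by (intro mult_mono powr_mono2) auto
    finally show ?thesis by (simp add: D_def d_def mult.assoc)
  qed (simp add: gap_def)
  moreover have "0 < D"
    unfolding D_def B_def using rate_pos by (intro mult_pos_pos divide_pos_pos add_pos_nonneg) auto
  ultimately show ?thesis by blast
qed

text \<open>The oscillation of the iterates \<open>(transfer ^^ n) f\<close> decays geometrically while stationarity fixes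
  their mean, so they converge uniformly to the mean of \<open>f\<close>. Duality turns this into decay of correlations;
  the upper bound suffices since it will be applied to a set and to its complement.\<close>

proposition transfer_decay:
  obtains \<kappa> D where "0 < \<kappa>" "\<kappa> < 1" "0 < D"
    "\<And>f L F n. (\<And>x. 0 \<le> f x) \<Longrightarrow> 0 \<le> L \<Longrightarrow> L-lipschitz_on UNIV f \<Longrightarrow> F \<in> borel_measurable M \<Longrightarrow>
      (\<integral>\<^sup>+x. ennreal (f x) * F ((T ^^ n) x) \<partial>M) \<le>
      ((\<integral>\<^sup>+x. ennreal (f x) \<partial>M) + ennreal (D * L * \<kappa> ^ n)) * (\<integral>\<^sup>+x. F x \<partial>M)"
proof -
  obtain \<kappa> where \<kappa>: "0 < \<kappa>" "\<kappa> < 1" and contraction: "\<And>f L. 0 \<le> L \<Longrightarrow>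
      \<forall>x\<in>K. \<forall>y\<in>K. f x - f y \<le> L * gap x y \<Longrightarrow>
      \<forall>x\<in>K. \<forall>y\<in>K. transfer f x - transfer f y \<le> \<kappa> * L * gap x y"
    using transfer_contraction by blast
  obtain D where D: "0 < D" "\<And>x y. x \<in> K \<Longrightarrow> y \<in> K \<Longrightarrow> dist x y \<le> D * gap x y"
    using lipschitz_gap by blast
  have "(\<integral>\<^sup>+x. ennreal (f x) * F ((T ^^ n) x) \<partial>M) \<le>
      ((\<integral>\<^sup>+x. ennreal (f x) \<partial>M) + ennreal (D * L * \<kappa> ^ n)) * (\<integral>\<^sup>+x. F x \<partial>M)"
    if f: "\<And>x. 0 \<le> f x" and L: "0 \<le> L" and lip: "L-lipschitz_on UNIV f" and F: "F \<in> borel_measurable M"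
    for f L F n
  proof -
    have fm: "f \<in> borel_measurable M"
      using lipschitz_on_continuous_on[OF lip] continuous_on_subset
      by (intro continuous_measurable_M) blast
    have osc: "\<forall>x\<in>K. \<forall>y\<in>K. (transfer ^^ k) f x - (transfer ^^ k) f y \<le> (\<kappa> ^ k * (L * D)) * gap x y" for k
    proof (induction k)
      case 0
      show ?case
      proof (intro ballI)
        fix x y assume xy: "x \<in> K" "y \<in> K"
        have "f x - f y \<le> L * dist x y"
          using lipschitz_onD[OF lip, of x y] by (simp add: dist_real_def)
        also have "\<dots> \<le> L * (D * gap x y)" using D xy L by (intro mult_left_mono) auto
        finally show "(transfer ^^ 0) f x - (transfer ^^ 0) f y \<le> \<kappa> ^ 0 * (L * D) * gap x y" by simp
      qed
    next
      case (Suc k)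
      show ?case using contraction[OF _ Suc.IH] \<kappa> L D by (simp add: mult.assoc)
    qed
    have bound: "ennreal ((transfer ^^ n) f x) \<le> (\<integral>\<^sup>+x. ennreal (f x) \<partial>M) + ennreal (D * L * \<kappa> ^ n)"
      if x: "x \<in> K" for x
    proof -
      have pn: "0 \<le> (transfer ^^ n) f y" if "y \<in> K" for y using funpow_transfer_nonneg f that by auto
      have "ennreal ((transfer ^^ n) f x) = (\<integral>\<^sup>+y. ennreal ((transfer ^^ n) f x) \<partial>M)"
        by (simp add: emeasure_space_1)
      also have "\<dots> \<le> (\<integral>\<^sup>+y. ennreal ((transfer ^^ n) f y) + ennreal (D * L * \<kappa> ^ n) \<partial>M)"
      proof (rule nn_integral_mono)
        fix y assume "y \<in> space M"
        then have y: "y \<in> K" by (simp add: space_M)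
        have "(transfer ^^ n) f x - (transfer ^^ n) f y \<le> \<kappa> ^ n * (L * D) * gap x y" using osc x y by blast
        also have "\<dots> \<le> \<kappa> ^ n * (L * D)" using gap_le gap_nonneg \<kappa> L D by (intro mult_left_le) auto
        finally have "(transfer ^^ n) f x \<le> (transfer ^^ n) f y + D * L * \<kappa> ^ n" by (simp add: mult_ac)
        then show "ennreal ((transfer ^^ n) f x) \<le> ennreal ((transfer ^^ n) f y) + ennreal (D * L * \<kappa> ^ n)"
          using pn[OF y] D L \<kappa> by (simp add: ennreal_plus[symmetric] ennreal_leI del: ennreal_plus)
      qed
      also have "\<dots> = (\<integral>\<^sup>+y. ennreal ((transfer ^^ n) f y) \<partial>M) + ennreal (D * L * \<kappa> ^ n)"
        using funpow_transfer_measurable[OF fm]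
        by (subst nn_integral_add) (auto simp: emeasure_space_1)
      also have "(\<integral>\<^sup>+y. ennreal ((transfer ^^ n) f y) \<partial>M) = (\<integral>\<^sup>+x. ennreal (f x) \<partial>M)"
        using transfer_duality[OF fm, of "\<lambda>_. 1" n] f by simp
      finally show ?thesis .
    qed
    have "(\<integral>\<^sup>+x. ennreal (f x) * F ((T ^^ n) x) \<partial>M) = (\<integral>\<^sup>+x. ennreal ((transfer ^^ n) f x) * F x \<partial>M)"
      using f by (intro transfer_duality fm F) auto
    also have "\<dots> \<le> (\<integral>\<^sup>+x. ((\<integral>\<^sup>+x. ennreal (f x) \<partial>M) + ennreal (D * L * \<kappa> ^ n)) * F x \<partial>M)"
      using bound by (intro nn_integral_mono mult_right_mono) (auto simp: space_M)
    also have "\<dots> = ((\<integral>\<^sup>+x. ennreal (f x) \<partial>M) + ennreal (D * L * \<kappa> ^ n)) * (\<integral>\<^sup>+x. F x \<partial>M)"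
      by (rule nn_integral_cmult[OF F])
    finally show ?thesis .
  qed
  then show ?thesis by (rule that[OF \<kappa> D(1)])
qed

end

section \<open>From decay of correlations to mixing of sets\<close>

lemma thickened_indicator_lipschitz:
  fixes E :: "'a::metric_space set"
  assumes "0 < \<rho>"
  shows "(1 / \<rho>)-lipschitz_on UNIV (\<lambda>x. max 0 (1 - infdist x E / \<rho>))"
proof (rule lipschitz_onI)
  fix x y :: 'a
  have "\<bar>max 0 (1 - infdist x E / \<rho>) - max 0 (1 - infdist y E / \<rho>)\<bar> \<le> \<bar>infdist x E / \<rho> - infdist y E / \<rho>\<bar>"
    by linarith
  also have "\<dots> = \<bar>infdist x E - infdist y E\<bar> / \<rho>"
    using assms by (simp add: diff_divide_distrib[symmetric])
  also have "\<dots> \<le> dist x y / \<rho>"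
    using assms infdist_triangle_abs by (intro divide_right_mono) auto
  finally show "dist (max 0 (1 - infdist x E / \<rho>)) (max 0 (1 - infdist y E / \<rho>)) \<le> 1 / \<rho> * dist x y"
    by (simp add: dist_real_def)
qed (use assms in simp)

text \<open>The segment from \<open>x\<close> to a nearby point of \<open>E\<close> crosses the frontier of \<open>E\<close>.\<close>

lemma infdist_less_imp_near_frontier:
  fixes E :: "'a::euclidean_space set"
  assumes "E \<noteq> {}" "x \<notin> E" "infdist x E < \<rho>"
  shows "x \<in> open_neighbourhood (frontier E) \<rho>"
proof -
  obtain y where y: "y \<in> E" "dist x y < \<rho>"
    using assms cInf_lessD[of "dist x ` E" \<rho>] by (auto simp: infdist_def)
  have "closed_segment x y \<inter> frontier E \<noteq> {}"
    using assms y by (intro connected_Int_frontier) auto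
  then obtain z where z: "z \<in> closed_segment x y" "z \<in> frontier E" by blast
  have "infdist x (frontier E) \<le> dist x z" by (rule infdist_le[OF z(2)])
  also have "\<dots> \<le> dist x y" using dist_in_closed_segment[OF z(1)] by (simp add: dist_commute)
  finally show ?thesis using y z by (auto simp: open_neighbourhood_def)
qed

lemma open_neighbourhood_borel: "open_neighbourhood A \<rho> \<in> sets borel"
proof -
  have "open {x. infdist x A < \<rho>}"
    by (intro open_Collect_less continuous_intros)
  then show ?thesis by (cases "A = {}") (auto simp: open_neighbourhood_def)
qed

text \<open>The interface between the dynamics and the geometry of the sets: correlations of Lipschitz
  functions with arbitrary functions decay, with a constant proportional to the Lipschitz constant.\<close>

locale lipschitz_decay = prob_space \<mu> for \<mu> :: "'a::euclidean_space measure" +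
  fixes T :: "'a \<Rightarrow> 'a" and D \<kappa> :: real
  assumes sets_\<mu>: "sets \<mu> = sets borel"
    and T_meas: "T \<in> measurable \<mu> \<mu>" and T_inv: "distr \<mu> \<mu> T = \<mu>"
    and \<kappa>: "0 < \<kappa>" "\<kappa> < 1" and D_pos: "0 < D"
    and decay: "\<And>f L F n. (\<And>x. 0 \<le> f x) \<Longrightarrow> 0 \<le> L \<Longrightarrow> L-lipschitz_on UNIV f \<Longrightarrow> F \<in> borel_measurable \<mu> \<Longrightarrow>
      (\<integral>\<^sup>+x. ennreal (f x) * F ((T ^^ n) x) \<partial>\<mu>) \<le>
      ((\<integral>\<^sup>+x. ennreal (f x) \<partial>\<mu>) + ennreal (D * L * \<kappa> ^ n)) * (\<integral>\<^sup>+x. F x \<partial>\<mu>)"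
begin

lemma space_\<mu>: "space \<mu> = UNIV"
  using sets_eq_imp_space_eq[OF sets_\<mu>] by simp

lemma funpow_T_invariant: "T ^^ n \<in> measurable \<mu> \<mu> \<and> distr \<mu> \<mu> (T ^^ n) = \<mu>"
proof (induction n)
  case 0
  then show ?case by (simp add: id_def distr_id2)
next
  case (Suc n)
  have "distr \<mu> \<mu> (T ^^ Suc n) = distr (distr \<mu> \<mu> (T ^^ n)) \<mu> T"
    using Suc T_meas by (subst distr_distr) auto
  then show ?case using Suc T_inv measurable_comp[of "T ^^ n" \<mu> \<mu> T \<mu>] T_meas by (simp add: o_def)
qed

abbreviation \<mu>c where "\<mu>c \<equiv> completion \<mu>"

lemma prob_space_completion: "prob_space \<mu>c"
  by (rule prob_spaceI) (simp add: emeasure_space_1)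

interpretation c: prob_space \<mu>c by (rule prob_space_completion)

lemma funpow_T_null:
  assumes "N \<in> null_sets \<mu>"
  shows "(T ^^ n) -` N \<in> null_sets \<mu>"
proof (rule null_setsI)
  show "(T ^^ n) -` N \<in> sets \<mu>"
    using measurable_sets[of "T ^^ n" \<mu> \<mu> N] funpow_T_invariant assms by (auto simp: space_\<mu>)
  have "emeasure \<mu> ((T ^^ n) -` N) = emeasure (distr \<mu> \<mu> (T ^^ n)) N"
    using funpow_T_invariant assms by (subst emeasure_distr) (auto simp: space_\<mu>)
  then show "emeasure \<mu> ((T ^^ n) -` N) = 0"
    using funpow_T_invariant[of n] assms by auto
qed

lemma completion_vimage:
  assumes F: "F \<in> sets \<mu>c"
  obtains S where "S \<in> sets \<mu>" "AE x in \<mu>c. x \<in> F \<longleftrightarrow> x \<in> S"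
    "AE x in \<mu>c. (T ^^ n) x \<in> F \<longleftrightarrow> (T ^^ n) x \<in> S" "(T ^^ n) -` F \<in> sets \<mu>c"
proof -
  obtain S N N' where S: "F = S \<union> N" "N \<subseteq> N'" "N' \<in> null_sets \<mu>" "S \<in> sets \<mu>"
    using sets_completionE[OF F] by metis
  have n: "(T ^^ n) -` N' \<in> null_sets \<mu>" by (rule funpow_T_null[OF S(3)])
  show ?thesis
  proof (rule that[OF S(4)])
    show "AE x in \<mu>c. x \<in> F \<longleftrightarrow> x \<in> S"
      using AE_completion[OF AE_not_in[OF S(3)]] by eventually_elim (use S in auto)
    show "AE x in \<mu>c. (T ^^ n) x \<in> F \<longleftrightarrow> (T ^^ n) x \<in> S"
      using AE_completion[OF AE_not_in[OF n]] by eventually_elim (use S in auto)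
    have "(T ^^ n) -` S \<in> sets \<mu>"
      using measurable_sets[of "T ^^ n" \<mu> \<mu> S] funpow_T_invariant S by (auto simp: space_\<mu>)
    then show "(T ^^ n) -` F \<in> sets \<mu>c"
      by (intro sets_completionI[of _ "(T ^^ n) -` S" "(T ^^ n) -` N", OF _ _ n]) (use S in auto)
  qed
qed

lemma measure_vimage:
  assumes F: "F \<in> sets \<mu>c"
  shows "measure \<mu>c ((T ^^ n) -` F) = measure \<mu>c F"
proof -
  obtain S where S: "S \<in> sets \<mu>" "AE x in \<mu>c. x \<in> F \<longleftrightarrow> x \<in> S"
    "AE x in \<mu>c. (T ^^ n) x \<in> F \<longleftrightarrow> (T ^^ n) x \<in> S" "(T ^^ n) -` F \<in> sets \<mu>c"
    using completion_vimage[OF F] .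
  have Sn: "(T ^^ n) -` S \<in> sets \<mu>"
    using measurable_sets[of "T ^^ n" \<mu> \<mu> S] funpow_T_invariant S by (auto simp: space_\<mu>)
  have "measure \<mu>c ((T ^^ n) -` F) = measure \<mu>c ((T ^^ n) -` S)"
    using S Sn by (intro measure_eq_AE) auto
  also have "\<dots> = measure (distr \<mu> \<mu> (T ^^ n)) S"
    using Sn S funpow_T_invariant by (subst measure_distr) (auto simp: space_\<mu>)
  also have "\<dots> = measure \<mu>c S" using funpow_T_invariant[of n] S by simp
  also have "\<dots> = measure \<mu>c F" using S F by (intro measure_eq_AE) auto
  finally show ?thesis .
qed

text \<open>The indicator of \<open>E\<close> is dominated by a function with Lipschitz constant \<open>1 / \<rho>\<close> which differs from
  it only within distance \<open>\<rho>\<close> of the frontier.\<close>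

lemma mixing_upper:
  assumes E: "E \<in> sets \<mu>c" and F: "F \<in> sets \<mu>c" and \<rho>: "0 < \<rho>"
  shows "measure \<mu>c (E \<inter> (T ^^ n) -` F) \<le>
    (measure \<mu>c E + measure \<mu> (open_neighbourhood (frontier E) \<rho>) + D / \<rho> * \<kappa> ^ n) * measure \<mu>c F"
proof (cases "E = {}")
  case True
  then show ?thesis using \<kappa> D_pos \<rho> by (auto intro!: mult_nonneg_nonneg add_nonneg_nonneg)
next
  case False
  define f where "f x = max 0 (1 - infdist x E / \<rho>)" for x
  define B where "B = open_neighbourhood (frontier E) \<rho>"
  have B: "B \<in> sets \<mu>" unfolding B_def sets_\<mu> by (rule open_neighbourhood_borel)
  have f0: "0 \<le> f x" for x by (simp add: f_def)
  have f1: "f x = 1" if "x \<in> E" for x using that by (simp add: f_def)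
  have fle: "f x \<le> indicator E x + indicator B x" for x
  proof (cases "x \<in> E \<or> f x = 0")
    case False
    then have "infdist x E < \<rho>" using \<rho> by (auto simp: f_def max_def field_simps split: if_splits)
    then have "x \<in> B" unfolding B_def using False \<open>E \<noteq> {}\<close> by (intro infdist_less_imp_near_frontier) auto
    moreover have "f x \<le> 1" using \<rho> infdist_nonneg[of x E] by (simp add: f_def)
    ultimately show ?thesis using False by simp
  qed (auto simp: f1)
  obtain S where S: "S \<in> sets \<mu>" "AE x in \<mu>c. x \<in> F \<longleftrightarrow> x \<in> S"
    "AE x in \<mu>c. (T ^^ n) x \<in> F \<longleftrightarrow> (T ^^ n) x \<in> S" "(T ^^ n) -` F \<in> sets \<mu>c"
    using completion_vimage[OF F] .
  have FS: "emeasure \<mu>c F = emeasure \<mu> S"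
    using emeasure_eq_AE[OF S(2) F] S(1) by simp
  have "emeasure \<mu>c (E \<inter> (T ^^ n) -` F) = (\<integral>\<^sup>+x. indicator (E \<inter> (T ^^ n) -` F) x \<partial>\<mu>c)"
    using E S by simp
  also have "\<dots> \<le> (\<integral>\<^sup>+x. ennreal (f x) * indicator S ((T ^^ n) x) \<partial>\<mu>c)"
  proof (rule nn_integral_mono_AE)
    show "AE x in \<mu>c. indicator (E \<inter> (T ^^ n) -` F) x \<le> ennreal (f x) * indicator S ((T ^^ n) x)"
      using S(3) by eventually_elim (auto simp: indicator_def f1)
  qed
  also have "\<dots> = (\<integral>\<^sup>+x. ennreal (f x) * indicator S ((T ^^ n) x) \<partial>\<mu>)" by (rule nn_integral_completion)
  also have "\<dots> \<le> ((\<integral>\<^sup>+x. ennreal (f x) \<partial>\<mu>) + ennreal (D * (1 / \<rho>) * \<kappa> ^ n)) * (\<integral>\<^sup>+x. indicator S x \<partial>\<mu>)"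
    using \<rho> S f0 thickened_indicator_lipschitz[OF \<rho>, of E] unfolding f_def by (intro decay) auto
  also have "(\<integral>\<^sup>+x. indicator S x \<partial>\<mu>) = emeasure \<mu>c F" using S FS by simp
  also have "(\<integral>\<^sup>+x. ennreal (f x) \<partial>\<mu>) = (\<integral>\<^sup>+x. ennreal (f x) \<partial>\<mu>c)" by (rule nn_integral_completion[symmetric])
  also have "\<dots> \<le> (\<integral>\<^sup>+x. indicator E x + indicator B x \<partial>\<mu>c)"
  proof (rule nn_integral_mono)
    fix x
    show "ennreal (f x) \<le> indicator E x + indicator B x"
      using ennreal_leI[OF fle[of x]] by (auto simp: indicator_def)
  qed
  also have "\<dots> = emeasure \<mu>c E + emeasure \<mu>c B"
    using E sets_completionI_sets[OF B] by (subst nn_integral_add) (auto simp del: sets_completionI_sets)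
  finally have "emeasure \<mu>c (E \<inter> (T ^^ n) -` F) \<le>
      (emeasure \<mu>c E + emeasure \<mu>c B + ennreal (D * (1 / \<rho>) * \<kappa> ^ n)) * emeasure \<mu>c F"
    by (simp add: mult_right_mono add_right_mono)
  also have "\<dots> = ennreal ((measure \<mu>c E + measure \<mu>c B + D * (1 / \<rho>) * \<kappa> ^ n) * measure \<mu>c F)"
    using D_pos \<rho> \<kappa> by (simp add: c.emeasure_eq_measure ennreal_mult'' ennreal_plus[symmetric] del: ennreal_plus)
  finally show ?thesis
    using D_pos \<rho> \<kappa> B
    by (simp add: c.emeasure_eq_measure B_def ennreal_le_iff)
qed

text \<open>The lower bound is the upper bound for the complement of \<open>E\<close>, which has the same frontier.\<close>

lemma mixing_bound:
  assumes E: "E \<in> sets \<mu>c" and F: "F \<in> sets \<mu>c" "0 < measure \<mu>c F" and \<rho>: "0 < \<rho>"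
  shows "\<bar>measure \<mu>c (E \<inter> (T ^^ n) -` F) / measure \<mu>c F - measure \<mu>c E\<bar> \<le>
    measure \<mu> (open_neighbourhood (frontier E) \<rho>) + D / \<rho> * \<kappa> ^ n"
proof -
  define e where "e = measure \<mu> (open_neighbourhood (frontier E) \<rho>) + D / \<rho> * \<kappa> ^ n"
  have TF: "(T ^^ n) -` F \<in> sets \<mu>c" using completion_vimage[OF F(1)] by metis
  have Ec: "- E \<in> sets \<mu>c" using sets.compl_sets[OF E] by (simp add: space_\<mu> Compl_eq_Diff_UNIV)
  have up: "measure \<mu>c (E \<inter> (T ^^ n) -` F) \<le> (measure \<mu>c E + e) * measure \<mu>c F"
    using mixing_upper[OF E F(1) \<rho>, of n] by (simp add: e_def add.assoc)
  have "measure \<mu>c (- E) = 1 - measure \<mu>c E"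
    using c.prob_compl[OF E] by (simp add: space_\<mu> Compl_eq_Diff_UNIV)
  then have "measure \<mu>c (- E \<inter> (T ^^ n) -` F) \<le> (1 - measure \<mu>c E + e) * measure \<mu>c F"
    using mixing_upper[OF Ec F(1) \<rho>, of n] by (simp add: e_def add.assoc)
  moreover have "measure \<mu>c ((T ^^ n) -` F) = measure \<mu>c (E \<inter> (T ^^ n) -` F) + measure \<mu>c (- E \<inter> (T ^^ n) -` F)"
    using E Ec TF by (subst c.finite_measure_Union[symmetric]) (auto intro!: arg_cong[where f = "measure \<mu>c"])
  ultimately have low: "(measure \<mu>c E - e) * measure \<mu>c F \<le> measure \<mu>c (E \<inter> (T ^^ n) -` F)"
    using measure_vimage[OF F(1), of n] by (simp add: algebra_simps)
  have "measure \<mu>c (E \<inter> (T ^^ n) -` F) / measure \<mu>c F \<le> measure \<mu>c E + e"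
    using up F(2) by (simp add: divide_le_eq)
  moreover have "measure \<mu>c E - e \<le> measure \<mu>c (E \<inter> (T ^^ n) -` F) / measure \<mu>c F"
    using low F(2) by (simp add: le_divide_eq)
  ultimately show ?thesis unfolding e_def[symmetric] by linarith
qed

text \<open>The smoothing scale \<open>\<rho>\<close> may shrink exponentially with \<open>n\<close>, but slower than \<open>\<kappa> ^ n\<close>: with
  \<open>\<rho> = sqrt \<kappa> ^ n\<close> both the boundary term and the correlation term decay exponentially.\<close>

proposition exponentially_mixing:
  assumes \<C>: "\<C> \<subseteq> sets \<mu>c" and C: "0 < C" and \<delta>: "0 < \<delta>"
    and bd: "\<And>E \<rho>. E \<in> \<C> \<Longrightarrow> 0 < \<rho> \<Longrightarrow> measure \<mu> (open_neighbourhood (frontier E) \<rho>) \<le> C * \<rho> powr \<delta>"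
  shows "exponentially_mixing \<mu> T \<C>"
proof -
  define r where "r = sqrt \<kappa>"
  have r: "0 < r" "r < 1" "r * r = \<kappa>" using \<kappa> by (auto simp: r_def)
  define \<gamma> where "\<gamma> = max r (r powr \<delta>)"
  have \<gamma>: "0 < \<gamma>" "\<gamma> < 1" using r \<delta> powr_less_mono2[of \<delta> r 1] by (auto simp: \<gamma>_def)
  have bound: "\<bar>measure \<mu>c (E \<inter> (T ^^ n) -` F) / measure \<mu>c F - measure \<mu>c E\<bar> \<le> (C + D) * \<gamma> ^ n"
    if "E \<in> \<C>" "F \<in> sets \<mu>c" "measure \<mu>c F > 0" for E F n
  proof -
    have rn: "0 < r ^ n" using r by simp
    have "\<bar>measure \<mu>c (E \<inter> (T ^^ n) -` F) / measure \<mu>c F - measure \<mu>c E\<bar> \<le>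
      measure \<mu> (open_neighbourhood (frontier E) (r ^ n)) + D / r ^ n * \<kappa> ^ n"
      using that \<C> rn by (intro mixing_bound) auto
    also have "\<dots> \<le> C * (r ^ n) powr \<delta> + D / r ^ n * \<kappa> ^ n"
      using bd[OF that(1) rn] by simp
    also have "(r ^ n) powr \<delta> = (r powr \<delta>) ^ n"
      using r by (simp add: powr_realpow[symmetric] powr_powr mult.commute)
    also have "D / r ^ n * \<kappa> ^ n = D * r ^ n"
      using r by (simp add: r(3)[symmetric] power_mult_distrib)
    also have "C * (r powr \<delta>) ^ n + D * r ^ n \<le> C * \<gamma> ^ n + D * \<gamma> ^ n"
      using C D_pos r by (intro add_mono mult_left_mono power_mono) (auto simp: \<gamma>_def)
    finally show ?thesis by (simp add: algebra_simps)
  qed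
  have "\<bar>mixing_coeff \<mu> T \<C> n\<bar> \<le> (C + D) * \<gamma> ^ n" for n
  proof -
    define X where "X = insert 0 {\<bar>measure \<mu>c (E \<inter> (T ^^ n) -` F) / measure \<mu>c F - measure \<mu>c E\<bar> | E F.
        E \<in> \<C> \<and> F \<in> sets \<mu>c \<and> measure \<mu>c F > 0}"
    have le: "x \<le> (C + D) * \<gamma> ^ n" if "x \<in> X" for x
      using that bound C D_pos \<gamma> unfolding X_def by auto
    have "0 \<le> Sup X" by (rule cSup_upper[OF _ bdd_aboveI[OF le]]) (simp add: X_def)
    moreover have "Sup X \<le> (C + D) * \<gamma> ^ n" using le by (intro cSup_least) (auto simp: X_def)
    ultimately show ?thesis by (simp add: mixing_coeff_def X_def)
  qed
  then have "mixing_coeff \<mu> T \<C> \<in> O(\<lambda>n. \<gamma> ^ n)"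
    using \<gamma> by (intro bigoI[where c = "C + D"] always_eventually) (simp add: abs_mult)
  then show ?thesis
    unfolding exponentially_mixing_def invariant_measure_def
    using \<C> \<gamma> T_meas T_inv prob_space_axioms by blast
qed

end

section \<open>Gibbs measures of conformal systems\<close>

text \<open>Hoelder functions bounded away from zero have Hoelder logarithms; the multiplicative form is the
  one that passes to products along orbits.\<close>

lemma holder_imp_log_holder:
  fixes u v :: real
  assumes "0 < l" "l \<le> u" "\<bar>v - u\<bar> \<le> C * t" "0 \<le> C * t"
  shows "v \<le> exp (C / l * t) * u"
proof -
  have "C * t / u \<le> C * t / l" using assms by (intro divide_left_mono) auto
  then have "1 + C * t / u \<le> exp (C * t / l)" using exp_ge_add_one_self[of "C * t / l"] by linarith
  then have "(1 + C * t / u) * u \<le> exp (C * t / l) * u" using assms by (intro mult_right_mono) auto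
  then have "u + C * t \<le> exp (C / l * t) * u" using assms by (simp add: distrib_right)
  then show ?thesis using assms by linarith
qed

lemma holder_on_continuous:
  assumes "holder_on \<alpha> S g" "0 < \<alpha>"
  shows "continuous_on S g"
  unfolding continuous_on_iff
proof (intro ballI allI impI)
  fix x and e :: real assume x: "x \<in> S" and e: "0 < e"
  obtain C where C: "\<forall>x\<in>S. \<forall>y\<in>S. \<bar>g x - g y\<bar> \<le> C * dist x y powr \<alpha>"
    using assms unfolding holder_on_def by blast
  define C' where "C' = max C 1"
  define d where "d = (e / C') powr (1 / \<alpha>)"
  have C': "0 < C'" by (simp add: C'_def)
  have "dist (g y) (g x) < e" if y: "y \<in> S" "dist y x < d" for y
  proof -
    have "dist (g y) (g x) \<le> C * dist y x powr \<alpha>" using C x y by (simp add: dist_real_def)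
    also have "\<dots> \<le> C' * dist y x powr \<alpha>" by (intro mult_right_mono) (auto simp: C'_def)
    also have "\<dots> < C' * d powr \<alpha>" using y C' assms by (intro mult_strict_left_mono powr_less_mono2) auto
    also have "\<dots> = e" using assms e C' by (simp add: d_def powr_powr)
    finally show ?thesis .
  qed
  moreover have "0 < d" using e C' by (simp add: d_def)
  ultimately show "\<exists>d>0. \<forall>x'\<in>S. dist x' x < d \<longrightarrow> dist (g x') (g x) < e" by blast
qed

lemma compact_pos_lower_bound:
  fixes f :: "'a::topological_space \<Rightarrow> real"
  assumes "compact S" "continuous_on S f" "\<And>x. x \<in> S \<Longrightarrow> 0 < f x"
  shows "\<exists>l>0. \<forall>x\<in>S. l \<le> f x"
proof (cases "S = {}")
  case False
  then obtain x where "x \<in> S" "\<forall>y\<in>S. f x \<le> f y"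
    using continuous_attains_inf[OF assms(1) _ assms(2)] by blast
  then show ?thesis using assms(3) by blast
qed (auto intro: exI[of _ 1])

lemma finite_uniform:
  fixes P :: "'i \<Rightarrow> real \<Rightarrow> bool"
  assumes "finite J" "\<And>j. j \<in> J \<Longrightarrow> \<exists>x. P j x" "\<And>j x y. j \<in> J \<Longrightarrow> P j x \<Longrightarrow> x \<le> y \<Longrightarrow> P j y"
  shows "\<exists>x. \<forall>j\<in>J. P j x"
proof -
  obtain f where f: "\<And>j. j \<in> J \<Longrightarrow> P j (f j)" using assms(2) by metis
  have "P j (Max (insert 0 (f ` J)))" if "j \<in> J" for j
    using that assms(1) by (intro assms(3)[OF that f[OF that]]) auto
  then show ?thesis by blast
qed

context ifs_attractor
begin

text \<open>Iterating the eigenvalue equation, one compares \<open>h\<close> at two points with \<open>h\<close> at points of vanishing distance,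
  where uniform continuity applies; the weights passed on the way contribute a geometric series.\<close>

lemma eigenfunction_log_holder:
  fixes h :: "'a \<Rightarrow> real" and w :: "nat \<Rightarrow> 'a \<Rightarrow> real"
  assumes h_cont: "continuous_on K h" and h_pos: "\<And>x. x \<in> K \<Longrightarrow> 0 < h x"
    and w_pos: "\<And>j x. j \<in> {1..m} \<Longrightarrow> x \<in> K \<Longrightarrow> 0 < w j x"
    and R: "0 < R" and eigen: "\<And>x. x \<in> K \<Longrightarrow> (\<Sum>j=1..m. w j x * h (\<phi> j x)) = R * h x"
    and G: "0 \<le> G" and b: "0 < b"
    and w_holder: "\<And>j x y. j \<in> {1..m} \<Longrightarrow> x \<in> K \<Longrightarrow> y \<in> K \<Longrightarrow> w j y \<le> exp (G * dist y x powr b) * w j x"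
    and xy: "x \<in> K" "y \<in> K"
  shows "h y \<le> exp (G / (1 - c powr b) * dist y x powr b) * h x"
proof -
  define \<theta> where "\<theta> = c powr b"
  have \<theta>: "0 < \<theta>" "\<theta> < 1" using c_pos c_less b powr_less_mono2[of b c 1] by (auto simp: \<theta>_def)
  obtain l where l: "0 < l" "\<And>x. x \<in> K \<Longrightarrow> l \<le> h x"
    using compact_pos_lower_bound[OF K_compact h_cont h_pos] by blast
  have "h y \<le> exp (G / (1 - \<theta>) * dist y x powr b + \<epsilon>) * h x" if \<epsilon>: "0 < \<epsilon>" for \<epsilon>
  proof -
    have "uniformly_continuous_on K h" by (rule compact_uniformly_continuous[OF h_cont K_compact])
    then obtain \<delta> where \<delta>: "0 < \<delta>" "\<And>x y. x \<in> K \<Longrightarrow> y \<in> K \<Longrightarrow> dist y x < \<delta> \<Longrightarrow> dist (h y) (h x) < \<epsilon> * l"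
      unfolding uniformly_continuous_on_def using \<epsilon> l by (metis mult_pos_pos)
    have step: "h y \<le> exp (G * (\<Sum>k<n. \<theta> ^ k) * dist y x powr b + \<epsilon>) * h x"
      if "x \<in> K" "y \<in> K" "c ^ n * dist y x < \<delta>" for n x y
      using that
    proof (induction n arbitrary: x y)
      case 0
      have "\<bar>h y - h x\<bar> \<le> (\<epsilon> * l) * 1" using \<delta>(2)[of x y] 0 by (simp add: dist_real_def)
      then have "h y \<le> exp ((\<epsilon> * l) / l * 1) * h x"
        using l \<epsilon> 0 by (intro holder_imp_log_holder) auto
      then show ?case using l by simp
    next
      case (Suc n)
      define t where "t = dist y x powr b"
      define E where "E = G * (\<Sum>k<n. \<theta> ^ k) * (\<theta> * t) + \<epsilon>"
      have summand: "w j y * h (\<phi> j y) \<le> exp (G * t + E) * (w j x * h (\<phi> j x))" if j: "j \<in> {1..m}" for j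
      proof -
        have d: "dist (\<phi> j y) (\<phi> j x) \<le> c * dist y x"
          using contr[OF j] Suc.prems K_sub by blast
        then have "c ^ n * dist (\<phi> j y) (\<phi> j x) \<le> c ^ n * (c * dist y x)"
          using c_pos by (intro mult_left_mono) auto
        then have "h (\<phi> j y) \<le> exp (G * (\<Sum>k<n. \<theta> ^ k) * dist (\<phi> j y) (\<phi> j x) powr b + \<epsilon>) * h (\<phi> j x)"
          using Suc.prems maps_K[OF j] by (intro Suc.IH) (auto simp: mult_ac)
        also have "\<dots> \<le> exp E * h (\<phi> j x)"
        proof -
          have "dist (\<phi> j y) (\<phi> j x) powr b \<le> (c * dist y x) powr b" using d b by (intro powr_mono2) auto
          also have "\<dots> = \<theta> * t" using c_pos by (simp add: powr_mult \<theta>_def t_def)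
          finally have "G * (\<Sum>k<n. \<theta> ^ k) * dist (\<phi> j y) (\<phi> j x) powr b \<le> G * (\<Sum>k<n. \<theta> ^ k) * (\<theta> * t)"
            using G \<theta> by (intro mult_left_mono mult_nonneg_nonneg sum_nonneg) auto
          then show ?thesis
            using h_pos[OF maps_K[OF j Suc.prems(1)]] by (intro mult_right_mono) (auto simp: E_def)
        qed
        finally have "w j y * h (\<phi> j y) \<le> (exp (G * t) * w j x) * (exp E * h (\<phi> j x))"
          using w_holder[OF j Suc.prems(1,2)] w_pos[OF j] h_pos[OF maps_K[OF j]] Suc.prems
          by (intro mult_mono) (auto simp: t_def less_imp_le)
        then show ?thesis by (simp add: exp_add mult_ac)
      qed
      have "R * h y = (\<Sum>j=1..m. w j y * h (\<phi> j y))" using eigen Suc.prems by simp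
      also have "\<dots> \<le> (\<Sum>j=1..m. exp (G * t + E) * (w j x * h (\<phi> j x)))" by (intro sum_mono summand)
      also have "\<dots> = R * (exp (G * t + E) * h x)"
        using eigen Suc.prems by (simp add: sum_distrib_left[symmetric])
      finally have "h y \<le> exp (G * t + E) * h x" using R by simp
      moreover have "G * t + E = G * (\<Sum>k<Suc n. \<theta> ^ k) * t + \<epsilon>"
        unfolding E_def sum.lessThan_Suc_shift by (simp add: algebra_simps sum_distrib_left)
      ultimately show ?case by (simp only: t_def)
    qed
    have "(\<lambda>n. c ^ n * dist y x) \<longlonglongrightarrow> 0"
      using c_pos c_less by (auto intro!: tendsto_mult_left_zero LIMSEQ_power_zero)
    then have "eventually (\<lambda>n. c ^ n * dist y x < \<delta>) sequentially" using \<delta>(1) order_tendstoD(2) by blast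
    then obtain n where "c ^ n * dist y x < \<delta>" by (auto simp: eventually_sequentially)
    then have "h y \<le> exp (G * (\<Sum>k<n. \<theta> ^ k) * dist y x powr b + \<epsilon>) * h x" using step xy by blast
    also have "\<dots> \<le> exp (G / (1 - \<theta>) * dist y x powr b + \<epsilon>) * h x"
    proof -
      have "(\<Sum>k<n. \<theta> ^ k) \<le> 1 / (1 - \<theta>)"
        using sum_le_suminf[OF summable_geometric[of \<theta>], of "{..<n}"] suminf_geometric[of \<theta>] \<theta> by auto
      then have "G * (\<Sum>k<n. \<theta> ^ k) * dist y x powr b \<le> G * (1 / (1 - \<theta>)) * dist y x powr b"
        using G by (intro mult_right_mono mult_left_mono) auto
      then show ?thesis using h_pos[OF xy(1)] by (intro mult_right_mono) auto
    qed
    finally show ?thesis .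
  qed
  moreover have hx: "0 < h x" "0 < h y" using h_pos xy by auto
  ultimately have "h y / h x \<le> exp (G / (1 - \<theta>) * dist y x powr b + \<epsilon>)" if "0 < \<epsilon>" for \<epsilon>
    using that by (simp add: pos_divide_le_eq)
  then have "ln (h y / h x) \<le> ln (exp (G / (1 - \<theta>) * dist y x powr b + \<epsilon>))" if "0 < \<epsilon>" for \<epsilon>
    using that hx by (subst ln_le_cancel_iff) auto
  then have "ln (h y / h x) \<le> G / (1 - \<theta>) * dist y x powr b"
    by (subst (asm) ln_exp) (rule field_le_epsilon)
  then have "exp (ln (h y / h x)) \<le> exp (G / (1 - \<theta>) * dist y x powr b)" by simp
  then show ?thesis using hx by (simp add: pos_divide_le_eq \<theta>_def)
qed

end

text \<open>Transport from the space \<open>K\<close> to the whole space, in which the complement of \<open>K\<close> is null.\<close>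

lemma gibbs_ifs_lipschitz_decay:
  fixes \<phi> :: "nat \<Rightarrow> 'a::euclidean_space \<Rightarrow> 'a"
  assumes "gibbs_ifs m \<phi> \<Omega> K c M p A b"
  shows "\<exists>D \<kappa>. lipschitz_decay (distr M borel (\<lambda>x. x)) (induced_map m \<phi> K) D \<kappa>"
proof -
  interpret gibbs_ifs m \<phi> \<Omega> K c M p A b by fact
  define \<mu> where "\<mu> = distr M borel (\<lambda>x. x)"
  have idM: "(\<lambda>x. x) \<in> borel_measurable M" by (rule borel_measurable_M) simp
  have Tb: "T \<in> borel_measurable borel" by (rule induced_map_measurable)
  have TK: "T x \<in> K" if "x \<in> K" for x using measurable_space[OF T_measurable] that by (simp add: space_M)
  have Tm: "T \<in> measurable \<mu> \<mu>" using Tb unfolding \<mu>_def by (subst measurable_cong_sets[of _ borel _ borel]) simp_all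
  show ?thesis
  proof (rule transfer_decay)
    fix \<kappa> D :: real
    assume \<kappa>: "0 < \<kappa>" "\<kappa> < 1" "0 < D"
      and dec: "\<And>f L F n. (\<And>x. 0 \<le> f x) \<Longrightarrow> 0 \<le> L \<Longrightarrow>
      L-lipschitz_on UNIV f \<Longrightarrow> F \<in> borel_measurable M \<Longrightarrow>
      (\<integral>\<^sup>+x. ennreal (f x) * F ((T ^^ n) x) \<partial>M) \<le>
      ((\<integral>\<^sup>+x. ennreal (f x) \<partial>M) + ennreal (D * L * \<kappa> ^ n)) * (\<integral>\<^sup>+x. F x \<partial>M)"
    have "lipschitz_decay \<mu> T D \<kappa>"
    proof (intro lipschitz_decay.intro lipschitz_decay_axioms.intro)
      show "prob_space \<mu>" unfolding \<mu>_def by (rule prob_space_distr[OF idM])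
      show "sets \<mu> = sets borel" by (simp add: \<mu>_def)
      show "T \<in> measurable \<mu> \<mu>" by (rule Tm)
      show "distr \<mu> \<mu> T = \<mu>"
      proof (rule measure_eqI)
        fix B assume "B \<in> sets (distr \<mu> \<mu> T)"
        then have B: "B \<in> sets borel" by (simp add: \<mu>_def)
        have TB: "T -` B \<in> sets borel" using measurable_sets[OF Tb B] by simp
        have BK: "B \<inter> K \<in> sets M" using B by (auto simp: sets_M sets_restrict_space)
        have "emeasure (distr \<mu> \<mu> T) B = emeasure \<mu> (T -` B)"
          using B Tm by (subst emeasure_distr) (auto simp: \<mu>_def)
        also have "\<dots> = emeasure M (T -` B \<inter> K)"
          using TB idM by (simp add: \<mu>_def emeasure_distr space_M)
        also have "T -` B \<inter> K = (T ^^ Suc 0) -` (B \<inter> K) \<inter> K" using TK by auto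
        also have "emeasure M \<dots> = emeasure M (B \<inter> K)" by (rule funpow_T_emeasure[OF BK])
        also have "\<dots> = emeasure \<mu> B" using B idM by (simp add: \<mu>_def emeasure_distr space_M)
        finally show "emeasure (distr \<mu> \<mu> T) B = emeasure \<mu> B" .
      qed simp
      show "0 < \<kappa>" "\<kappa> < 1" "0 < D" by (rule \<kappa>)+
      fix f :: "'a \<Rightarrow> real" and L :: real and F :: "'a \<Rightarrow> ennreal" and n
      assume f: "\<And>x. 0 \<le> f x" and L: "0 \<le> L" "L-lipschitz_on UNIV f" and F: "F \<in> borel_measurable \<mu>"
      have Fb: "F \<in> borel_measurable borel" using F by (simp add: \<mu>_def)
      have fb: "f \<in> borel_measurable borel"
        using lipschitz_on_continuous_on[OF L(2)] by (rule borel_measurable_continuous_onI)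
      have Tn: "T ^^ k \<in> borel_measurable borel" for k
      proof (induction k)
        case (Suc k)
        then show ?case using measurable_comp[OF Suc Tb] by (simp add: o_def)
      qed (simp add: id_def)
      have "(\<lambda>x. ennreal (f x) * F ((T ^^ n) x)) \<in> borel_measurable borel"
        using measurable_compose[OF Tn Fb] fb by measurable
      then show "(\<integral>\<^sup>+x. ennreal (f x) * F ((T ^^ n) x) \<partial>\<mu>) \<le>
        ((\<integral>\<^sup>+x. ennreal (f x) \<partial>\<mu>) + ennreal (D * L * \<kappa> ^ n)) * (\<integral>\<^sup>+x. F x \<partial>\<mu>)"
        using dec[of f L F n] f L borel_measurable_M[OF Fb] Fb fb idM unfolding \<mu>_def
        by (simp add: nn_integral_distr)
    qed
    then show ?thesis unfolding \<mu>_def by blast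
  qed
qed

text \<open>Finitely many maps admit common constants.\<close>

lemma conformal_IFS_attractor:
  fixes \<phi> :: "nat \<Rightarrow> real ^ 'n \<Rightarrow> real ^ 'n"
  assumes ifs: "conformal_IFS \<alpha> \<Omega> m \<phi>" and K: "self_conformal_set \<Omega> m \<phi> K"
  shows "\<exists>c \<kappa> s G. conformal_attractor m \<phi> \<Omega> K c (\<lambda>j. jnorm (\<phi> j)) \<kappa> s G \<alpha>"
proof -
  let ?J = "{1..m}"
  have \<alpha>: "0 < \<alpha>" and J: "finite ?J" "?J \<noteq> {}" and \<Omega>: "bounded \<Omega>" "open \<Omega>"
    and maps: "\<And>j. j \<in> ?J \<Longrightarrow> \<phi> j \<in> \<Omega> \<rightarrow> \<Omega>"
    and conf: "\<And>j. j \<in> ?J \<Longrightarrow> conformal_on \<Omega> (\<phi> j)"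
    and lip: "\<And>j. j \<in> ?J \<Longrightarrow> \<exists>c<1. c-lipschitz_on \<Omega> (\<phi> j)"
    and INF: "\<And>j. j \<in> ?J \<Longrightarrow> 0 < (INF x\<in>\<Omega>. jnorm (\<phi> j) x)"
    and bdd: "\<And>j. j \<in> ?J \<Longrightarrow> bdd_above (jnorm (\<phi> j) ` \<Omega>)"
    and SUP: "\<And>j. j \<in> ?J \<Longrightarrow> (SUP x\<in>\<Omega>. jnorm (\<phi> j) x) < 1"
    and holder: "\<And>j. j \<in> ?J \<Longrightarrow> holder_on \<alpha> \<Omega> (jnorm (\<phi> j))"
    using ifs unfolding conformal_IFS_def by auto
  obtain f where f: "\<And>j. j \<in> ?J \<Longrightarrow> f j < 1 \<and> (f j)-lipschitz_on \<Omega> (\<phi> j)" using lip by metis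
  define c where "c = Max (insert (1/2) (f ` ?J))"
  have c: "0 < c" "c < 1"
    using f J by (auto simp: c_def less_max_iff_disj Max_gr_iff)
  have f_le: "f j \<le> c" if "j \<in> ?J" for j
    unfolding c_def using that by (intro Max_ge) auto
  define \<kappa> where "\<kappa> = Min ((\<lambda>j. INF x\<in>\<Omega>. jnorm (\<phi> j) x) ` ?J)"
  define s where "s = Max ((\<lambda>j. SUP x\<in>\<Omega>. jnorm (\<phi> j) x) ` ?J)"
  have nonneg: "0 \<le> jnorm (\<phi> j) x" for j x
    unfolding jnorm_def by (intro onorm_pos_le) simp
  have \<kappa>: "0 < \<kappa>" using INF J by (simp add: \<kappa>_def)
  have s: "s < 1" using SUP J by (simp add: s_def)
  have \<kappa>_le: "\<kappa> \<le> jnorm (\<phi> j) x" if "j \<in> ?J" "x \<in> \<Omega>" for j x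
  proof -
    have "\<kappa> \<le> (INF x\<in>\<Omega>. jnorm (\<phi> j) x)" using that J by (simp add: \<kappa>_def)
    also have "\<dots> \<le> jnorm (\<phi> j) x"
      using that(2) nonneg by (intro cINF_lower bdd_belowI2[of _ 0]) auto
    finally show ?thesis .
  qed
  have s_ge: "jnorm (\<phi> j) x \<le> s" if "j \<in> ?J" "x \<in> \<Omega>" for j x
  proof -
    have "jnorm (\<phi> j) x \<le> (SUP x\<in>\<Omega>. jnorm (\<phi> j) x)"
      using that bdd by (intro cSUP_upper) auto
    also have "\<dots> \<le> s" using that J by (simp add: s_def)
    finally show ?thesis .
  qed
  have "\<exists>C. \<forall>j\<in>?J. 0 \<le> C \<and> (\<forall>x\<in>\<Omega>. \<forall>y\<in>\<Omega>. \<bar>jnorm (\<phi> j) x - jnorm (\<phi> j) y\<bar> \<le> C * dist x y powr \<alpha>)"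
  proof (rule finite_uniform[OF J(1)])
    fix j assume "j \<in> ?J"
    then obtain C where C: "\<forall>x\<in>\<Omega>. \<forall>y\<in>\<Omega>. \<bar>jnorm (\<phi> j) x - jnorm (\<phi> j) y\<bar> \<le> C * dist x y powr \<alpha>"
      using holder unfolding holder_on_def by blast
    have le: "C * dist x y powr \<alpha> \<le> max C 0 * dist x y powr \<alpha>" for x y
      by (intro mult_right_mono) auto
    then show "\<exists>C. 0 \<le> C \<and> (\<forall>x\<in>\<Omega>. \<forall>y\<in>\<Omega>. \<bar>jnorm (\<phi> j) x - jnorm (\<phi> j) y\<bar> \<le> C * dist x y powr \<alpha>)"
    proof (intro exI conjI ballI)
      show "\<bar>jnorm (\<phi> j) x - jnorm (\<phi> j) y\<bar> \<le> max C 0 * dist x y powr \<alpha>"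
        if "x \<in> \<Omega>" "y \<in> \<Omega>" for x y
        using C that le[of x y] by (meson order_trans)
    qed simp
  next
    fix j x y
    assume "0 \<le> x \<and> (\<forall>u\<in>\<Omega>. \<forall>v\<in>\<Omega>. \<bar>jnorm (\<phi> j) u - jnorm (\<phi> j) v\<bar> \<le> x * dist u v powr \<alpha>)" "x \<le> y"
    then show "0 \<le> y \<and> (\<forall>u\<in>\<Omega>. \<forall>v\<in>\<Omega>. \<bar>jnorm (\<phi> j) u - jnorm (\<phi> j) v\<bar> \<le> y * dist u v powr \<alpha>)"
      by (meson mult_right_mono order_trans powr_ge_zero)
  qed
  then obtain C where
    CC: "\<forall>j\<in>?J. 0 \<le> C \<and> (\<forall>x\<in>\<Omega>. \<forall>y\<in>\<Omega>. \<bar>jnorm (\<phi> j) x - jnorm (\<phi> j) y\<bar> \<le> C * dist x y powr \<alpha>)" ..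
  have C: "\<bar>jnorm (\<phi> j) x - jnorm (\<phi> j) y\<bar> \<le> C * dist x y powr \<alpha>"
    if "j \<in> ?J" "x \<in> \<Omega>" "y \<in> \<Omega>" for j x y
    using CC that by blast
  have C0: "0 \<le> C" using CC J(2) by blast
  have "conformal_attractor m \<phi> \<Omega> K c (\<lambda>j. jnorm (\<phi> j)) \<kappa> s (C / \<kappa>) \<alpha>"
  proof
    fix j x assume j: "j \<in> ?J" and x: "x \<in> \<Omega>"
    show "\<phi> j x \<in> \<Omega>" using maps[OF j] x by auto
    show "\<exists>D. (\<phi> j has_derivative D) (at x) \<and> (\<forall>v. norm (D v) = jnorm (\<phi> j) x * norm v)"
    proof (intro exI conjI allI)
      show "(\<phi> j has_derivative (\<lambda>v. jacobian (\<phi> j) (at x) *v v)) (at x)"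
        using conf[OF j] x by (subst jacobian_works[symmetric]) (auto simp: conformal_on_def)
      show "norm (jacobian (\<phi> j) (at x) *v v) = jnorm (\<phi> j) x * norm v" for v
        using conf[OF j] x by (auto simp: conformal_on_def)
    qed
    fix y assume y: "y \<in> \<Omega>"
    have "dist (\<phi> j x) (\<phi> j y) \<le> f j * dist x y" using f[OF j] x y by (auto dest: lipschitz_onD)
    also have "\<dots> \<le> c * dist x y" using f_le[OF j] by (intro mult_right_mono) auto
    finally show "dist (\<phi> j x) (\<phi> j y) \<le> c * dist x y" .
    show "jnorm (\<phi> j) y \<le> exp (C / \<kappa> * dist y x powr \<alpha>) * jnorm (\<phi> j) x"
      using C[OF j y x] C0 \<kappa> \<kappa>_le[OF j x] by (intro holder_imp_log_holder) auto
  next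
    show "inj_on (\<phi> j) \<Omega>" if "j \<in> ?J" for j using conf[OF that] by (simp add: conformal_on_def)
    show "K \<noteq> {}" "compact K" "K \<subseteq> \<Omega>" "K = (\<Union>j\<in>{1..m}. \<phi> j ` K)"
      using K unfolding self_conformal_set_def by blast+
    show "0 \<le> C / \<kappa>" using C0 \<kappa> by simp
  qed (use c \<Omega> \<kappa> s \<alpha> \<kappa>_le s_ge in auto)
  then show ?thesis by blast
qed

text \<open>Normalizing the weights \<open>g\<close> by the eigenfunction \<open>h\<close> turns \<open>R\<close> into \<open>1\<close>, hence the Gibbs measure
  into a stationary measure.\<close>

lemma gibbs_measure_stationary:
  fixes \<phi> :: "nat \<Rightarrow> real ^ 'n \<Rightarrow> real ^ 'n"
  assumes ifs: "ifs_attractor m \<phi> \<Omega> K c" and gibbs: "gibbs_measure \<Omega> m \<phi> K \<mu>"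
  shows "\<exists>M p A b. stationary_ifs m \<phi> \<Omega> K c M p \<and> \<mu> = distr M borel (\<lambda>x. x) \<and>
    0 < A \<and> 0 < b \<and> b \<le> 1 \<and>
    (\<forall>j\<in>{1..m}. \<forall>x\<in>K. \<forall>y\<in>K. p j x \<le> exp (A * dist x y powr b) * p j y)"
proof -
  interpret ifs_attractor m \<phi> \<Omega> K c by fact
  obtain \<alpha>' g R h \<nu> where \<alpha>': "0 < \<alpha>'"
    and g: "\<And>j x. j \<in> {1..m} \<Longrightarrow> x \<in> \<phi> j ` \<Omega> \<Longrightarrow> 0 < g j x" "\<And>j. j \<in> {1..m} \<Longrightarrow> holder_on \<alpha>' (\<phi> j ` \<Omega>) (g j)"
    and h: "continuous_on K h" "\<And>x. x \<in> K \<Longrightarrow> 0 < h x"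
    and eigen: "\<And>x. x \<in> K \<Longrightarrow> transfer_op m \<phi> g h x = R * h x"
    and \<nu>: "prob_space \<nu>" "sets \<nu> = sets (restrict_space borel K)"
    and dual: "\<And>f::_ \<Rightarrow> real. continuous_on K f \<Longrightarrow> (\<integral>x. transfer_op m \<phi> g f x \<partial>\<nu>) = R * (\<integral>x. f x \<partial>\<nu>)"
    and int_h: "(\<integral>x. h x \<partial>\<nu>) = 1"
    and \<mu>: "\<mu> = distr (density \<nu> (\<lambda>x. ennreal (h x))) borel (\<lambda>x. x)"
    using gibbs unfolding gibbs_measure_def by blast
  interpret \<nu>: prob_space \<nu> by (rule \<nu>)
  define w where "w j x = g j (\<phi> j x)" for j x
  have w_pos: "0 < w j x" if "j \<in> {1..m}" "x \<in> K" for j x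
    using g(1)[OF that(1)] that K_sub by (auto simp: w_def)
  have \<phi>c: "continuous_on K (\<phi> j)" if "j \<in> {1..m}" for j
    using cont[OF that] K_sub continuous_on_subset by blast
  have w_cont: "continuous_on K (w j)" if j: "j \<in> {1..m}" for j
    unfolding w_def
    by (rule continuous_on_compose2[OF holder_on_continuous[OF g(2)[OF j] \<alpha>'] \<phi>c[OF j]]) (use K_sub in auto)
  have eigen': "(\<Sum>j=1..m. w j x * h (\<phi> j x)) = R * h x" if "x \<in> K" for x
    using eigen[OF that] by (simp add: transfer_op_def w_def)
  have R: "0 < R"
  proof -
    obtain x where x: "x \<in> K" using K_ne by blast
    obtain j y where j: "j \<in> {1..m}" using K_cases[OF x] by metis
    have "0 < (\<Sum>j=1..m. w j x * h (\<phi> j x))"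
      using j[unfolded atLeastAtMost_iff] w_pos[OF _ x] h(2)[OF maps_K[OF _ x]] by (intro sum_pos) auto
    then show ?thesis using eigen'[OF x] h(2)[OF x] by (simp add: zero_less_mult_iff)
  qed
  (* Exponents above 1 are lowered to 1 so that Lipschitz functions are Hoelder with exponent b. *)
  define b where "b = min \<alpha>' 1"
  have b: "0 < b" "b \<le> 1" "b \<le> \<alpha>'" using \<alpha>' by (auto simp: b_def)
  obtain B' where B': "\<And>x y. x \<in> \<Omega> \<Longrightarrow> y \<in> \<Omega> \<Longrightarrow> dist x y \<le> B'"
    using bdd unfolding bounded_two_points by blast
  define B where "B = max B' 1"
  have "\<exists>G. \<forall>j\<in>{1..m}. 0 \<le> G \<and> (\<forall>x\<in>K. \<forall>y\<in>K. w j y \<le> exp (G * dist y x powr b) * w j x)"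
  proof (rule finite_uniform)
    fix j assume j: "j \<in> {1..m}"
    obtain l where l: "0 < l" "\<And>x. x \<in> K \<Longrightarrow> l \<le> w j x"
      using compact_pos_lower_bound[OF K_compact w_cont[OF j]] w_pos[OF j] by blast
    obtain C where C: "\<And>x y. x \<in> \<phi> j ` \<Omega> \<Longrightarrow> y \<in> \<phi> j ` \<Omega> \<Longrightarrow> \<bar>g j x - g j y\<bar> \<le> C * dist x y powr \<alpha>'"
      using g(2)[OF j] unfolding holder_on_def by blast
    define C' where "C' = max C 0 * B powr (\<alpha>' - b)"
    have "w j y \<le> exp (C' / l * dist y x powr b) * w j x" if xy: "x \<in> K" "y \<in> K" for x y
    proof (rule holder_imp_log_holder[OF l(1) l(2)[OF xy(1)]])
      have xy': "x \<in> \<Omega>" "y \<in> \<Omega>" using xy K_sub by auto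
      have d: "dist (\<phi> j y) (\<phi> j x) \<le> dist y x"
        using contr[OF j xy'(2,1)] mult_left_le_one_le[of "dist y x" c] c_pos c_less by auto
      have dB: "dist y x \<le> B" using B'[OF xy'(2,1)] by (simp add: B_def)
      have "\<bar>w j y - w j x\<bar> \<le> C * dist (\<phi> j y) (\<phi> j x) powr \<alpha>'"
        unfolding w_def using xy' by (intro C) auto
      also have "\<dots> \<le> max C 0 * dist (\<phi> j y) (\<phi> j x) powr \<alpha>'" by (intro mult_right_mono) auto
      also have "\<dots> \<le> max C 0 * dist y x powr \<alpha>'"
        using d \<alpha>' by (intro mult_left_mono powr_mono2) auto
      also have "dist y x powr \<alpha>' = dist y x powr (\<alpha>' - b) * dist y x powr b"
        by (simp add: powr_add[symmetric])
      also have "max C 0 * \<dots> \<le> max C 0 * (B powr (\<alpha>' - b) * dist y x powr b)"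
        using dB b by (intro mult_left_mono mult_right_mono powr_mono2) auto
      finally show "\<bar>w j y - w j x\<bar> \<le> C' * dist y x powr b" by (simp add: C'_def mult.assoc)
      show "0 \<le> C' * dist y x powr b" by (simp add: C'_def)
    qed
    then show "\<exists>G. 0 \<le> G \<and> (\<forall>x\<in>K. \<forall>y\<in>K. w j y \<le> exp (G * dist y x powr b) * w j x)"
      using l by (intro exI[of _ "C' / l"]) (auto simp: C'_def)
  next
    fix j and G G' :: real
    assume j: "j \<in> {1..m}" and G: "0 \<le> G \<and> (\<forall>x\<in>K. \<forall>y\<in>K. w j y \<le> exp (G * dist y x powr b) * w j x)" "G \<le> G'"
    show "0 \<le> G' \<and> (\<forall>x\<in>K. \<forall>y\<in>K. w j y \<le> exp (G' * dist y x powr b) * w j x)"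
    proof (intro conjI ballI)
      show "0 \<le> G'" using G by linarith
      fix x y assume xy: "x \<in> K" "y \<in> K"
      have "w j y \<le> exp (G * dist y x powr b) * w j x" using G(1) xy by blast
      also have "\<dots> \<le> exp (G' * dist y x powr b) * w j x"
        using w_pos[OF j xy(1)] G(2) by (intro mult_right_mono) (auto intro: mult_right_mono)
      finally show "w j y \<le> exp (G' * dist y x powr b) * w j x" .
    qed
  qed simp
  then obtain G where G0: "0 \<le> G" and w_holder: "\<And>j x y. j \<in> {1..m} \<Longrightarrow> x \<in> K \<Longrightarrow> y \<in> K \<Longrightarrow>
      w j y \<le> exp (G * dist y x powr b) * w j x"
    using K_cases K_ne by (metis ex_in_conv)
  define H where "H = G / (1 - c powr b)"
  have "c powr b < 1" using c_pos c_less b powr_less_mono2[of b c 1] by auto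
  then have H: "0 \<le> H" using G0 by (simp add: H_def)
  have h_holder: "h y \<le> exp (H * dist y x powr b) * h x" if "x \<in> K" "y \<in> K" for x y
    unfolding H_def by (rule eigenfunction_log_holder[OF h w_pos R eigen' G0 b(1) w_holder that])
  define p where "p j x = w j x * h (\<phi> j x) / (R * h x)" for j x
  define A where "A = G + 2 * H + 1"
  have p_holder: "p j x \<le> exp (A * dist x y powr b) * p j y" if j: "j \<in> {1..m}" and xy: "x \<in> K" "y \<in> K" for j x y
  proof -
    define t where "t = dist x y powr b"
    have jx: "\<phi> j x \<in> K" "\<phi> j y \<in> K" using maps_K j xy by auto
    have hx: "0 < h x" "0 < h y" "0 < h (\<phi> j x)" "0 < h (\<phi> j y)" using h xy jx by auto
    have "dist (\<phi> j x) (\<phi> j y) \<le> dist x y"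
      using contr[OF j, of x y] xy K_sub mult_left_le_one_le[of "dist x y" c] c_pos c_less by force
    then have "dist (\<phi> j x) (\<phi> j y) powr b \<le> t" using b unfolding t_def by (intro powr_mono2) auto
    then have "H * dist (\<phi> j x) (\<phi> j y) powr b \<le> H * t" using H by (rule mult_left_mono)
    then have "exp (H * dist (\<phi> j x) (\<phi> j y) powr b) * h (\<phi> j y) \<le> exp (H * t) * h (\<phi> j y)"
      using hx by (intro mult_right_mono) auto
    then have 1: "h (\<phi> j x) \<le> exp (H * t) * h (\<phi> j y)" using h_holder[OF jx(2,1)] by linarith
    have 2: "w j x \<le> exp (G * t) * w j y" using w_holder[OF j xy(2,1)] by (simp add: t_def)
    have "h y \<le> exp (H * t) * h x" using h_holder[OF xy] by (simp add: t_def dist_commute)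
    then have 3: "1 / h x \<le> exp (H * t) / h y" using hx by (simp add: field_simps)
    have "p j x = (w j x * h (\<phi> j x)) * (1 / h x) / R" by (simp add: p_def)
    also have "\<dots> \<le> ((exp (G * t) * w j y) * (exp (H * t) * h (\<phi> j y))) * (exp (H * t) / h y) / R"
      using 1 2 3 hx w_pos[OF j xy(1)] w_pos[OF j xy(2)] R
      by (intro divide_right_mono mult_mono mult_nonneg_nonneg) (auto intro: less_imp_le)
    also have "\<dots> = (exp (G * t) * exp (H * t) * exp (H * t)) * p j y"
      by (simp add: p_def mult_ac)
    also have "exp (G * t) * exp (H * t) * exp (H * t) = exp (G * t + H * t + H * t)"
      by (simp only: exp_add)
    also have "exp (G * t + H * t + H * t) * p j y \<le> exp (A * t) * p j y"
    proof -
      have "G * t + H * t + H * t \<le> A * t" by (simp add: A_def t_def algebra_simps)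
      then show ?thesis
        using hx w_pos[OF j xy(2)] R by (intro mult_right_mono) (auto simp: p_def intro!: less_imp_le)
    qed
    finally show ?thesis by (simp add: t_def)
  qed
  define M where "M = density \<nu> (\<lambda>x. ennreal (h x))"
  have sp: "space \<nu> = K" using sets_eq_imp_space_eq[OF \<nu>(2)] by (simp add: space_restrict_space)
  have meas: "f \<in> borel_measurable \<nu>" if "continuous_on K f" for f :: "real ^ 'n \<Rightarrow> real"
    unfolding measurable_cong_sets[OF \<nu>(2) refl] by (rule borel_measurable_continuous_on_restrict[OF that])
  have hm: "h \<in> borel_measurable \<nu>" using meas h by blast
  have h_AE: "AE x in \<nu>. 0 \<le> h x" using h(2) by (intro AE_I2) (simp add: sp less_imp_le)
  have intM: "(\<integral>x. f x \<partial>M) = (\<integral>x. h x * f x \<partial>\<nu>)" if "continuous_on K f" for f :: "real ^ 'n \<Rightarrow> real"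
    unfolding M_def using meas[OF that] hm h_AE by (subst integral_density) auto
  have p_cont: "continuous_on K (p j)" if j: "j \<in> {1..m}" for j
    unfolding p_def
    using R h(2) w_cont[OF j] h(1) continuous_on_compose2[OF h(1) \<phi>c[OF j]] maps_K[OF j]
    by (intro continuous_on_divide continuous_on_mult) (auto simp: less_imp_neq[symmetric])
  have "stationary_ifs m \<phi> \<Omega> K c M p"
  proof (intro stationary_ifs.intro stationary_ifs_axioms.intro ifs)
    show "prob_space M"
    proof
      have "integrable \<nu> h"
        using int_h not_integrable_integral_eq by fastforce
      then have "(\<integral>\<^sup>+x. ennreal (h x) \<partial>\<nu>) = 1"
        using int_h h_AE by (subst nn_integral_eq_integral) auto
      then show "emeasure M (space M) = 1"
        unfolding M_def using hm by (simp add: emeasure_density cong: nn_integral_cong)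
    qed
    show "sets M = sets (restrict_space borel K)" by (simp add: M_def \<nu>)
    show "0 < p j x" if "j \<in> {1..m}" "x \<in> K" for j x
      using that w_pos h(2) maps_K R by (simp add: p_def)
    show "(\<Sum>j=1..m. p j x) = 1" if "x \<in> K" for x
      using eigen'[OF that] h(2)[OF that] R by (simp add: p_def sum_divide_distrib[symmetric])
    show "continuous_on K (p j)" if "j \<in> {1..m}" for j by (rule p_cont[OF that])
    fix f :: "real ^ 'n \<Rightarrow> real" assume f: "continuous_on K f"
    have hf: "continuous_on K (\<lambda>x. h x * f x)" using h(1) f by (intro continuous_on_mult)
    have "continuous_on K (\<lambda>x. \<Sum>j=1..m. p j x * f (\<phi> j x))"
      using p_cont continuous_on_compose2[OF f \<phi>c] maps_K
      by (intro continuous_on_sum continuous_on_mult) auto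
    then have "(\<integral>x. (\<Sum>j=1..m. p j x * f (\<phi> j x)) \<partial>M) = (\<integral>x. h x * (\<Sum>j=1..m. p j x * f (\<phi> j x)) \<partial>\<nu>)"
      by (rule intM)
    also have "\<dots> = (\<integral>x. (1 / R) * transfer_op m \<phi> g (\<lambda>x. h x * f x) x \<partial>\<nu>)"
    proof (rule Bochner_Integration.integral_cong[OF refl])
      fix x assume "x \<in> space \<nu>"
      then have "h x \<noteq> 0" using h(2)[of x] by (simp add: sp)
      then show "h x * (\<Sum>j=1..m. p j x * f (\<phi> j x)) = (1 / R) * transfer_op m \<phi> g (\<lambda>x. h x * f x) x"
        unfolding transfer_op_def sum_distrib_left by (intro sum.cong) (auto simp: p_def w_def)
    qed
    also have "\<dots> = (1 / R) * (R * (\<integral>x. h x * f x \<partial>\<nu>))" using dual[OF hf] by simp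
    also have "\<dots> = (\<integral>x. f x \<partial>M)" using intM[OF f] R by simp
    finally show "(\<integral>x. f x \<partial>M) = (\<integral>x. (\<Sum>j=1..m. p j x * f (\<phi> j x)) \<partial>M)" ..
  qed
  moreover have "\<mu> = distr M borel (\<lambda>x. x)" using \<mu> by (simp add: M_def)
  moreover have "0 < A" using G0 H by (simp add: A_def)
  ultimately show ?thesis using p_holder b by blast
qed

section \<open>Exponential mixing\<close>

theorem theorem1p1:
  fixes m :: nat
    and \<phi> :: "nat \<Rightarrow> real ^ 'n \<Rightarrow> real ^ 'n"
    and K :: "(real ^ 'n) set"
    and \<mu> :: "(real ^ 'n) measure"
    and T :: "real ^ 'n \<Rightarrow> real ^ 'n"
    and \<C> :: "(real ^ 'n) set set"
    and C \<delta> :: real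
  assumes "self_conformal_system m \<phi> K \<mu> T"
    and "\<C> \<subseteq> sets (completion \<mu>)"
    and "C > 0" and "\<delta> > 0"
    and "\<And>E \<rho>. E \<in> \<C> \<Longrightarrow> \<rho> > 0 \<Longrightarrow>
           measure \<mu> (open_neighbourhood (frontier E) \<rho>) \<le> C * \<rho> powr \<delta>"
  shows "exponentially_mixing \<mu> T \<C>"
proof -
  obtain \<Omega> \<alpha> where ifs: "conformal_IFS \<alpha> \<Omega> m \<phi>" and osc: "open_set_condition \<Omega> m \<phi>"
    and K: "self_conformal_set \<Omega> m \<phi> K" and gibbs: "gibbs_measure \<Omega> m \<phi> K \<mu>"
    and T: "T = induced_map m \<phi> K"
    using assms(1) unfolding self_conformal_system_def by blast
  obtain c \<kappa> s G where "conformal_attractor m \<phi> \<Omega> K c (\<lambda>j. jnorm (\<phi> j)) \<kappa> s G \<alpha>"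
    using conformal_IFS_attractor[OF ifs K] by blast
  then interpret conformal_attractor m \<phi> \<Omega> K c "\<lambda>j. jnorm (\<phi> j)" \<kappa> s G \<alpha> .
  obtain V where "V \<noteq> {}" "open V" "V \<subseteq> \<Omega>" "\<forall>j\<in>{1..m}. \<phi> j ` V \<subseteq> V"
    "\<forall>i\<in>{1..m}. \<forall>j\<in>{1..m}. i \<noteq> j \<longrightarrow> \<phi> i ` V \<inter> \<phi> j ` V = {}"
    using osc unfolding open_set_condition_def by blast
  then interpret conformal_osc m \<phi> \<Omega> K c "\<lambda>j. jnorm (\<phi> j)" \<kappa> s G \<alpha> V
    by unfold_locales auto
  obtain M p A b where M: "stationary_ifs m \<phi> \<Omega> K c M p" and \<mu>: "\<mu> = distr M borel (\<lambda>x. x)"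
    and Ab: "0 < A" "0 < b" "b \<le> 1"
      "\<forall>j\<in>{1..m}. \<forall>x\<in>K. \<forall>y\<in>K. p j x \<le> exp (A * dist x y powr b) * p j y"
    using gibbs_measure_stationary[OF ifs_attractor_axioms gibbs] by blast
  interpret stationary_ifs m \<phi> \<Omega> K c M p by (rule M)
  obtain N where "\<forall>n. \<forall>x\<in>K. card {u \<in> lists {1..m}. length u = n \<and> x \<in> foldr \<phi> u ` K} \<le> N"
    using bounded_multiplicity by blast
  then have "emeasure M overlap = 0" by (intro overlap_null[of N]) (simp add: cover_words_def)
  then have "gibbs_ifs m \<phi> \<Omega> K c M p A b" using Ab by unfold_locales auto
  then obtain D \<eta> where "lipschitz_decay \<mu> T D \<eta>"
    using gibbs_ifs_lipschitz_decay unfolding \<mu> T by blast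
  then show ?thesis using assms(2-5) by (rule lipschitz_decay.exponentially_mixing)
qed

end
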